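(* Let $\mathbb{F}_q$ be a finite field with $q$ elements, of characteristic $p$. The twist zeta function of $\mathrm{GL}_2(\mathbb{F}_q)$ is $$\tilde{\zeta}_{\mathrm{GL}_2(\mathbb{F}_q)}(s)=\begin{cases}1+q^{-s}+\frac{1}{2}(q-1)(q+1)^{-s}+\frac{1}{2}(q+1)(q-1)^{-s} & \text{if }p\neq2,\\[3pt] 1+q^{-s}+\frac{1}{2}(q-2)(q+1)^{-s}+\frac{1}{2}q(q-1)^{-s} & \text{if }p=2.\end{cases}$$
   Context: Representations are complex. Two representations $\rho,\sigma$ of a group $G$ are twist equivalent if there exists a one-dimensional representation $\chi$ of $G$ such that $\rho\cong\sigma\otimes\chi$. The corresponding equivalence classes are called twist isoclasses; all members of a twist isoclass have the same dimension, which is called the dimension of the twist isoclass. $\tilde r_i(G)$ denotes the number of twist isoclasses of irreducible representations of $G$ of dimension $i$, and the twist zeta function of $G$ is $\tilde\zeta_G(s)=\sum_{i=1}^{\infty}\tilde r_i(G)i^{-s}$, where $s$ is a complex variable.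
   Formalization: The case q = 2 is excluded: there the printed formula gives 2 + 2^{-s}, but GL_2(F_2) is S_3, whose trivial and sign representations are twist equivalent, so its twist zeta function is 1 + 2^{-s}. *)

theory Defs
  imports
    "HOL-Analysis.Analysis"
    "Jordan_Normal_Form.VS_Connect"
begin

definition GL :: "'a::comm_ring_1 itself \<Rightarrow> nat \<Rightarrow> 'a mat monoid" where
  "GL ty n = units_of (ring_mat ty n ())"

(* A complex representation of dimension n is a homomorphism into GL_n(C); its values outside
   the carrier of G are unconstrained and never inspected below. *)
definition representation :: "('g, 'b) monoid_scheme \<Rightarrow> nat \<Rightarrow> ('g \<Rightarrow> complex mat) \<Rightarrow> bool" where
  "representation G n \<rho> \<longleftrightarrow> \<rho> \<in> hom G (GL TYPE(complex) n)"

definition irreducible_rep :: "('g, 'b) monoid_scheme \<Rightarrow> nat \<Rightarrow> ('g \<Rightarrow> complex mat) \<Rightarrow> bool" where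
  "irreducible_rep G n \<rho> \<longleftrightarrow> representation G n \<rho> \<and> 0 < n \<and>
     (\<forall>W. VectorSpace.subspace class_ring W (module_vec TYPE(complex) n) \<and>
          (\<forall>g\<in>carrier G. \<forall>w\<in>W. \<rho> g *\<^sub>v w \<in> W) \<longrightarrow> W = {0\<^sub>v n} \<or> W = carrier_vec n)"

definition rep_iso ::
  "('g, 'b) monoid_scheme \<Rightarrow> nat \<Rightarrow> ('g \<Rightarrow> complex mat) \<Rightarrow> ('g \<Rightarrow> complex mat) \<Rightarrow> bool" where
  "rep_iso G n \<rho> \<sigma> \<longleftrightarrow>
     (\<exists>P \<in> carrier (GL TYPE(complex) n). \<forall>g\<in>carrier G. P * \<rho> g = \<sigma> g * P)"

(* Kronecker product: the matrix of A \<otimes> B in the lexicographically ordered basis of the e_i \<otimes> e_k. *)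
definition kronecker :: "'a::times mat \<Rightarrow> 'a mat \<Rightarrow> 'a mat" where
  "kronecker A B = mat (dim_row A * dim_row B) (dim_col A * dim_col B)
     (\<lambda>(i, j). A $$ (i div dim_row B, j div dim_col B) * B $$ (i mod dim_row B, j mod dim_col B))"

definition rep_tensor ::
  "('g \<Rightarrow> complex mat) \<Rightarrow> ('g \<Rightarrow> complex mat) \<Rightarrow> 'g \<Rightarrow> complex mat" where
  "rep_tensor \<sigma> \<psi> = (\<lambda>g. kronecker (\<sigma> g) (\<psi> g))"

definition twist_equivalent ::
  "('g, 'b) monoid_scheme \<Rightarrow> nat \<Rightarrow> ('g \<Rightarrow> complex mat) \<Rightarrow> ('g \<Rightarrow> complex mat) \<Rightarrow> bool" where
  "twist_equivalent G n \<rho> \<sigma> \<longleftrightarrow> (\<exists>\<psi>. representation G 1 \<psi> \<and> rep_iso G n \<rho> (rep_tensor \<sigma> \<psi>))"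

(* Twist equivalent representations have equal dimension, so the relation is taken on the
   irreducible representations of each dimension n separately. *)
definition twist_isoclasses ::
  "('g, 'b) monoid_scheme \<Rightarrow> nat \<Rightarrow> ('g \<Rightarrow> complex mat) set set" where
  "twist_isoclasses G n =
     {\<rho>. irreducible_rep G n \<rho>} //
       {(\<rho>, \<sigma>). irreducible_rep G n \<rho> \<and> irreducible_rep G n \<sigma> \<and> twist_equivalent G n \<rho> \<sigma>}"

definition twist_count :: "('g, 'b) monoid_scheme \<Rightarrow> nat \<Rightarrow> nat" where
  "twist_count G n = card (twist_isoclasses G n)"

definition twist_zeta_term :: "('g, 'b) monoid_scheme \<Rightarrow> complex \<Rightarrow> nat \<Rightarrow> complex" where
  "twist_zeta_term G s i = of_nat (twist_count G i) * of_nat i powr (- s)"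

definition twist_zeta :: "('g, 'b) monoid_scheme \<Rightarrow> complex \<Rightarrow> complex" where
  "twist_zeta G s = (\<Sum>i. twist_zeta_term G s (Suc i))"

end

theory Submission
  imports Defs "Jordan_Normal_Form.Spectral_Radius" "Jordan_Normal_Form.Schur_Decomposition"
begin

text \<open>Write \<open>G\<close> for the group of invertible matrices of size two over the field with \<open>q\<close> elements. Irreducible
representations are determined by their characters, and twisting multiplies characters by linear
characters; so twist isoclasses are orbits of the group of linear characters on the irreducible
characters (\<open>twist_isoclasses_count\<close>), and the orbits have to be counted by degree. No irreducible
representation is constructed; everything follows from column orthogonality (\<open>sum_irr_chars_pair\<close>), which
evaluates \<open>\<Sum>\<chi>. \<chi> x * \<chi> (inv y)\<close> as the number of elements conjugating \<open>y\<close> to \<open>x\<close>.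

The total number of orbits. For \<open>q > 2\<close> the linear characters of \<open>G\<close> are those of the multiplicative group
of the field composed with the determinant. By Burnside's counting and column orthogonality the number
of orbits is the number of conjugacy classes of \<open>G\<close> of determinant one (\<open>card_all_orbits\<close>). There is one
nonscalar class for each trace, so this number is \<open>q + s\<close>, where \<open>s\<close> is the number of \<open>z\<close> with \<open>z^2 = 1\<close>.

The degrees. Restrict an irreducible character \<open>\<chi>\<close> to the upper unipotent matrices. The nontrivial
characters of this group all occur with the same multiplicity \<open>m\<close> (\<open>whittaker_mult\<close>), hence the degree of
\<open>\<chi>\<close> is \<open>a + (q - 1) * m\<close>, where \<open>a\<close> is the dimension of the unipotent invariants. The case \<open>m = 0\<close> occurs
exactly for the \<open>q - 1\<close> linear characters. The sum of all \<open>m^2\<close> is \<open>q * (q - 1)\<close>, and this is also the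
number of characters with \<open>m > 0\<close>, because there are \<open>(q - 1) * (q + 1)\<close> conjugacy classes; so \<open>m = 1\<close> for
all of them (\<open>whittaker_one\<close>). On the invariants the diagonal matrices act through pairs \<open>(c, d)\<close> of
characters. For each pair the sum over \<open>\<chi>\<close> of \<open>m\<close> times the multiplicity of \<open>(c, d)\<close> is \<open>1\<close>, and the sum of
the degrees times this multiplicity is \<open>q + 1\<close>. Therefore exactly one \<open>\<chi>\<close> with \<open>m = 1\<close> contains \<open>(c, d)\<close>,
and its degree is \<open>q + 1\<close> if \<open>c \<noteq> d\<close> and \<open>q\<close> if \<open>c = d\<close> (\<open>principal_series\<close>). The \<open>\<chi>\<close> with \<open>m = 1\<close> and
\<open>a = 0\<close> have degree \<open>q - 1\<close>.

The count. The linear characters form one orbit, and so do the characters of degree \<open>q\<close>. In degree \<open>q + 1\<close>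
an orbit is determined by \<open>c / d\<close> up to inversion, which gives \<open>((q - 2) + (s - 1)) / 2\<close> orbits
(\<open>card_orbits_principal\<close>). The remaining orbits have degree \<open>q - 1\<close> (\<open>card_orbits_total\<close>). Finally \<open>s\<close> is \<open>1\<close>
in characteristic two and \<open>2\<close> otherwise, and the four degrees are distinct because \<open>q > 2\<close>.\<close>

text \<open>Matrices, vectors and determinants are those with explicit dimensions; their type-indexed namesakes
are hidden.\<close>

hide_const (open) Determinants.det Determinants.trace Finite_Cartesian_Product.mat
  Finite_Cartesian_Product.row Finite_Cartesian_Product.column Finite_Cartesian_Product.vec
unbundle no vec_syntax

section \<open>Sums, traces and adapted bases of matrices\<close>

definition mtrace :: "'a::comm_monoid_add mat \<Rightarrow> 'a" where
  "mtrace A = (\<Sum>i<dim_row A. A $$ (i, i))"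

text \<open>The matrix types carry no additive group structure, because the zero matrix depends on the
  dimensions; finite sums of matrices are therefore formed entrywise, with the dimensions given.\<close>
definition msum :: "nat \<Rightarrow> nat \<Rightarrow> ('i \<Rightarrow> 'a::comm_monoid_add mat) \<Rightarrow> 'i set \<Rightarrow> 'a mat" where
  "msum r c f A = mat r c (\<lambda>ij. \<Sum>a\<in>A. f a $$ ij)"

lemma msum_carrier [simp]: "msum r c f A \<in> carrier_mat r c"
  by (simp add: msum_def)

lemma msum_index [simp]:
  "i < r \<Longrightarrow> j < c \<Longrightarrow> msum r c f A $$ (i, j) = (\<Sum>a\<in>A. f a $$ (i, j))"
  by (simp add: msum_def)

lemma msum_dim [simp]: "dim_row (msum r c f A) = r" "dim_col (msum r c f A) = c"
  by (simp_all add: msum_def)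

lemma mult_entry:
  fixes A B :: "'a::semiring_0 mat"
  assumes "A \<in> carrier_mat r m" "B \<in> carrier_mat m c" "i < r" "j < c"
  shows "(A * B) $$ (i, j) = (\<Sum>k<m. A $$ (i, k) * B $$ (k, j))"
  using assms by (simp add: scalar_prod_def atLeast0LessThan)

lemma mult_msum:
  fixes B :: "'a::semiring_0 mat"
  assumes B: "B \<in> carrier_mat n r" and f: "\<And>a. a \<in> A \<Longrightarrow> f a \<in> carrier_mat r c"
  shows "B * msum r c f A = msum n c (\<lambda>a. B * f a) A"
proof (rule eq_matI)
  fix i j assume "i < dim_row (msum n c (\<lambda>a. B * f a) A)" "j < dim_col (msum n c (\<lambda>a. B * f a) A)"
  then have ij: "i < n" "j < c" by simp_all
  have "(B * msum r c f A) $$ (i, j) = (\<Sum>k<r. \<Sum>a\<in>A. B $$ (i, k) * f a $$ (k, j))"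
    using ij by (simp add: mult_entry[OF B msum_carrier] sum_distrib_left)
  also have "\<dots> = (\<Sum>a\<in>A. (B * f a) $$ (i, j))"
    by (subst sum.swap, intro sum.cong refl) (simp add: mult_entry[OF B f] ij)
  finally show "(B * msum r c f A) $$ (i, j) = msum n c (\<lambda>a. B * f a) A $$ (i, j)"
    using ij by simp
qed (use B in auto)

lemma msum_mult:
  fixes B :: "'a::semiring_0 mat"
  assumes B: "B \<in> carrier_mat c n" and f: "\<And>a. a \<in> A \<Longrightarrow> f a \<in> carrier_mat r c"
  shows "msum r c f A * B = msum r n (\<lambda>a. f a * B) A"
proof (rule eq_matI)
  fix i j assume "i < dim_row (msum r n (\<lambda>a. f a * B) A)" "j < dim_col (msum r n (\<lambda>a. f a * B) A)"
  then have ij: "i < r" "j < n" by simp_all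
  have "(msum r c f A * B) $$ (i, j) = (\<Sum>k<c. \<Sum>a\<in>A. f a $$ (i, k) * B $$ (k, j))"
    using ij by (simp add: mult_entry[OF msum_carrier B] sum_distrib_right)
  also have "\<dots> = (\<Sum>a\<in>A. (f a * B) $$ (i, j))"
    by (subst sum.swap, intro sum.cong refl) (simp add: mult_entry[OF f B] ij)
  finally show "(msum r c f A * B) $$ (i, j) = msum r n (\<lambda>a. f a * B) A $$ (i, j)"
    using ij by simp
qed (use B in auto)

lemma msum_cong: "A = B \<Longrightarrow> (\<And>a. a \<in> B \<Longrightarrow> f a = g a) \<Longrightarrow> msum r c f A = msum r c g B"
  unfolding msum_def by (intro arg_cong[where f="mat r c"] ext sum.cong) auto

lemma msum_reindex:
  assumes "bij_betw h A B"
  shows "msum r c (\<lambda>a. f (h a)) A = msum r c f B"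
  unfolding msum_def by (intro arg_cong[where f="mat r c"] ext sum.reindex_bij_betw assms)

lemma mtrace_msum:
  assumes "\<And>a. a \<in> A \<Longrightarrow> f a \<in> carrier_mat n n"
  shows "mtrace (msum n n f A) = (\<Sum>a\<in>A. mtrace (f a))"
proof -
  have "mtrace (msum n n f A) = (\<Sum>i<n. \<Sum>a\<in>A. f a $$ (i, i))" by (simp add: mtrace_def)
  also have "\<dots> = (\<Sum>a\<in>A. \<Sum>i<n. f a $$ (i, i))" by (rule sum.swap)
  also have "\<dots> = (\<Sum>a\<in>A. mtrace (f a))"
    by (intro sum.cong refl) (use assms in \<open>auto simp: mtrace_def\<close>)
  finally show ?thesis .
qed

lemma mtrace_mult_commute:
  fixes A B :: "'a::comm_semiring_0 mat"
  assumes A: "A \<in> carrier_mat r c" and B: "B \<in> carrier_mat c r"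
  shows "mtrace (A * B) = mtrace (B * A)"
proof -
  have "mtrace (A * B) = (\<Sum>i<r. \<Sum>k<c. A $$ (i, k) * B $$ (k, i))"
    using A by (auto simp: mtrace_def mult_entry[OF A B] simp del: index_mult_mat(1))
  also have "\<dots> = (\<Sum>k<c. \<Sum>i<r. B $$ (k, i) * A $$ (i, k))"
    by (subst sum.swap) (simp add: mult.commute)
  also have "\<dots> = mtrace (B * A)"
    using B by (auto simp: mtrace_def mult_entry[OF B A] simp del: index_mult_mat(1))
  finally show ?thesis .
qed

lemma mtrace_one [simp]: "mtrace (1\<^sub>m n :: 'a::semiring_1 mat) = of_nat n"
  by (simp add: mtrace_def)

lemma mtrace_smult:
  "mtrace (c \<cdot>\<^sub>m A) = c * mtrace (A :: 'a::semiring_0 mat)" if "A \<in> carrier_mat n n"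
  using that by (auto simp: mtrace_def sum_distrib_left)

lemma mult_cancel_inverse_left:
  fixes X :: "'a::comm_ring_1 mat"
  assumes "P \<in> carrier_mat n n" "Q \<in> carrier_mat n n" "Q * P = 1\<^sub>m n" "X \<in> carrier_mat n c"
  shows "Q * (P * X) = X"
  using assms by (metis assoc_mult_mat left_mult_one_mat)

lemma mtrace_similar:
  fixes A :: "'a::comm_ring_1 mat"
  assumes "A \<in> carrier_mat n n" "P \<in> carrier_mat n n" "Q \<in> carrier_mat n n" "Q * P = 1\<^sub>m n"
  shows "mtrace (P * A * Q) = mtrace A"
proof -
  have "mtrace (P * A * Q) = mtrace (Q * (P * A))"
    by (rule mtrace_mult_commute[of _ n n]) (use assms in auto)
  then show ?thesis using assms by (simp add: mult_cancel_inverse_left)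
qed

lemma mult_mat_unit_vec:
  fixes P :: "'a::semiring_1 mat"
  assumes "P \<in> carrier_mat r n" "j < n"
  shows "P *\<^sub>v unit_vec n j = col P j"
  using assms by (intro eq_vecI) (auto simp: scalar_prod_right_unit)

lemma mat_eqI_mult_vec:
  fixes A B :: "'a::comm_ring_1 mat"
  assumes A: "A \<in> carrier_mat r c" and B: "B \<in> carrier_mat r c"
    and eq: "\<And>v. v \<in> carrier_vec c \<Longrightarrow> A *\<^sub>v v = B *\<^sub>v v"
  shows "A = B"
proof (rule eq_matI)
  fix i j assume "i < dim_row B" "j < dim_col B"
  then have ij: "i < r" "j < c" using B by auto
  have "col A j = A *\<^sub>v unit_vec c j" "col B j = B *\<^sub>v unit_vec c j"
    using mult_mat_unit_vec[OF A ij(2)] mult_mat_unit_vec[OF B ij(2)] by simp_all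
  then have "col A j = col B j" using eq by simp
  then have "col A j $ i = col B j $ i" by simp
  then show "A $$ (i, j) = B $$ (i, j)" using A B ij by auto
qed (use A B in auto)

lemma smult_smult_mat: "c \<cdot>\<^sub>m (d \<cdot>\<^sub>m A) = (c * d) \<cdot>\<^sub>m (A :: 'a::semigroup_mult mat)"
  by (rule eq_matI) (simp_all add: mult.assoc)

lemma kronecker_one_dim:
  fixes A :: "'a::comm_monoid_mult mat"
  assumes "A \<in> carrier_mat n n" "B \<in> carrier_mat 1 1"
  shows "kronecker A B = mat n n (\<lambda>(i, j). A $$ (i, j) * B $$ (0, 0))"
  using assms by (auto simp: kronecker_def)

definition elem_mat :: "nat \<Rightarrow> nat \<Rightarrow> nat \<Rightarrow> nat \<Rightarrow> complex mat" where
  "elem_mat n m i j = mat n m (\<lambda>(a, b). if a = i \<and> b = j then 1 else 0)"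

text \<open>Matrix units pick out single products of matrix entries; averaging them over a group turns an
  identity between matrices into the orthogonality of matrix coefficients.\<close>
lemma mult_elem_mat_mult:
  assumes A: "A \<in> carrier_mat n n" and B: "B \<in> carrier_mat m m" and "i < n" "j < m" "a < n" "b < m"
  shows "(A * elem_mat n m i j * B) $$ (a, b) = A $$ (a, i) * B $$ (j, b)"
proof -
  have E: "elem_mat n m i j \<in> carrier_mat n m" by (simp add: elem_mat_def)
  have AE: "(A * elem_mat n m i j) $$ (a, l) = (if l = j then A $$ (a, i) else 0)" if "l < m" for l
  proof -
    have "(A * elem_mat n m i j) $$ (a, l) = (\<Sum>k<n. if k = i then (if l = j then A $$ (a, i) else 0) else 0)"
      unfolding mult_entry[OF A E assms(5) that]
      by (rule sum.cong) (use that in \<open>auto simp: elem_mat_def\<close>)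
    then show ?thesis using assms by simp
  qed
  have "(A * elem_mat n m i j * B) $$ (a, b) = (\<Sum>l<m. if l = j then A $$ (a, i) * B $$ (j, b) else 0)"
    unfolding mult_entry[OF mult_carrier_mat[OF A E] B assms(5,6)]
    by (rule sum.cong) (auto simp: AE)
  then show ?thesis using assms by simp
qed

text \<open>An entry at distance \<open>d\<close> above the diagonal of \<open>B * B\<close> only involves entries of \<open>B\<close> at smaller
  distance, so \<open>B\<close> vanishes one diagonal after the other.\<close>
lemma upper_triangular_idempotent_zero_diag:
  fixes B :: "'a::idom mat"
  assumes B: "B \<in> carrier_mat n n" and tri: "upper_triangular B" and idem: "B * B = B"
    and diag: "\<And>i. i < n \<Longrightarrow> B $$ (i, i) = 0"
  shows "B = 0\<^sub>m n n"
proof -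
  have *: "i < n \<Longrightarrow> j < n \<Longrightarrow> j < i + d \<Longrightarrow> B $$ (i, j) = 0" for d i j
  proof (induction d arbitrary: i j rule: less_induct)
    case (less d)
    show ?case
    proof (cases "j \<le> i")
      case True
      then show ?thesis using tri diag less.prems B by (cases "j = i") (auto simp: upper_triangular_def)
    next
      case False
      have "B $$ (i, j) = (\<Sum>k<n. B $$ (i, k) * B $$ (k, j))"
        using mult_entry[OF B B less.prems(1,2)] by (simp add: idem)
      also have "\<dots> = 0"
      proof (rule sum.neutral, intro ballI)
        fix k assume k: "k \<in> {..<n}"
        consider "k < i" | "k = i" | "i < k" "k < j" | "j \<le> k" by linarith
        then show "B $$ (i, k) * B $$ (k, j) = 0"
        proof cases
          case 1 then show ?thesis using tri less.prems B k by (auto simp: upper_triangular_def)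
        next
          case 2 then show ?thesis using diag less.prems by simp
        next
          case 3
          then have "k < i + (d - 1)" "d - 1 < d" using less.prems by linarith+
          then show ?thesis using less.IH less.prems k by simp
        next
          case 4
          then show ?thesis using tri diag less.prems B k
            by (cases "k = j") (auto simp: upper_triangular_def)
        qed
      qed
      finally show ?thesis .
    qed
  qed
  show ?thesis
    by (rule eq_matI) (use B in \<open>auto intro!: *[of _ _ n]\<close>)
qed

text \<open>After triangularisation the diagonal entries of an idempotent are \<open>0\<close> or \<open>1\<close>. These two statements
  replace the dimension of an isotypic subspace throughout: multiplicities are traces of projections,
  and a multiplicity zero means that the projection is zero.\<close>
lemma idempotent_mtrace:
  fixes E :: "complex mat"
  assumes E: "E \<in> carrier_mat n n" and idem: "E * E = E"
  shows "mtrace E \<in> \<nat>" and "mtrace E = 0 \<Longrightarrow> E = 0\<^sub>m n n"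
proof -
  obtain es where "char_poly E = (\<Prod>a\<leftarrow>es. [:- a, 1:])" using char_poly_factorized[OF E] by blast
  then obtain B where B: "B \<in> carrier_mat n n" "upper_triangular B" "similar_mat E B"
    using schur_decomposition_exists[OF E] by blast
  obtain P Q where wit: "similar_mat_wit E B P Q" using B(3) by (auto simp: similar_mat_def)
  note w = similar_mat_witD2[OF E wit]
  have P: "P \<in> carrier_mat n n" and Q: "Q \<in> carrier_mat n n" and PQ: "P * Q = 1\<^sub>m n" and QP: "Q * P = 1\<^sub>m n"
    and EB: "E = P * B * Q" using w by auto
  note cancel = mult_cancel_inverse_left[OF P Q QP]
  have "B = Q * E * P" unfolding EB using P Q B(1) QP cancel
    by (simp add: assoc_mult_mat[of _ n n _ n _ n])
  moreover have "Q * E * P * (Q * E * P) = Q * (E * E) * P"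
  proof -
    have "Q * E * P * (Q * E * P) = Q * (E * (P * Q * (E * P)))"
      using P Q E by (simp add: assoc_mult_mat[of _ n n _ n _ n])
    also have "\<dots> = Q * (E * E) * P"
      using P Q E PQ by (simp add: assoc_mult_mat[of _ n n _ n _ n])
    finally show ?thesis .
  qed
  ultimately have BB: "B * B = B" using idem by simp
  have diag: "B $$ (i, i) = 0 \<or> B $$ (i, i) = 1" if i: "i < n" for i
  proof -
    have "B $$ (i, i) = (\<Sum>k<n. B $$ (i, k) * B $$ (k, i))"
      using mult_entry[OF B(1) B(1) i i] by (simp add: BB)
    also have "\<dots> = (\<Sum>k<n. if k = i then B $$ (i, i) * B $$ (i, i) else 0)"
    proof (rule sum.cong)
      fix k assume "k \<in> {..<n}"
      then show "B $$ (i, k) * B $$ (k, i) = (if k = i then B $$ (i, i) * B $$ (i, i) else 0)"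
        using B(1,2) i by (cases k i rule: linorder_cases) (auto simp: upper_triangular_def)
    qed simp
    also have "\<dots> = B $$ (i, i) * B $$ (i, i)" using i by simp
    finally show ?thesis by simp
  qed
  have tr: "mtrace E = (\<Sum>i<n. B $$ (i, i))"
    using mtrace_similar[OF B(1) P Q QP] B(1) by (simp add: EB) (simp add: mtrace_def)
  have tr': "mtrace E = of_nat (card {i. i < n \<and> B $$ (i, i) = 1})"
  proof -
    have "(\<Sum>i<n. B $$ (i, i)) = (\<Sum>i<n. if B $$ (i, i) = 1 then 1 else 0)"
      by (rule sum.cong) (use diag in auto)
    also have "\<dots> = of_nat (card {i. i < n \<and> B $$ (i, i) = 1})"
      by (simp add: sum.If_cases Collect_conj_eq lessThan_def)
    finally show ?thesis by (simp add: tr)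
  qed
  then show "mtrace E \<in> \<nat>" by simp
  assume "mtrace E = 0"
  then have "{i. i < n \<and> B $$ (i, i) = 1} = {}" using tr' by simp
  then have "B = 0\<^sub>m n n"
    using upper_triangular_idempotent_zero_diag[OF B(1,2) BB] diag by blast
  then show "E = 0\<^sub>m n n" using EB P Q by simp
qed

lemma idempotent_mtrace_full:
  fixes E :: "complex mat"
  assumes E: "E \<in> carrier_mat n n" and idem: "E * E = E" and tr: "mtrace E = of_nat n"
  shows "E = 1\<^sub>m n"
proof -
  let ?F = "1\<^sub>m n - E"
  have "?F * ?F = ?F - E * ?F"
    using minus_mult_distrib_mat[of "1\<^sub>m n" n n E ?F n] E by (metis left_mult_one_mat minus_carrier_mat one_carrier_mat)
  also have "E * ?F = 0\<^sub>m n n"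
    using E idem by (simp add: mult_minus_distrib_mat[of E n n "1\<^sub>m n" n E])
  finally have "?F * ?F = ?F" using E by auto
  moreover have "mtrace ?F = 0"
    using E tr by (auto simp: mtrace_def sum_subtractf)
  ultimately have F: "?F = 0\<^sub>m n n" using idempotent_mtrace(2)[of ?F n] minus_carrier_mat[OF E] by blast
  show ?thesis
  proof (rule eq_matI)
    fix i j assume ij: "i < dim_row (1\<^sub>m n :: complex mat)" "j < dim_col (1\<^sub>m n :: complex mat)"
    then have "?F $$ (i, j) = 0" using F by simp
    then show "E $$ (i, j) = 1\<^sub>m n $$ (i, j)" using ij E by auto
  qed (use E in auto)
qed

lemma subspace_vec_iff:
  "VectorSpace.subspace class_ring W (module_vec TYPE('a::field) n) \<longleftrightarrow>
     W \<subseteq> carrier_vec n \<and> 0\<^sub>v n \<in> W \<and> (\<forall>v\<in>W. \<forall>w\<in>W. v + w \<in> W) \<and> (\<forall>c. \<forall>v\<in>W. c \<cdot>\<^sub>v v \<in> W)"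
proof -
  have vs: "vectorspace class_ring (module_vec TYPE('a) n)" by (rule vec_vs)
  then have "module class_ring (module_vec TYPE('a) n)" by (simp add: vectorspace_def)
  then show ?thesis using vs
    by (auto simp: subspace_def submodule_def module_vec_simps class_ring_simps)
qed

lemma mult_mat_vec_eq_cols:
  fixes P :: "'a::field mat"
  assumes "P \<in> carrier_mat n n" "v \<in> carrier_vec n" "i < n"
  shows "(P *\<^sub>v v) $ i = (\<Sum>j<n. P $$ (i, j) * v $ j)"
  using assms by (auto simp: scalar_prod_def atLeast0LessThan)

text \<open>Steinitz exchange: among the invertible matrices take one with the largest number \<open>k\<close> of initial
  columns in \<open>W\<close>. A vector of \<open>W\<close> with a nonzero coordinate beyond \<open>k\<close> could be exchanged into the
  basis and would increase \<open>k\<close>.\<close>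
lemma adapted_basis:
  fixes W :: "'a::field vec set"
  assumes W: "VectorSpace.subspace class_ring W (module_vec TYPE('a) n)"
    and W0: "W \<noteq> {0\<^sub>v n}" and W1: "W \<noteq> carrier_vec n"
  obtains P Q k where "P \<in> carrier_mat n n" "Q \<in> carrier_mat n n" "P * Q = 1\<^sub>m n" "Q * P = 1\<^sub>m n"
    "0 < k" "k < n" "\<And>j. j < k \<Longrightarrow> col P j \<in> W" "\<And>w i. w \<in> W \<Longrightarrow> k \<le> i \<Longrightarrow> i < n \<Longrightarrow> (Q *\<^sub>v w) $ i = 0"
proof -
  note Ws = W[unfolded subspace_vec_iff]
  define good where "good k \<longleftrightarrow> k \<le> n \<and> (\<exists>P\<in>carrier_mat n n. \<exists>Q\<in>carrier_mat n n.
    P * Q = 1\<^sub>m n \<and> Q * P = 1\<^sub>m n \<and> (\<forall>j<k. col P j \<in> W))" for k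
  have "good 0" unfolding good_def by (auto intro!: bexI[of _ "1\<^sub>m n"])
  moreover have "\<forall>k. good k \<longrightarrow> k \<le> n" by (simp add: good_def)
  ultimately have "\<exists>k. good k \<and> (\<forall>k'. good k' \<longrightarrow> k' \<le> k)" by (rule Nat.ex_has_greatest_nat[of good])
  then obtain k where k: "good k" and kmax: "\<And>k'. good k' \<Longrightarrow> k' \<le> k" by blast
  obtain P Q where P: "P \<in> carrier_mat n n" and Q: "Q \<in> carrier_mat n n"
    and PQ: "P * Q = 1\<^sub>m n" and QP: "Q * P = 1\<^sub>m n" and cols: "\<And>j. j < k \<Longrightarrow> col P j \<in> W" and kn: "k \<le> n"
    using k by (auto simp: good_def)
  have coords: "(Q *\<^sub>v w) $ i = 0" if w: "w \<in> W" and i: "k \<le> i" "i < n" for w i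
  proof (rule ccontr)
    let ?c = "Q *\<^sub>v w"
    assume ci: "?c $ i \<noteq> 0"
    have wc: "w \<in> carrier_vec n" using w Ws by auto
    have c: "?c \<in> carrier_vec n" using Q wc by auto
    \<comment> \<open>In coordinates: column \<open>k\<close> becomes \<open>w\<close>, and the old column \<open>k\<close> moves to the place of column \<open>i\<close>.\<close>
    define M where "M = mat n n (\<lambda>(r, s). if s = k then ?c $ r
      else if s = i then (if r = k then 1 else 0) else (if r = s then 1 else (0::'a)))"
    have M: "M \<in> carrier_mat n n" by (simp add: M_def)
    have "det M \<noteq> 0"
    proof
      assume "det M = 0"
      then obtain v where v: "v \<in> carrier_vec n" "v \<noteq> 0\<^sub>v n" "M *\<^sub>v v = 0\<^sub>v n"
        using det_0_iff_vec_prod_zero_field[OF M] by auto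
      have row0: "(\<Sum>s<n. M $$ (r, s) * v $ s) = 0" if "r < n" for r
        using v mult_mat_vec_eq_cols[OF M v(1) that] that by simp
      have kn': "k < n" using i by simp
      have "(\<Sum>s<n. M $$ (i, s) * v $ s) = (\<Sum>s<n. if s = k then ?c $ i * v $ k else 0)"
        by (rule sum.cong) (use i in \<open>auto simp: M_def\<close>)
      then have vk: "v $ k = 0" using row0[OF i(2)] ci kn' by simp
      have "v $ r = 0" if r: "r < n" for r
      proof (cases "r = k \<or> r = i")
        case True
        have "(\<Sum>s<n. M $$ (k, s) * v $ s) = (\<Sum>s<n. if s = i then v $ i else 0)"
          by (rule sum.cong) (use i kn' vk in \<open>auto simp: M_def\<close>)
        then show ?thesis using row0[OF kn'] i True vk by auto
      next
        case False
        have "(\<Sum>s<n. M $$ (r, s) * v $ s) = (\<Sum>s<n. if s = r then v $ r else 0)"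
          by (rule sum.cong) (use False r vk in \<open>auto simp: M_def\<close>)
        then show ?thesis using row0[OF r] r by simp
      qed
      then show False using v by (auto intro!: eq_vecI)
    qed
    then obtain M' where M': "M' \<in> carrier_mat n n" "M * M' = 1\<^sub>m n" "M' * M = 1\<^sub>m n"
      using det_non_zero_imp_unit[OF M, of "()"] by (auto simp: Units_def ring_mat_def)
    have "M * (M' * Q) = Q" using mult_cancel_inverse_left[OF M'(1) M M'(2)] Q by simp
    then have inv1: "P * M * (M' * Q) = 1\<^sub>m n"
        using P M Q M' PQ by (simp add: assoc_mult_mat[of P n n M n _ n])
    have "Q * (P * M) = M" using mult_cancel_inverse_left[OF P Q QP] M by simp
    then have inv2: "M' * Q * (P * M) = 1\<^sub>m n"
        using P M Q M' by (simp add: assoc_mult_mat[of M' n n Q n _ n])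
    have cols': "col (P * M) j \<in> W" if j: "j < Suc k" for j
    proof -
      have jn: "j < n" using j i by simp
      have colPM: "col (P * M) j = P *\<^sub>v col M j" using P M jn by (intro eq_vecI) auto
      show ?thesis
      proof (cases "j = k")
        case True
        have "col M j = ?c" using c jn True Q by (intro eq_vecI) (auto simp: M_def)
        then have "col (P * M) j = P * Q *\<^sub>v w" using colPM P Q wc by simp
        then show ?thesis using PQ w wc by simp
      next
        case False
        have "col M j = unit_vec n j" using jn False j i
          by (intro eq_vecI) (auto simp: M_def unit_vec_def)
        then have "col (P * M) j = col P j" using colPM P jn by (simp add: mult_mat_unit_vec)
        then show ?thesis using cols j False by simp
      qed
    qed
    have "good (Suc k)" unfolding good_def
    proof (intro conjI)
      have "\<exists>Q'\<in>carrier_mat n n. P * M * Q' = 1\<^sub>m n \<and> Q' * (P * M) = 1\<^sub>m n \<and> (\<forall>j<Suc k. col (P * M) j \<in> W)"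
        by (rule bexI[of _ "M' * Q"]) (use inv1 inv2 cols' mult_carrier_mat[OF M'(1) Q] in blast)+
      then show "\<exists>P'\<in>carrier_mat n n. \<exists>Q'\<in>carrier_mat n n.
          P' * Q' = 1\<^sub>m n \<and> Q' * P' = 1\<^sub>m n \<and> (\<forall>j<Suc k. col P' j \<in> W)"
        by (rule bexI) (use P M in simp)
    qed (use i in simp)
    then show False using kmax by fastforce
  qed
  have "k \<noteq> 0"
  proof
    assume "k = 0"
    have "w = 0\<^sub>v n" if w: "w \<in> W" for w
    proof -
      have wc: "w \<in> carrier_vec n" using w Ws by auto
      have "Q *\<^sub>v w = 0\<^sub>v n" using coords[OF w] \<open>k = 0\<close> Q by (intro eq_vecI) auto
      moreover have "P *\<^sub>v 0\<^sub>v n = 0\<^sub>v n" using P by (intro eq_vecI) auto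
      ultimately have "P * Q *\<^sub>v w = 0\<^sub>v n" using P Q wc by simp
      then show ?thesis using PQ wc by simp
    qed
    then show False using W0 Ws by auto
  qed
  moreover have "k \<noteq> n"
  proof
    assume kn: "k = n"
    have "v \<in> W" if v: "v \<in> carrier_vec n" for v
    proof -
      have vc: "Q *\<^sub>v v \<in> carrier_vec n" using Q v by auto
      \<comment> \<open>Partial sums of the expansion of \<open>v\<close> in the columns of \<open>P\<close>.\<close>
      define part where "part m = vec n (\<lambda>i. \<Sum>j<m. P $$ (i, j) * (Q *\<^sub>v v) $ j)" for m
      have "m \<le> n \<Longrightarrow> part m \<in> W" for m
      proof (induction m)
        case 0
        have "part 0 = 0\<^sub>v n" by (auto simp: part_def)
        then show ?case using Ws by simp
      next
        case (Suc m)
        have "part (Suc m) = part m + (Q *\<^sub>v v) $ m \<cdot>\<^sub>v col P m"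
          using P Suc.prems by (intro eq_vecI) (auto simp: part_def mult.commute)
        then show ?case using Suc Ws cols kn by auto
      qed
      moreover have "part n = P *\<^sub>v (Q *\<^sub>v v)"
        using P by (intro eq_vecI)
          (auto simp: part_def mult_mat_vec_eq_cols[OF P vc] simp del: index_mult_mat_vec)
      moreover have "\<dots> = v" using P Q PQ v by (metis assoc_mult_mat_vec one_mult_mat_vec)
      ultimately show ?thesis by auto
    qed
    then show False using W1 Ws by blast
  qed
  ultimately show ?thesis using that[OF P Q PQ QP _ _ cols coords] kn by simp
qed

section \<open>Representations and Schur's lemma\<close>

lemma GL_group: "group (GL TYPE('a::comm_ring_1) n)"
  unfolding GL_def by (rule monoid.units_group) (rule ring.is_monoid, rule ring_mat)

lemma GL_mult [simp]: "x \<otimes>\<^bsub>GL ty n\<^esub> y = x * y"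
  and GL_one [simp]: "\<one>\<^bsub>GL ty n\<^esub> = 1\<^sub>m n"
  by (simp_all add: GL_def units_of_mult units_of_one ring_mat_simps)

lemma GL_carrier_iff:
  "A \<in> carrier (GL TYPE('a::comm_ring_1) n) \<longleftrightarrow>
     A \<in> carrier_mat n n \<and> (\<exists>B\<in>carrier_mat n n. A * B = 1\<^sub>m n \<and> B * A = 1\<^sub>m n)"
  by (auto simp: GL_def units_of_carrier Units_def ring_mat_simps)

lemma GL_carrier_det:
  "A \<in> carrier (GL TYPE('a::field) n) \<longleftrightarrow> A \<in> carrier_mat n n \<and> Determinant.det A \<noteq> 0"
  using det_non_zero_imp_unit[of A n "()"] unit_imp_det_non_zero[of A n "()"] GL_carrier_iff[of A n]
  by (auto simp: GL_def units_of_carrier)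

lemma sum_list_map_count:
  fixes f :: "'b \<Rightarrow> 'c::comm_semiring_1"
  assumes "finite A" "set xs \<subseteq> A"
  shows "(\<Sum>x\<leftarrow>xs. f x) = (\<Sum>x\<in>A. of_nat (count_list xs x) * f x)"
  using assms(2)
proof (induction xs)
  case (Cons a xs)
  have "(\<Sum>x\<in>A. of_nat (count_list (a # xs) x) * f x)
      = (\<Sum>x\<in>A. (if x = a then f x else 0) + of_nat (count_list xs x) * f x)"
    by (rule sum.cong) (auto simp: algebra_simps)
  then show ?case using Cons assms(1) by (simp add: sum.distrib)
qed simp

text \<open>This counts isomorphism classes by the values of a complete invariant.\<close>
lemma quotient_kernel:
  assumes "finite (F ` A)"
  shows "finite (A // {(x, y). x \<in> A \<and> y \<in> A \<and> F x = F y})"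
    and "card (A // {(x, y). x \<in> A \<and> y \<in> A \<and> F x = F y}) = card (F ` A)"
proof -
  let ?r = "{(x, y). x \<in> A \<and> y \<in> A \<and> F x = F y}"
  have "A // ?r = (\<lambda>x. ?r `` {x}) ` A" by (auto simp: quotient_def)
  also have "\<dots> = (\<lambda>x. {y \<in> A. F y = F x}) ` A" by (intro image_cong) auto
  finally have eq: "A // ?r = (\<lambda>z. {y \<in> A. F y = z}) ` F ` A" by (simp add: image_image)
  have "inj_on (\<lambda>z. {y \<in> A. F y = z}) (F ` A)" by (auto simp: inj_on_def)
  then show "card (A // ?r) = card (F ` A)" by (simp add: eq card_image)
  show "finite (A // ?r)" using assms by (simp add: eq)
qed

locale finite_group = group G for G (structure) +
  assumes finite_carrier [simp]: "finite (carrier G)"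

context finite_group
begin

lemma card_carrier_pos: "card (carrier G) > 0"
  using finite_carrier one_closed by (metis card_gt_0_iff empty_iff)

lemma bij_left: "a \<in> carrier G \<Longrightarrow> bij_betw (\<lambda>x. a \<otimes> x) (carrier G) (carrier G)"
  by (rule bij_betw_byWitness[where f' = "\<lambda>x. inv a \<otimes> x"]) (auto simp: m_assoc[symmetric])

lemma rep_carrier: "representation G n \<rho> \<Longrightarrow> g \<in> carrier G \<Longrightarrow> \<rho> g \<in> carrier_mat n n"
  by (auto simp: representation_def hom_def GL_carrier_iff)

lemma rep_mult: "representation G n \<rho> \<Longrightarrow> g \<in> carrier G \<Longrightarrow> h \<in> carrier G \<Longrightarrow> \<rho> (g \<otimes> h) = \<rho> g * \<rho> h"
  by (auto simp: representation_def hom_def)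

lemma rep_one: "representation G n \<rho> \<Longrightarrow> \<rho> \<one> = 1\<^sub>m n"
  using hom_one[of \<rho> G "GL TYPE(complex) n"] GL_group group_axioms by (auto simp: representation_def)

lemma rep_inv_mult: "representation G n \<rho> \<Longrightarrow> g \<in> carrier G \<Longrightarrow> \<rho> (inv g) * \<rho> g = 1\<^sub>m n"
  by (simp add: rep_mult[symmetric] rep_one)

lemma representationI:
  assumes car: "\<And>g. g \<in> carrier G \<Longrightarrow> \<rho> g \<in> carrier_mat n n"
    and mult: "\<And>g h. g \<in> carrier G \<Longrightarrow> h \<in> carrier G \<Longrightarrow> \<rho> (g \<otimes> h) = \<rho> g * \<rho> h"
    and one: "\<rho> \<one> = 1\<^sub>m n"
  shows "representation G n \<rho>"
  unfolding representation_def
proof (rule homI)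
  fix g assume g: "g \<in> carrier G"
  show "\<rho> g \<in> carrier (GL TYPE(complex) n)" unfolding GL_carrier_iff
    using g by (intro conjI bexI[of _ "\<rho> (inv g)"]) (auto simp: mult[symmetric] one car)
qed (simp add: mult)

definition character :: "('a \<Rightarrow> complex mat) \<Rightarrow> 'a \<Rightarrow> complex" where
  "character \<rho> g = (if g \<in> carrier G then mtrace (\<rho> g) else 0)"

definition irr_chars :: "('a \<Rightarrow> complex) set" where
  "irr_chars = {character \<rho> | n \<rho>. irreducible_rep G n \<rho>}"

lemma irr_rep: "irreducible_rep G n \<rho> \<Longrightarrow> representation G n \<rho>"
  and irr_dim_pos: "irreducible_rep G n \<rho> \<Longrightarrow> 0 < n"
  by (simp_all add: irreducible_rep_def)

lemma character_one: "representation G n \<rho> \<Longrightarrow> character \<rho> \<one> = of_nat n"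
  by (simp add: character_def rep_one)

lemma character_mult_commute:
  assumes "representation G n \<rho>" "g \<in> carrier G" "h \<in> carrier G"
  shows "character \<rho> (g \<otimes> h) = character \<rho> (h \<otimes> g)"
  using assms mtrace_mult_commute[of "\<rho> g" n n "\<rho> h"] by (simp add: character_def rep_mult rep_carrier)

lemma irr_invariant_subspace:
  assumes "irreducible_rep G n \<rho>" "VectorSpace.subspace class_ring W (module_vec TYPE(complex) n)"
    "\<And>g w. g \<in> carrier G \<Longrightarrow> w \<in> W \<Longrightarrow> \<rho> g *\<^sub>v w \<in> W"
  shows "W = {0\<^sub>v n} \<or> W = carrier_vec n"
  using assms by (auto simp: irreducible_rep_def)

text \<open>Kernel and image of an intertwiner are invariant subspaces. That the two dimensions agree follows
  from comparing the traces of \<open>T * S\<close> and \<open>S * T\<close> for the two-sided inverse \<open>S\<close>.\<close>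
lemma schur:
  assumes irr: "irreducible_rep G n \<rho>" "irreducible_rep G m \<sigma>"
    and T: "T \<in> carrier_mat n m" and comm: "\<And>g. g \<in> carrier G \<Longrightarrow> \<rho> g * T = T * \<sigma> g"
    and nz: "T \<noteq> 0\<^sub>m n m"
  shows "n = m" and "T \<in> carrier (GL TYPE(complex) n)"
proof -
  note \<rho> = rep_carrier[OF irr_rep[OF irr(1)]] and \<sigma> = rep_carrier[OF irr_rep[OF irr(2)]]
  have T0: "T *\<^sub>v 0\<^sub>v m = 0\<^sub>v n" using T by (intro eq_vecI) auto
  have comm_vec: "\<rho> g *\<^sub>v (T *\<^sub>v v) = T *\<^sub>v (\<sigma> g *\<^sub>v v)" if "g \<in> carrier G" "v \<in> carrier_vec m" for g v
    using that T \<rho>[OF that(1)] \<sigma>[OF that(1)] comm[OF that(1)] by (metis assoc_mult_mat_vec)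
  have \<rho>0: "\<rho> g *\<^sub>v 0\<^sub>v n = 0\<^sub>v n" if "g \<in> carrier G" for g
    using \<rho>[OF that] by (intro eq_vecI) auto
  let ?K = "{v \<in> carrier_vec m. T *\<^sub>v v = 0\<^sub>v n}"
  have "?K = {0\<^sub>v m} \<or> ?K = carrier_vec m"
  proof (rule irr_invariant_subspace[OF irr(2)])
    show "VectorSpace.subspace class_ring ?K (module_vec TYPE(complex) m)"
      using T T0 by (auto simp: subspace_vec_iff mult_add_distrib_mat_vec[OF T] mult_mat_vec[OF T])
    fix g w assume g: "g \<in> carrier G" and w: "w \<in> ?K"
    show "\<sigma> g *\<^sub>v w \<in> ?K" using w comm_vec[OF g, of w] \<rho>0[OF g] \<sigma>[OF g] by auto
  qed
  moreover have "?K \<noteq> carrier_vec m"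
  proof
    assume K: "?K = carrier_vec m"
    have "T = 0\<^sub>m n m"
    proof (rule mat_eqI_mult_vec[OF T])
      fix v :: "complex vec" assume v: "v \<in> carrier_vec m"
      then have "T *\<^sub>v v = 0\<^sub>v n" using K by blast
      then show "T *\<^sub>v v = 0\<^sub>m n m *\<^sub>v v" using v by auto
    qed simp
    then show False using nz by simp
  qed
  ultimately have K: "?K = {0\<^sub>v m}" by blast
  let ?I = "(\<lambda>v. T *\<^sub>v v) ` carrier_vec m"
  have "?I = {0\<^sub>v n} \<or> ?I = carrier_vec n"
  proof (rule irr_invariant_subspace[OF irr(1)])
    have "T *\<^sub>v v + T *\<^sub>v w \<in> ?I" if "v \<in> carrier_vec m" "w \<in> carrier_vec m" for v w
      using that by (intro image_eqI[of _ _ "v + w"]) (auto simp: mult_add_distrib_mat_vec[OF T])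
    moreover have "c \<cdot>\<^sub>v (T *\<^sub>v v) \<in> ?I" if "v \<in> carrier_vec m" for c v
      using that by (intro image_eqI[of _ _ "c \<cdot>\<^sub>v v"]) (auto simp: mult_mat_vec[OF T])
    moreover have "0\<^sub>v n \<in> ?I" using T0 by (intro image_eqI[of _ _ "0\<^sub>v m"]) auto
    ultimately show "VectorSpace.subspace class_ring ?I (module_vec TYPE(complex) n)"
      using T by (auto simp: subspace_vec_iff)
    fix g w assume g: "g \<in> carrier G" and w: "w \<in> ?I"
    then show "\<rho> g *\<^sub>v w \<in> ?I" using comm_vec[OF g] mult_mat_vec_carrier[OF \<sigma>[OF g]] by auto
  qed
  moreover have "?I \<noteq> {0\<^sub>v n}"
  proof
    assume "?I = {0\<^sub>v n}"
    then have "?K = carrier_vec m" by blast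
    then show False using \<open>?K \<noteq> carrier_vec m\<close> by blast
  qed
  ultimately have I: "?I = carrier_vec n" by blast
  have "\<exists>s\<in>carrier_vec m. T *\<^sub>v s = unit_vec n i" if "i < n" for i
  proof -
    have "unit_vec n i \<in> ?I" using I by simp
    then show ?thesis by force
  qed
  then obtain s where s: "\<And>i. i < n \<Longrightarrow> s i \<in> carrier_vec m \<and> T *\<^sub>v s i = unit_vec n i" by metis
  \<comment> \<open>The columns of \<open>S\<close> are preimages of the unit vectors.\<close>
  define S where "S = mat m n (\<lambda>(a, i). s i $ a)"
  have S: "S \<in> carrier_mat m n" by (simp add: S_def)
  have TS: "T * S = 1\<^sub>m n"
  proof (rule mat_col_eqI)
    fix i assume "i < dim_col (1\<^sub>m n :: complex mat)"
    then have i: "i < n" by simp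
    have "col S i = s i" using s[OF i] i by (intro eq_vecI) (auto simp: S_def)
    moreover have "col (T * S) i = T *\<^sub>v col S i" using T S i by (intro eq_vecI) auto
    ultimately show "col (T * S) i = col (1\<^sub>m n) i" using s[OF i] i by simp
  qed (use T S in auto)
  have ST: "S * T = 1\<^sub>m m"
  proof (rule mat_eqI_mult_vec[of _ m m])
    fix v :: "complex vec" assume v: "v \<in> carrier_vec m"
    have STv: "S * T *\<^sub>v v \<in> carrier_vec m"
      using mult_mat_vec_carrier[OF mult_carrier_mat[OF S T] v] .
    have "T *\<^sub>v (S * T *\<^sub>v v) = T * S *\<^sub>v (T *\<^sub>v v)"
      using S T v by (simp add: assoc_mult_mat_vec[of _ _ m] assoc_mult_mat_vec[of _ _ n])
    also have "\<dots> = T *\<^sub>v v" using TS T v by simp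
    finally have "T *\<^sub>v (S * T *\<^sub>v v - v) = T *\<^sub>v v - T *\<^sub>v v"
      using mult_minus_distrib_mat_vec[OF T STv v] by simp
    then have "S * T *\<^sub>v v - v \<in> ?K" using STv v T by auto
    then have d: "S * T *\<^sub>v v - v = 0\<^sub>v m" using K by blast
    have "S * T *\<^sub>v v = v"
    proof (rule eq_vecI)
      fix i assume i: "i < dim_vec v"
      then have "(S * T *\<^sub>v v - v) $ i = 0" using d v by simp
      then show "(S * T *\<^sub>v v) $ i = v $ i" using i v S T by simp
    qed (use S v in auto)
    then show "S * T *\<^sub>v v = 1\<^sub>m m *\<^sub>v v" using v by simp
  qed (use S T in auto)
  have "(of_nat n :: complex) = of_nat m"
    using mtrace_mult_commute[OF T S] TS ST by simp
  then show nm: "n = m" by simp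
  show "T \<in> carrier (GL TYPE(complex) n)"
    unfolding GL_carrier_iff using T S TS ST nm by auto
qed

text \<open>Over the complex numbers \<open>T\<close> has an eigenvalue \<open>c\<close>, and \<open>T - c\<close> is a singular intertwiner.\<close>
lemma schur_scalar:
  assumes irr: "irreducible_rep G n \<rho>" and T: "T \<in> carrier_mat n n"
    and comm: "\<And>g. g \<in> carrier G \<Longrightarrow> \<rho> g * T = T * \<rho> g"
  obtains c where "T = c \<cdot>\<^sub>m 1\<^sub>m n"
proof -
  obtain c where "eigenvalue T c"
    using spectrum_non_empty[OF T irr_dim_pos[OF irr]] by (auto simp: spectrum_def)
  then obtain v where v: "v \<in> carrier_vec n" "v \<noteq> 0\<^sub>v n" "T *\<^sub>v v = c \<cdot>\<^sub>v v"
    using T by (auto simp: eigenvalue_def eigenvector_def)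
  let ?D = "T - c \<cdot>\<^sub>m 1\<^sub>m n"
  have c1: "c \<cdot>\<^sub>m 1\<^sub>m n \<in> carrier_mat n n" by simp
  have D: "?D \<in> carrier_mat n n" by (rule minus_carrier_mat[OF c1])
  have "?D = 0\<^sub>m n n"
  proof (rule ccontr)
    assume "?D \<noteq> 0\<^sub>m n n"
    moreover have "\<rho> g * ?D = ?D * \<rho> g" if g: "g \<in> carrier G" for g
    proof -
      note \<rho>g = rep_carrier[OF irr_rep[OF irr] g]
      have "\<rho> g * ?D = \<rho> g * T - c \<cdot>\<^sub>m \<rho> g"
        using mult_minus_distrib_mat[OF \<rho>g T c1] \<rho>g mult_smult_distrib[OF \<rho>g one_carrier_mat[of n]] by simp
      also have "\<dots> = ?D * \<rho> g"
        using minus_mult_distrib_mat[OF T c1 \<rho>g] \<rho>g comm[OF g]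
          mult_smult_assoc_mat[OF one_carrier_mat[of n] \<rho>g] by simp
      finally show ?thesis .
    qed
    ultimately have "?D \<in> carrier (GL TYPE(complex) n)" using schur(2)[OF irr irr D] by blast
    then have "Determinant.det ?D \<noteq> 0" by (simp add: GL_carrier_det)
    moreover have "?D *\<^sub>v v = 0\<^sub>v n"
      using minus_mult_distrib_mat_vec[OF T c1 v(1)] v by (auto intro!: eq_vecI)
    ultimately show False using det_0_iff_vec_prod_zero_field[OF D] v by blast
  qed
  have "T = c \<cdot>\<^sub>m 1\<^sub>m n"
  proof (rule eq_matI)
    fix i j assume ij: "i < dim_row (c \<cdot>\<^sub>m 1\<^sub>m n)" "j < dim_col (c \<cdot>\<^sub>m 1\<^sub>m n)"
    then have "?D $$ (i, j) = 0" using \<open>?D = 0\<^sub>m n n\<close> by simp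
    then show "T $$ (i, j) = (c \<cdot>\<^sub>m 1\<^sub>m n) $$ (i, j)" using ij T by simp
  qed (use T in auto)
  then show ?thesis using that by blast
qed

text \<open>All operators are scalar by Schur, so every line is invariant.\<close>
lemma irr_commuting_dim:
  assumes irr: "irreducible_rep G n \<rho>"
    and comm: "\<And>g h. g \<in> carrier G \<Longrightarrow> h \<in> carrier G \<Longrightarrow> \<rho> g * \<rho> h = \<rho> h * \<rho> g"
  shows "n = 1"
proof -
  have n: "0 < n" by (rule irr_dim_pos[OF irr])
  let ?e = "unit_vec n 0 :: complex vec"
  let ?W = "{c \<cdot>\<^sub>v ?e | c. True}"
  have "?W = {0\<^sub>v n} \<or> ?W = carrier_vec n"
  proof (rule irr_invariant_subspace[OF irr])
    have "0\<^sub>v n = 0 \<cdot>\<^sub>v ?e" by auto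
    moreover have "c \<cdot>\<^sub>v ?e + d \<cdot>\<^sub>v ?e = (c + d) \<cdot>\<^sub>v ?e" for c d by (auto simp: add_smult_distrib_vec)
    moreover have "c \<cdot>\<^sub>v (d \<cdot>\<^sub>v ?e) = (c * d) \<cdot>\<^sub>v ?e" for c d by (auto simp: smult_smult_assoc)
    ultimately show "VectorSpace.subspace class_ring ?W (module_vec TYPE(complex) n)"
      unfolding subspace_vec_iff by (fastforce simp del: index_smult_vec)
    fix g w assume g: "g \<in> carrier G" and w: "w \<in> ?W"
    obtain c where c: "\<rho> g = c \<cdot>\<^sub>m 1\<^sub>m n"
      using schur_scalar[OF irr rep_carrier[OF irr_rep[OF irr] g]] comm g by metis
    obtain d where d: "w = d \<cdot>\<^sub>v ?e" using w by blast
    have "\<rho> g *\<^sub>v w = (c * d) \<cdot>\<^sub>v ?e" unfolding c d by (intro eq_vecI) auto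
    then show "\<rho> g *\<^sub>v w \<in> ?W" by blast
  qed
  moreover have "?W \<noteq> {0\<^sub>v n}"
  proof
    assume "?W = {0\<^sub>v n}"
    moreover have "?e = 1 \<cdot>\<^sub>v ?e" by simp
    ultimately have "?e = 0\<^sub>v n" by blast
    then have "?e $ 0 = 0" using n by (metis index_zero_vec(1))
    then show False using n by simp
  qed
  ultimately have W: "?W = carrier_vec n" by blast
  show "n = 1"
  proof (rule ccontr)
    assume "n \<noteq> 1"
    then have n1: "1 < n" using n by simp
    have "unit_vec n 1 \<in> ?W" using W by simp
    then obtain c where "(unit_vec n 1 :: complex vec) = c \<cdot>\<^sub>v ?e" by blast
    then have "(unit_vec n 1 :: complex vec) $ 1 = (c \<cdot>\<^sub>v ?e) $ 1" by simp
    then show False using n1 by simp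
  qed
qed

lemma one_dim_irreducible:
  assumes rep: "representation G 1 \<rho>"
  shows "irreducible_rep G 1 \<rho>"
  unfolding irreducible_rep_def
proof (intro conjI allI impI)
  fix W assume "VectorSpace.subspace class_ring W (module_vec TYPE(complex) 1) \<and>
    (\<forall>g\<in>carrier G. \<forall>w\<in>W. \<rho> g *\<^sub>v w \<in> W)"
  then have W: "W \<subseteq> carrier_vec 1" "0\<^sub>v 1 \<in> W" "\<And>c v. v \<in> W \<Longrightarrow> c \<cdot>\<^sub>v v \<in> W"
    by (auto simp: subspace_vec_iff)
  show "W = {0\<^sub>v 1} \<or> W = carrier_vec 1"
  proof (cases "\<exists>w\<in>W. w \<noteq> 0\<^sub>v 1")
    case True
    then obtain w where w: "w \<in> W" "w \<noteq> 0\<^sub>v 1" by blast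
    then have "w $ 0 \<noteq> 0" using W(1) by (auto intro!: eq_vecI)
    have "v \<in> W" if "v \<in> carrier_vec 1" for v
    proof -
      have "v = (v $ 0 / w $ 0) \<cdot>\<^sub>v w"
        using that W(1) w \<open>w $ 0 \<noteq> 0\<close> by (intro eq_vecI) auto
      then show ?thesis using W(3)[OF w(1)] by metis
    qed
    then show ?thesis using W(1) by blast
  next
    case False
    then show ?thesis using W(2) by blast
  qed
qed (use rep in simp_all)

text \<open>In a basis adapted to an invariant subspace the representation is block triangular, and the diagonal
  blocks are smaller representations whose traces add up. Since only traces matter, no invariant
  complement is needed.\<close>
lemma rep_trace_decomposition:
  "representation G n \<rho> \<Longrightarrow>
    \<exists>cs. set cs \<subseteq> irr_chars \<and> (\<forall>g\<in>carrier G. mtrace (\<rho> g) = (\<Sum>\<chi>\<leftarrow>cs. \<chi> g))"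
proof (induction n arbitrary: \<rho> rule: less_induct)
  case (less n)
  note rep = less.prems
  note \<rho> = rep_carrier[OF rep]
  show ?case
  proof (cases "n = 0 \<or> irreducible_rep G n \<rho>")
    case True
    then show ?thesis
    proof
      assume "n = 0"
      then have "mtrace (\<rho> g) = 0" if "g \<in> carrier G" for g using \<rho>[OF that] by (simp add: mtrace_def)
      then show ?thesis by (intro exI[of _ "[]"]) simp
    next
      assume "irreducible_rep G n \<rho>"
      then have "character \<rho> \<in> irr_chars" by (auto simp: irr_chars_def)
      then show ?thesis by (intro exI[of _ "[character \<rho>]"]) (simp add: character_def)
    qed
  next
    case False
    then obtain W where W: "VectorSpace.subspace class_ring W (module_vec TYPE(complex) n)"
      and inv: "\<And>g w. g \<in> carrier G \<Longrightarrow> w \<in> W \<Longrightarrow> \<rho> g *\<^sub>v w \<in> W"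
      and W0: "W \<noteq> {0\<^sub>v n}" and W1: "W \<noteq> carrier_vec n"
      using rep by (auto simp: irreducible_rep_def)
    obtain P Q k where P: "P \<in> carrier_mat n n" and Q: "Q \<in> carrier_mat n n"
      and PQ: "P * Q = 1\<^sub>m n" and QP: "Q * P = 1\<^sub>m n" and k: "0 < k" "k < n"
      and cols: "\<And>j. j < k \<Longrightarrow> col P j \<in> W"
      and coords: "\<And>w i. w \<in> W \<Longrightarrow> k \<le> i \<Longrightarrow> i < n \<Longrightarrow> (Q *\<^sub>v w) $ i = 0"
      using adapted_basis[OF W W0 W1] by metis
    define R where "R g = Q * \<rho> g * P" for g
    have R: "R g \<in> carrier_mat n n" if "g \<in> carrier G" for g using \<rho>[OF that] P Q by (simp add: R_def)
    have R_mult: "R (g \<otimes> h) = R g * R h" if g: "g \<in> carrier G" and h: "h \<in> carrier G" for g h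
    proof -
      have "R g * R h = Q * \<rho> g * (P * (Q * (\<rho> h * P)))"
        using P Q \<rho>[OF g] \<rho>[OF h] by (simp add: R_def assoc_mult_mat[of _ n n _ n _ n])
      also have "\<dots> = Q * \<rho> g * (\<rho> h * P)"
        using mult_cancel_inverse_left[OF Q P PQ, of "\<rho> h * P" n] \<rho>[OF h] P by simp
      finally show ?thesis
        using P Q \<rho>[OF g] \<rho>[OF h] by (simp add: R_def rep_mult[OF rep g h] assoc_mult_mat[of _ n n _ n _ n])
    qed
    have R_one: "R \<one> = 1\<^sub>m n" using P Q QP by (simp add: R_def rep_one[OF rep])
    have block: "R g $$ (i, j) = 0" if g: "g \<in> carrier G" and "k \<le> i" "i < n" "j < k" for g i j
    proof -
      have jn: "j < n" using that k by simp
      have "R g $$ (i, j) = (Q *\<^sub>v (\<rho> g *\<^sub>v col P j)) $ i"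
      proof -
        have "R g = Q * (\<rho> g * P)" using P Q \<rho>[OF g] by (simp add: R_def)
        moreover have "col (\<rho> g * P) j = \<rho> g *\<^sub>v col P j" using P \<rho>[OF g] jn by (intro eq_vecI) auto
        ultimately show ?thesis using P Q \<rho>[OF g] jn that by simp
      qed
      then show ?thesis using coords inv[OF g] cols that by simp
    qed
    \<comment> \<open>The diagonal block of \<open>R g\<close> of size \<open>m\<close> that starts at position \<open>t\<close>.\<close>
    define blk where "blk t m g = mat m m (\<lambda>(i, j). R g $$ (i + t, j + t))" for t m g
    have split: "(\<Sum>l<n. f l) = (\<Sum>l<k. f l) + (\<Sum>l<n - k. f (l + k))" for f :: "nat \<Rightarrow> complex"
    proof -
      have "(\<Sum>l<n. f l) = (\<Sum>l<k. f l) + (\<Sum>l=k..<n. f l)"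
        using sum.atLeastLessThan_concat[of 0 k n f] k by (simp add: atLeast0LessThan)
      also have "(\<Sum>l=k..<n. f l) = (\<Sum>l<n - k. f (l + k))"
        using sum.shift_bounds_nat_ivl[of f 0 k "n - k"] k by (simp add: atLeast0LessThan)
      finally show ?thesis .
    qed
    have blk_rep: "representation G m (blk t m)"
      if tm: "t + m \<le> n" and prod: "\<And>g h i j. g \<in> carrier G \<Longrightarrow> h \<in> carrier G \<Longrightarrow> i < m \<Longrightarrow> j < m \<Longrightarrow>
        (\<Sum>l<n. R g $$ (i + t, l) * R h $$ (l, j + t)) = (\<Sum>l<m. R g $$ (i + t, l + t) * R h $$ (l + t, j + t))" for t m
    proof (rule representationI)
      fix g h assume g: "g \<in> carrier G" and h: "h \<in> carrier G"
      show "blk t m (g \<otimes> h) = blk t m g * blk t m h"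
      proof (rule eq_matI)
        fix i j assume "i < dim_row (blk t m g * blk t m h)" "j < dim_col (blk t m g * blk t m h)"
        then have ij: "i < m" "j < m" by (simp_all add: blk_def)
        have "blk t m (g \<otimes> h) $$ (i, j) = (\<Sum>l<n. R g $$ (i + t, l) * R h $$ (l, j + t))"
          using ij tm R_mult[OF g h] mult_entry[OF R[OF g] R[OF h], of "i + t" "j + t"] by (simp add: blk_def)
        also have "\<dots> = (blk t m g * blk t m h) $$ (i, j)"
          unfolding prod[OF g h ij] using ij by (subst mult_entry[of _ m m _ m]) (auto simp: blk_def)
        finally show "blk t m (g \<otimes> h) $$ (i, j) = (blk t m g * blk t m h) $$ (i, j)" .
      qed (simp_all add: blk_def)
    next
      show "blk t m \<one> = 1\<^sub>m m" using tm by (intro eq_matI) (auto simp: blk_def R_one)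
    qed (simp add: blk_def)
    have rep1: "representation G k (blk 0 k)"
      by (rule blk_rep) (use k block in \<open>simp_all add: split\<close>)
    have rep2: "representation G (n - k) (blk k (n - k))"
      by (rule blk_rep) (use k block in \<open>simp_all add: split\<close>)
    obtain cs1 where cs1: "set cs1 \<subseteq> irr_chars" "\<And>g. g \<in> carrier G \<Longrightarrow> mtrace (blk 0 k g) = (\<Sum>\<chi>\<leftarrow>cs1. \<chi> g)"
      using less.IH[OF k(2) rep1] by blast
    obtain cs2 where cs2: "set cs2 \<subseteq> irr_chars" "\<And>g. g \<in> carrier G \<Longrightarrow> mtrace (blk k (n - k) g) = (\<Sum>\<chi>\<leftarrow>cs2. \<chi> g)"
      using less.IH[OF _ rep2] k by fastforce
    have "mtrace (\<rho> g) = (\<Sum>\<chi>\<leftarrow>cs1 @ cs2. \<chi> g)" if g: "g \<in> carrier G" for g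
    proof -
      have "mtrace (\<rho> g) = mtrace (R g)"
        using mtrace_similar[OF \<rho>[OF g] Q P PQ] by (simp add: R_def)
      also have "\<dots> = (\<Sum>l<n. R g $$ (l, l))" using R[OF g] by (simp add: mtrace_def)
      also have "\<dots> = mtrace (blk 0 k g) + mtrace (blk k (n - k) g)"
        unfolding split by (simp add: mtrace_def blk_def)
      finally show ?thesis using cs1(2) cs2(2) g by simp
    qed
    then show ?thesis using cs1(1) cs2(1) by (intro exI[of _ "cs1 @ cs2"]) auto
  qed
qed

section \<open>Orthogonality relations and the regular character\<close>

lemma sum_left: "a \<in> carrier G \<Longrightarrow> (\<Sum>g\<in>carrier G. f (a \<otimes> g)) = (\<Sum>g\<in>carrier G. f g)"
  by (rule sum.reindex_bij_betw[OF bij_left])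

text \<open>Averaging an arbitrary matrix over the group yields an intertwiner; Schur's lemma applied to these
  averages gives all orthogonality relations.\<close>
lemma averaged_intertwiner:
  assumes rep: "representation G n \<rho>" "representation G m \<sigma>" and X: "X \<in> carrier_mat n m"
    and h: "h \<in> carrier G"
  defines "T \<equiv> msum n m (\<lambda>g. \<rho> g * X * \<sigma> (inv g)) (carrier G)"
  shows "\<rho> h * T = T * \<sigma> h"
proof -
  note \<rho> = rep_carrier[OF rep(1)] and \<sigma> = rep_carrier[OF rep(2)]
  have car: "\<rho> g * X * \<sigma> (inv g) \<in> carrier_mat n m" if "g \<in> carrier G" for g
    using \<rho>[OF that] \<sigma>[OF inv_closed[OF that]] X by auto
  have "\<rho> h * T = msum n m (\<lambda>g. \<rho> h * (\<rho> g * X * \<sigma> (inv g))) (carrier G)"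
    unfolding T_def by (rule mult_msum[OF \<rho>[OF h] car])
  also have "\<dots> = msum n m (\<lambda>g. \<rho> (h \<otimes> g) * X * \<sigma> (inv (h \<otimes> g)) * \<sigma> h) (carrier G)"
  proof (rule msum_cong[OF refl])
    fix g assume g: "g \<in> carrier G"
    have "\<sigma> (inv g) = \<sigma> (inv (h \<otimes> g)) * \<sigma> h"
      using g h rep_mult[OF rep(2), of "inv (h \<otimes> g)" h] by (simp add: inv_mult_group m_assoc)
    moreover have "\<sigma> (inv (h \<otimes> g)) \<in> carrier_mat m m" using \<sigma> g h by blast
    ultimately show "\<rho> h * (\<rho> g * X * \<sigma> (inv g)) = \<rho> (h \<otimes> g) * X * \<sigma> (inv (h \<otimes> g)) * \<sigma> h"
      using \<rho>[OF g] \<rho>[OF h] \<sigma>[OF h] X assoc_mult_mat[OF \<rho>[OF h] \<rho>[OF g] X]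
        assoc_mult_mat[of "\<rho> h" n n "\<rho> g * X" m "\<sigma> (inv (h \<otimes> g)) * \<sigma> h" m]
        assoc_mult_mat[of "\<rho> h * (\<rho> g * X)" n m "\<sigma> (inv (h \<otimes> g))" m "\<sigma> h" m]
      unfolding rep_mult[OF rep(1) h g] by (metis mult_carrier_mat)
  qed
  also have "\<dots> = msum n m (\<lambda>g. \<rho> g * X * \<sigma> (inv g) * \<sigma> h) (carrier G)"
    by (rule msum_reindex[OF bij_left[OF h], where f = "\<lambda>g. \<rho> g * X * \<sigma> (inv g) * \<sigma> h"])
  also have "\<dots> = T * \<sigma> h"
    unfolding T_def by (rule msum_mult[OF \<sigma>[OF h] car, symmetric])
  finally show ?thesis .
qed

lemma trace_product_sum:
  assumes rep: "representation G n \<rho>" "representation G m \<sigma>"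
  shows "(\<Sum>g\<in>carrier G. mtrace (\<rho> g) * mtrace (\<sigma> (inv g))) =
    (\<Sum>i<n. \<Sum>j<m. msum n m (\<lambda>g. \<rho> g * elem_mat n m i j * \<sigma> (inv g)) (carrier G) $$ (i, j))"
proof -
  note \<rho> = rep_carrier[OF rep(1)] and \<sigma> = rep_carrier[OF rep(2) inv_closed]
  have "(\<Sum>i<n. \<Sum>j<m. msum n m (\<lambda>g. \<rho> g * elem_mat n m i j * \<sigma> (inv g)) (carrier G) $$ (i, j)) =
    (\<Sum>i<n. \<Sum>j<m. \<Sum>g\<in>carrier G. \<rho> g $$ (i, i) * \<sigma> (inv g) $$ (j, j))"
    by (intro sum.cong refl) (simp add: mult_elem_mat_mult[OF \<rho> \<sigma>])
  also have "\<dots> = (\<Sum>g\<in>carrier G. \<Sum>i<n. \<Sum>j<m. \<rho> g $$ (i, i) * \<sigma> (inv g) $$ (j, j))"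
    by (simp only: sum.swap[of _ "carrier G"])
  also have "\<dots> = (\<Sum>g\<in>carrier G. mtrace (\<rho> g) * mtrace (\<sigma> (inv g)))"
  proof (rule sum.cong[OF refl])
    fix g assume g: "g \<in> carrier G"
    show "(\<Sum>i<n. \<Sum>j<m. \<rho> g $$ (i, i) * \<sigma> (inv g) $$ (j, j)) = mtrace (\<rho> g) * mtrace (\<sigma> (inv g))"
      using \<rho>[OF g] \<sigma>[OF g] by (simp add: mtrace_def sum_product)
  qed
  finally show ?thesis by simp
qed

lemma intertwiners_zero_orthogonal:
  assumes rep: "representation G n \<rho>" "representation G m \<sigma>"
    and zero: "\<And>T. T \<in> carrier_mat n m \<Longrightarrow> (\<And>g. g \<in> carrier G \<Longrightarrow> \<rho> g * T = T * \<sigma> g) \<Longrightarrow> T = 0\<^sub>m n m"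
  shows "(\<Sum>g\<in>carrier G. mtrace (\<rho> g) * mtrace (\<sigma> (inv g))) = 0"
  unfolding trace_product_sum[OF rep]
proof (intro sum.neutral ballI)
  fix i j assume ij: "i \<in> {..<n}" "j \<in> {..<m}"
  have "msum n m (\<lambda>g. \<rho> g * elem_mat n m i j * \<sigma> (inv g)) (carrier G) = 0\<^sub>m n m"
    by (rule zero) (auto intro!: averaged_intertwiner[OF rep] simp: elem_mat_def)
  then show "msum n m (\<lambda>g. \<rho> g * elem_mat n m i j * \<sigma> (inv g)) (carrier G) $$ (i, j) = 0"
    using ij by (simp del: msum_index)
qed

lemma irr_self_inner_product:
  assumes irr: "irreducible_rep G n \<rho>"
  shows "(\<Sum>g\<in>carrier G. mtrace (\<rho> g) * mtrace (\<rho> (inv g))) = of_nat (card (carrier G))"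
proof -
  note rep = irr_rep[OF irr]
  note \<rho> = rep_carrier[OF rep]
  have n: "n > 0" by (rule irr_dim_pos[OF irr])
  have entry: "msum n n (\<lambda>g. \<rho> g * elem_mat n n i j * \<rho> (inv g)) (carrier G) $$ (i, j) =
      (if i = j then of_nat (card (carrier G)) / of_nat n else 0)" if ij: "i < n" "j < n" for i j
  proof -
    have E: "elem_mat n n i j \<in> carrier_mat n n" by (simp add: elem_mat_def)
    let ?T = "msum n n (\<lambda>g. \<rho> g * elem_mat n n i j * \<rho> (inv g)) (carrier G)"
    obtain c where c: "?T = c \<cdot>\<^sub>m 1\<^sub>m n"
      by (rule schur_scalar[OF irr msum_carrier averaged_intertwiner[OF rep rep E]])
    have "c * of_nat n = mtrace ?T" using mtrace_smult[OF one_carrier_mat, of c n] by (simp add: c)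
    also have "\<dots> = (\<Sum>g\<in>carrier G. mtrace (\<rho> g * elem_mat n n i j * \<rho> (inv g)))"
      by (rule mtrace_msum) (use \<rho> E in \<open>auto intro!: mult_carrier_mat\<close>)
    also have "\<dots> = (\<Sum>g\<in>carrier G. if i = j then 1 else 0)"
    proof (rule sum.cong[OF refl])
      fix g assume g: "g \<in> carrier G"
      have "mtrace (\<rho> g * elem_mat n n i j * \<rho> (inv g)) = mtrace (elem_mat n n i j)"
        by (rule mtrace_similar[OF E \<rho>[OF g] \<rho>[OF inv_closed[OF g]] rep_inv_mult[OF rep g]])
      also have "\<dots> = (\<Sum>a<n. if a = i then (if i = j then 1 else 0) else 0)"
        unfolding mtrace_def by (rule sum.cong) (auto simp: elem_mat_def)
      also have "\<dots> = (if i = j then 1 else 0)" using ij by simp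
      finally show "mtrace (\<rho> g * elem_mat n n i j * \<rho> (inv g)) = (if i = j then 1 else 0)" .
    qed
    finally have "c = (if i = j then of_nat (card (carrier G)) / of_nat n else 0)"
      using n by (auto simp: field_simps)
    then show ?thesis using ij by (simp add: c del: msum_index)
  qed
  have "(\<Sum>g\<in>carrier G. mtrace (\<rho> g) * mtrace (\<rho> (inv g))) =
    (\<Sum>i<n. \<Sum>j<n. if i = j then of_nat (card (carrier G)) / of_nat n else 0)"
    unfolding trace_product_sum[OF rep rep] by (intro sum.cong refl) (simp add: entry del: msum_index)
  also have "\<dots> = of_nat (card (carrier G))" using n by simp
  finally show ?thesis .
qed

text \<open>Either all averaged matrix units vanish, or there is an invertible intertwiner and the two characters
  agree. In particular an irreducible representation is determined by its character, which allows to
  count characters instead of isomorphism classes.\<close>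
lemma irr_orthogonality:
  assumes irr: "irreducible_rep G n \<rho>" "irreducible_rep G m \<sigma>"
  shows "(\<Sum>g\<in>carrier G. character \<rho> g * character \<sigma> (inv g)) =
      (if character \<rho> = character \<sigma> then of_nat (card (carrier G)) else 0)"
    and "character \<rho> = character \<sigma> \<Longrightarrow> n = m \<and> rep_iso G n \<rho> \<sigma>"
proof -
  note rep = irr_rep[OF irr(1)] irr_rep[OF irr(2)]
  have sum_eq: "(\<Sum>g\<in>carrier G. character \<rho> g * character \<sigma> (inv g)) =
      (\<Sum>g\<in>carrier G. mtrace (\<rho> g) * mtrace (\<sigma> (inv g)))"
    by (rule sum.cong) (auto simp: character_def)
  have same: "(\<Sum>g\<in>carrier G. character \<rho> g * character \<sigma> (inv g)) = of_nat (card (carrier G))"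
    if eq: "character \<rho> = character \<sigma>"
  proof -
    have "(\<Sum>g\<in>carrier G. character \<rho> g * character \<rho> (inv g)) = of_nat (card (carrier G))"
      using irr_self_inner_product[OF irr(1)] by (simp add: character_def cong: sum.cong)
    then show ?thesis using eq by simp
  qed
  have iso: "n = m \<and> rep_iso G n \<rho> \<sigma> \<and> character \<rho> = character \<sigma>"
    if T: "T \<in> carrier_mat n m" "\<And>g. g \<in> carrier G \<Longrightarrow> \<rho> g * T = T * \<sigma> g" "T \<noteq> 0\<^sub>m n m" for T
  proof -
    have nm: "n = m" by (rule schur(1)[OF irr T(1,2,3)])
    have "T \<in> carrier (GL TYPE(complex) n)" by (rule schur(2)[OF irr T(1,2,3)])
    then obtain S where S: "S \<in> carrier_mat n n" "T * S = 1\<^sub>m n" "S * T = 1\<^sub>m n"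
      by (auto simp: GL_carrier_iff)
    have T': "T \<in> carrier_mat n n" using T nm by simp
    have conj: "\<sigma> g = S * \<rho> g * T" if g: "g \<in> carrier G" for g
    proof -
      have \<sigma>: "\<sigma> g \<in> carrier_mat n n" and \<rho>: "\<rho> g \<in> carrier_mat n n" using rep_carrier rep nm g by auto
      have "S * \<rho> g * T = S * (T * \<sigma> g)" using \<rho> S T' T(2)[OF g] by (simp add: assoc_mult_mat[of _ n n _ n _ n])
      then show ?thesis using mult_cancel_inverse_left[OF T' S(1,3) \<sigma>] by simp
    qed
    have "S * \<rho> g = \<sigma> g * S" if g: "g \<in> carrier G" for g
    proof -
      have \<rho>: "\<rho> g \<in> carrier_mat n n" using rep_carrier rep g by auto
      have "\<sigma> g * S = S * \<rho> g * (T * S)" using \<rho> S T' conj[OF g] by (simp add: assoc_mult_mat[of _ n n _ n _ n])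
      then show ?thesis using S \<rho> by simp
    qed
    then have "rep_iso G n \<rho> \<sigma>"
      unfolding rep_iso_def using S T' by (intro bexI[of _ S]) (auto simp: GL_carrier_iff)
    moreover have "character \<rho> = character \<sigma>"
      using conj mtrace_similar[OF rep_carrier[OF rep(1)] S(1) T' S(2)] by (auto simp: character_def)
    ultimately show ?thesis using nm by blast
  qed
  show "(\<Sum>g\<in>carrier G. character \<rho> g * character \<sigma> (inv g)) =
      (if character \<rho> = character \<sigma> then of_nat (card (carrier G)) else 0)"
  proof (cases "character \<rho> = character \<sigma>")
    case False
    then show ?thesis unfolding sum_eq using intertwiners_zero_orthogonal[OF rep] iso by (metis (no_types, lifting))
  qed (use same in simp)
  assume eq: "character \<rho> = character \<sigma>"
  show "n = m \<and> rep_iso G n \<rho> \<sigma>"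
  proof (rule ccontr)
    assume "\<not> (n = m \<and> rep_iso G n \<rho> \<sigma>)"
    then have "(\<Sum>g\<in>carrier G. character \<rho> g * character \<sigma> (inv g)) = 0"
      unfolding sum_eq using intertwiners_zero_orthogonal[OF rep] iso by (metis (no_types, lifting))
    then show False using same[OF eq] card_carrier_pos by simp
  qed
qed

lemma irr_chars_orthogonality:
  assumes "\<chi> \<in> irr_chars" "\<phi> \<in> irr_chars"
  shows "(\<Sum>g\<in>carrier G. \<chi> g * \<phi> (inv g)) = (if \<chi> = \<phi> then of_nat (card (carrier G)) else 0)"
  using assms irr_orthogonality(1) by (auto simp: irr_chars_def)

lemma rep_iso_character:
  assumes rep: "representation G n \<rho>" "representation G n \<sigma>" and iso: "rep_iso G n \<rho> \<sigma>"
  shows "character \<rho> = character \<sigma>"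
proof
  fix g
  obtain P Q where P: "P \<in> carrier_mat n n" and Q: "Q \<in> carrier_mat n n" "P * Q = 1\<^sub>m n" "Q * P = 1\<^sub>m n"
    and comm: "\<And>g. g \<in> carrier G \<Longrightarrow> P * \<rho> g = \<sigma> g * P"
    using iso by (auto simp: rep_iso_def GL_carrier_iff)
  show "character \<rho> g = character \<sigma> g"
  proof (cases "g \<in> carrier G")
    case True
    note \<rho> = rep_carrier[OF rep(1) True] and \<sigma> = rep_carrier[OF rep(2) True]
    have "mtrace (Q * \<sigma> g * P) = mtrace (\<sigma> g)" by (rule mtrace_similar[OF \<sigma> Q(1) P Q(2)])
    moreover have "Q * \<sigma> g * P = Q * (P * \<rho> g)"
      using comm[OF True] P Q \<sigma> by (simp add: assoc_mult_mat[of _ n n _ n _ n])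
    moreover have "\<dots> = \<rho> g" by (rule mult_cancel_inverse_left[OF P Q(1,3) \<rho>])
    ultimately show ?thesis using True by (simp add: character_def)
  qed (simp add: character_def)
qed

text \<open>The regular representation by permutation matrices: only the identity fixes a group element under
  left multiplication.\<close>
lemma regular_rep:
  obtains N R where "representation G N R"
    "\<And>g. g \<in> carrier G \<Longrightarrow> mtrace (R g) = (if g = \<one> then of_nat (card (carrier G)) else 0)"
proof -
  let ?N = "card (carrier G)"
  obtain e where e: "bij_betw e {..<?N} (carrier G)"
    using ex_bij_betw_nat_finite[OF finite_carrier] by (auto simp: atLeast0LessThan)
  have e_in: "e i \<in> carrier G" if "i < ?N" for i using e that by (auto simp: bij_betw_def)
  have e_inj: "e i = e j \<longleftrightarrow> i = j" if "i < ?N" "j < ?N" for i j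
    using e that by (auto simp: bij_betw_def inj_on_def)
  define R :: "'a \<Rightarrow> complex mat" where "R g = mat ?N ?N (\<lambda>(i, j). if e i = g \<otimes> e j then 1 else 0)" for g
  have "representation G ?N R"
  proof (rule representationI)
    fix g h assume g: "g \<in> carrier G" and h: "h \<in> carrier G"
    show "R (g \<otimes> h) = R g * R h"
    proof (rule eq_matI)
      fix i j assume "i < dim_row (R g * R h)" "j < dim_col (R g * R h)"
      then have ij: "i < ?N" "j < ?N" by (simp_all add: R_def)
      have "h \<otimes> e j \<in> carrier G" using h e_in ij by simp
      then obtain k0 where k0: "k0 < ?N" "e k0 = h \<otimes> e j"
        using e unfolding bij_betw_def by (metis imageE lessThan_iff)
      have "(R g * R h) $$ (i, j) = (\<Sum>k<?N. R g $$ (i, k) * R h $$ (k, j))"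
        by (rule mult_entry[of _ _ ?N _ ?N]) (use ij in \<open>auto simp: R_def\<close>)
      also have "\<dots> = (\<Sum>k<?N. if k = k0 then (if e i = g \<otimes> (h \<otimes> e j) then 1 else 0) else 0)"
        by (rule sum.cong) (use ij k0 in \<open>auto simp: R_def e_inj k0(2)[symmetric]\<close>)
      also have "\<dots> = R (g \<otimes> h) $$ (i, j)" using k0 ij g h e_in by (simp add: R_def m_assoc)
      finally show "R (g \<otimes> h) $$ (i, j) = (R g * R h) $$ (i, j)" by simp
    qed (simp_all add: R_def)
  next
    show "R \<one> = 1\<^sub>m ?N" by (rule eq_matI) (auto simp: R_def e_in e_inj)
  qed (simp add: R_def)
  moreover have "mtrace (R g) = (if g = \<one> then of_nat ?N else 0)" if g: "g \<in> carrier G" for g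
  proof -
    have "mtrace (R g) = (\<Sum>i<?N. if e i = g \<otimes> e i then 1 else 0)" by (simp add: mtrace_def R_def)
    also have "\<dots> = (\<Sum>i<?N. if g = \<one> then 1 else 0)"
      by (rule sum.cong) (use e_in g r_cancel_one' in auto)
    finally show ?thesis by simp
  qed
  ultimately show ?thesis using that by blast
qed

lemma irr_char_one:
  assumes "\<chi> \<in> irr_chars"
  obtains n where "n > 0" "\<chi> \<one> = of_nat n"
proof -
  obtain n \<rho> where "irreducible_rep G n \<rho>" "\<chi> = character \<rho>" using assms by (auto simp: irr_chars_def)
  then show ?thesis using that irr_dim_pos character_one[OF irr_rep] by blast
qed

text \<open>The regular character is a sum of irreducible ones, and its inner product with any irreducible \<open>\<phi>\<close>
  is the degree of \<open>\<phi>\<close>. So every irreducible character occurs in this finite sum, with its degree as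
  multiplicity.\<close>
lemma finite_irr_chars: "finite irr_chars"
  and sum_irr_chars_regular:
    "g \<in> carrier G \<Longrightarrow> (\<Sum>\<chi>\<in>irr_chars. \<chi> \<one> * \<chi> g) = (if g = \<one> then of_nat (card (carrier G)) else 0)"
proof -
  obtain N R where R: "representation G N R"
    and trR: "\<And>g. g \<in> carrier G \<Longrightarrow> mtrace (R g) = (if g = \<one> then of_nat (card (carrier G)) else 0)"
    by (rule regular_rep) blast
  obtain cs where cs: "set cs \<subseteq> irr_chars" "\<And>g. g \<in> carrier G \<Longrightarrow> mtrace (R g) = (\<Sum>\<chi>\<leftarrow>cs. \<chi> g)"
    using rep_trace_decomposition[OF R] by blast
  have dec: "(if g = \<one> then of_nat (card (carrier G)) else 0) = (\<Sum>\<chi>\<in>set cs. of_nat (count_list cs \<chi>) * \<chi> g)"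
    if "g \<in> carrier G" for g
    using cs(2)[OF that] trR[OF that] sum_list_map_count[of "set cs" cs "\<lambda>\<chi>. \<chi> g"] by simp
  have mult: "of_nat (count_list cs \<phi>) = \<phi> \<one>" if \<phi>: "\<phi> \<in> irr_chars" for \<phi>
  proof -
    have "of_nat (card (carrier G)) * \<phi> \<one> =
        (\<Sum>g\<in>carrier G. (if g = \<one> then of_nat (card (carrier G)) else 0) * \<phi> (inv g))"
      by (simp add: if_distrib[of "\<lambda>x. x * _"] sum.delta cong: if_cong)
    also have "\<dots> = (\<Sum>g\<in>carrier G. \<Sum>\<chi>\<in>set cs. of_nat (count_list cs \<chi>) * (\<chi> g * \<phi> (inv g)))"
      by (intro sum.cong refl) (simp add: dec sum_distrib_right mult.assoc)
    also have "\<dots> = (\<Sum>\<chi>\<in>set cs. of_nat (count_list cs \<chi>) * (\<Sum>g\<in>carrier G. \<chi> g * \<phi> (inv g)))"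
      by (subst sum.swap) (simp add: sum_distrib_left)
    also have "\<dots> = (\<Sum>\<chi>\<in>set cs. if \<chi> = \<phi> then of_nat (count_list cs \<phi>) * of_nat (card (carrier G)) else 0)"
      using cs(1) \<phi> by (intro sum.cong refl) (auto simp: irr_chars_orthogonality)
    also have "\<dots> = of_nat (count_list cs \<phi>) * of_nat (card (carrier G))"
      by (simp add: sum.delta)
    finally show ?thesis using card_carrier_pos by (auto simp: mult.commute simp del: finite_carrier)
  qed
  have eq: "irr_chars = set cs"
  proof
    show "irr_chars \<subseteq> set cs"
    proof
      fix \<phi> assume \<phi>: "\<phi> \<in> irr_chars"
      then have "count_list cs \<phi> \<noteq> 0" using mult[OF \<phi>] irr_char_one[OF \<phi>] by (metis neq0_conv of_nat_eq_iff)
      then show "\<phi> \<in> set cs" by (metis count_notin)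
    qed
  qed (rule cs(1))
  show "finite irr_chars" by (simp add: eq)
  assume "g \<in> carrier G"
  from dec[OF this] show "(\<Sum>\<chi>\<in>irr_chars. \<chi> \<one> * \<chi> g) = (if g = \<one> then of_nat (card (carrier G)) else 0)"
    using mult by (simp add: eq)
qed

text \<open>The average of the conjugates of \<open>\<rho> y\<close> is scalar by Schur's lemma, and its trace determines the
  scalar.\<close>
lemma irr_char_product:
  assumes \<chi>: "\<chi> \<in> irr_chars" and x: "x \<in> carrier G" and y: "y \<in> carrier G"
  shows "of_nat (card (carrier G)) * (\<chi> x * \<chi> y) = \<chi> \<one> * (\<Sum>h\<in>carrier G. \<chi> (x \<otimes> (h \<otimes> y \<otimes> inv h)))"
proof -
  obtain n \<rho> where irr: "irreducible_rep G n \<rho>" and \<chi>_def: "\<chi> = character \<rho>"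
    using \<chi> by (auto simp: irr_chars_def)
  note rep = irr_rep[OF irr]
  note \<rho> = rep_carrier[OF rep]
  let ?T = "msum n n (\<lambda>h. \<rho> h * \<rho> y * \<rho> (inv h)) (carrier G)"
  have car: "\<rho> h * \<rho> y * \<rho> (inv h) \<in> carrier_mat n n" if "h \<in> carrier G" for h
    using \<rho>[OF that] \<rho>[OF y] \<rho>[OF inv_closed[OF that]] by auto
  obtain c where c: "?T = c \<cdot>\<^sub>m 1\<^sub>m n"
    by (rule schur_scalar[OF irr msum_carrier averaged_intertwiner[OF rep rep \<rho>[OF y]]])
  have "c * of_nat n = mtrace ?T" using mtrace_smult[OF one_carrier_mat, of c n] by (simp add: c)
  also have "\<dots> = (\<Sum>h\<in>carrier G. mtrace (\<rho> h * \<rho> y * \<rho> (inv h)))" by (rule mtrace_msum[OF car])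
  also have "\<dots> = (\<Sum>h\<in>carrier G. mtrace (\<rho> y))"
    by (intro sum.cong refl mtrace_similar[of _ n] \<rho> y inv_closed rep_inv_mult[OF rep])
  also have "\<dots> = of_nat (card (carrier G)) * \<chi> y" using y by (simp add: \<chi>_def character_def)
  finally have cn: "c * of_nat n = of_nat (card (carrier G)) * \<chi> y" .
  have "(\<Sum>h\<in>carrier G. \<chi> (x \<otimes> (h \<otimes> y \<otimes> inv h))) = (\<Sum>h\<in>carrier G. mtrace (\<rho> x * (\<rho> h * \<rho> y * \<rho> (inv h))))"
    using x y by (intro sum.cong refl) (simp add: \<chi>_def character_def rep_mult[OF rep])
  also have "\<dots> = mtrace (msum n n (\<lambda>h. \<rho> x * (\<rho> h * \<rho> y * \<rho> (inv h))) (carrier G))"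
    by (rule mtrace_msum[symmetric]) (use \<rho>[OF x] car in \<open>auto intro: mult_carrier_mat\<close>)
  also have "msum n n (\<lambda>h. \<rho> x * (\<rho> h * \<rho> y * \<rho> (inv h))) (carrier G) = \<rho> x * ?T"
    by (rule mult_msum[OF \<rho>[OF x] car, symmetric])
  also have "\<rho> x * ?T = c \<cdot>\<^sub>m \<rho> x"
    unfolding c using mult_smult_distrib[OF \<rho>[OF x] one_carrier_mat, of c] \<rho>[OF x] by simp
  also have "mtrace (c \<cdot>\<^sub>m \<rho> x) = c * \<chi> x" using mtrace_smult[OF \<rho>[OF x]] x by (simp add: \<chi>_def character_def)
  finally have "\<chi> \<one> * (\<Sum>h\<in>carrier G. \<chi> (x \<otimes> (h \<otimes> y \<otimes> inv h))) = c * of_nat n * \<chi> x"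
    using character_one[OF rep] by (simp add: \<chi>_def)
  then show ?thesis by (simp add: cn)
qed

text \<open>Column orthogonality in its most useful form: the right-hand side counts the \<open>h\<close> that conjugate \<open>y\<close>
  to \<open>x\<close>. It follows by inserting the product formula into the regular character.\<close>
lemma sum_irr_chars_pair:
  assumes x: "x \<in> carrier G" and y: "y \<in> carrier G"
  shows "(\<Sum>\<chi>\<in>irr_chars. \<chi> x * \<chi> (inv y)) = of_nat (card {h \<in> carrier G. h \<otimes> y = x \<otimes> h})"
proof -
  let ?N = "of_nat (card (carrier G)) :: complex"
  have "?N * (\<Sum>\<chi>\<in>irr_chars. \<chi> x * \<chi> (inv y)) =
      (\<Sum>\<chi>\<in>irr_chars. \<Sum>h\<in>carrier G. \<chi> \<one> * \<chi> (x \<otimes> (h \<otimes> inv y \<otimes> inv h)))"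
    unfolding sum_distrib_left
    by (intro sum.cong refl) (use irr_char_product[OF _ x inv_closed[OF y]] in \<open>simp add: sum_distrib_left\<close>)
  also have "\<dots> = (\<Sum>h\<in>carrier G. \<Sum>\<chi>\<in>irr_chars. \<chi> \<one> * \<chi> (x \<otimes> (h \<otimes> inv y \<otimes> inv h)))"
    by (rule sum.swap)
  also have "\<dots> = (\<Sum>h\<in>carrier G. if h \<otimes> y = x \<otimes> h then ?N else 0)"
  proof (rule sum.cong[OF refl])
    fix h assume h: "h \<in> carrier G"
    have "x \<otimes> (h \<otimes> inv y \<otimes> inv h) = (x \<otimes> h) \<otimes> inv (h \<otimes> y)"
      using x y h by (simp add: inv_mult_group m_assoc)
    moreover have "(x \<otimes> h) \<otimes> inv (h \<otimes> y) = \<one> \<longleftrightarrow> h \<otimes> y = x \<otimes> h"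
      using x y h by (metis inv_closed inv_equality inv_inv m_closed r_inv)
    ultimately show "(\<Sum>\<chi>\<in>irr_chars. \<chi> \<one> * \<chi> (x \<otimes> (h \<otimes> inv y \<otimes> inv h))) = (if h \<otimes> y = x \<otimes> h then ?N else 0)"
      using x y h by (simp add: sum_irr_chars_regular)
  qed
  also have "\<dots> = ?N * of_nat (card {h \<in> carrier G. h \<otimes> y = x \<otimes> h})"
    by (simp add: sum.If_cases Collect_conj_eq Int_commute)
  finally show ?thesis using card_carrier_pos by (auto simp del: finite_carrier)
qed

section \<open>Linear characters, twisting and orbits\<close>

text \<open>Characters vanish outside the group so that equal characters are equal as functions.\<close>
definition lin_chars :: "('a \<Rightarrow> complex) set" where
  "lin_chars = {l. (\<forall>x\<in>carrier G. \<forall>y\<in>carrier G. l (x \<otimes> y) = l x * l y) \<and> l \<one> = 1 \<and> (\<forall>x. x \<notin> carrier G \<longrightarrow> l x = 0)}"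

lemma lin_char_mult: "l \<in> lin_chars \<Longrightarrow> x \<in> carrier G \<Longrightarrow> y \<in> carrier G \<Longrightarrow> l (x \<otimes> y) = l x * l y"
  and lin_char_one: "l \<in> lin_chars \<Longrightarrow> l \<one> = 1"
  and lin_char_outside: "l \<in> lin_chars \<Longrightarrow> x \<notin> carrier G \<Longrightarrow> l x = 0"
  by (auto simp: lin_chars_def)

lemma lin_char_inv: "l \<in> lin_chars \<Longrightarrow> x \<in> carrier G \<Longrightarrow> l x * l (inv x) = 1"
  using lin_char_mult[of l x "inv x"] lin_char_one[of l] by simp

lemma lin_char_nonzero: "l \<in> lin_chars \<Longrightarrow> x \<in> carrier G \<Longrightarrow> l x \<noteq> 0"
  using lin_char_inv by force

lemma irr_char_outside: "\<chi> \<in> irr_chars \<Longrightarrow> x \<notin> carrier G \<Longrightarrow> \<chi> x = 0"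
  by (auto simp: irr_chars_def character_def)

lemma one_dim_entry: "representation G 1 \<psi> \<Longrightarrow> g \<in> carrier G \<Longrightarrow> \<psi> g $$ (0, 0) = character \<psi> g"
  using rep_carrier[of 1 \<psi> g] by (auto simp: character_def mtrace_def)

lemma one_dim_character: "representation G 1 \<psi> \<Longrightarrow> character \<psi> \<in> lin_chars"
proof -
  assume rep: "representation G 1 \<psi>"
  have "character \<psi> (x \<otimes> y) = character \<psi> x * character \<psi> y" if "x \<in> carrier G" "y \<in> carrier G" for x y
    using that rep_mult[OF rep that] mult_entry[OF rep_carrier[OF rep that(1)] rep_carrier[OF rep that(2)], of 0 0]
    by (simp add: one_dim_entry[OF rep, symmetric])
  then show ?thesis using character_one[OF rep] by (auto simp: lin_chars_def character_def)
qed

lemma lin_char_rep: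
  assumes l: "l \<in> lin_chars"
  shows "representation G 1 (\<lambda>g. mat 1 1 (\<lambda>_. l g))" and "character (\<lambda>g. mat 1 1 (\<lambda>_. l g)) = l"
proof -
  show "representation G 1 (\<lambda>g. mat 1 1 (\<lambda>_. l g))"
  proof (rule representationI)
    fix g h assume "g \<in> carrier G" "h \<in> carrier G"
    then show "mat 1 1 (\<lambda>_. l (g \<otimes> h)) = mat 1 1 (\<lambda>_. l g) * mat 1 1 (\<lambda>_. l h)"
      using lin_char_mult[OF l] by (intro eq_matI) (auto simp: scalar_prod_def)
  qed (auto simp: lin_char_one[OF l])
  show "character (\<lambda>g. mat 1 1 (\<lambda>_. l g)) = l"
    using lin_char_outside[OF l] by (auto simp: character_def mtrace_def)
qed

lemma lin_chars_irr: "lin_chars = {\<chi> \<in> irr_chars. \<chi> \<one> = 1}"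
proof (intro equalityI subsetI)
  fix l assume l: "l \<in> lin_chars"
  then show "l \<in> {\<chi> \<in> irr_chars. \<chi> \<one> = 1}"
    using one_dim_irreducible[OF lin_char_rep(1)[OF l]] lin_char_rep(2)[OF l] lin_char_one
    unfolding irr_chars_def by (metis (mono_tags, lifting) mem_Collect_eq)
next
  fix \<chi> assume "\<chi> \<in> {\<chi> \<in> irr_chars. \<chi> \<one> = 1}"
  then obtain n \<rho> where \<rho>: "irreducible_rep G n \<rho>" "\<chi> = character \<rho>" "\<chi> \<one> = 1" by (auto simp: irr_chars_def)
  then have "n = 1" using character_one[OF irr_rep[OF \<rho>(1)]] by simp
  then show "\<chi> \<in> lin_chars" using one_dim_character irr_rep[OF \<rho>(1)] \<rho>(2) by simp
qed

lemma finite_lin_chars [simp]: "finite lin_chars"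
  using finite_irr_chars by (simp add: lin_chars_irr)

lemma lin_chars_subset: "l \<in> lin_chars \<Longrightarrow> l \<in> irr_chars"
  by (simp add: lin_chars_irr)

lemma comm_lin_chars:
  assumes comm: "\<And>x y. x \<in> carrier G \<Longrightarrow> y \<in> carrier G \<Longrightarrow> x \<otimes> y = y \<otimes> x"
  shows "lin_chars = irr_chars"
proof -
  have "\<chi> \<one> = 1" if "\<chi> \<in> irr_chars" for \<chi>
  proof -
    obtain n \<rho> where \<rho>: "irreducible_rep G n \<rho>" "\<chi> = character \<rho>" using \<open>\<chi> \<in> irr_chars\<close> by (auto simp: irr_chars_def)
    have "n = 1" by (rule irr_commuting_dim[OF \<rho>(1)]) (metis rep_mult[OF irr_rep[OF \<rho>(1)]] comm)
    then show ?thesis using character_one[OF irr_rep[OF \<rho>(1)]] \<rho>(2) by simp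
  qed
  then show ?thesis by (auto simp: lin_chars_irr)
qed

text \<open>For a commutative group all degrees in the regular character are one.\<close>
lemma sum_lin_chars_comm:
  assumes comm: "\<And>x y. x \<in> carrier G \<Longrightarrow> y \<in> carrier G \<Longrightarrow> x \<otimes> y = y \<otimes> x" and g: "g \<in> carrier G"
  shows "(\<Sum>l\<in>lin_chars. l g) = (if g = \<one> then of_nat (card (carrier G)) else 0)"
proof -
  have "(\<Sum>l\<in>lin_chars. l g) = (\<Sum>l\<in>lin_chars. l \<one> * l g)"
    by (rule sum.cong) (simp_all add: lin_char_one)
  then show ?thesis using sum_irr_chars_regular[OF g] comm_lin_chars[OF comm] by simp
qed

lemma card_lin_chars_comm:
  assumes comm: "\<And>x y. x \<in> carrier G \<Longrightarrow> y \<in> carrier G \<Longrightarrow> x \<otimes> y = y \<otimes> x"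
  shows "card lin_chars = card (carrier G)"
proof -
  have "(of_nat (card lin_chars) :: complex) = (\<Sum>l\<in>lin_chars. l \<one>)" by (simp add: lin_char_one)
  also have "\<dots> = of_nat (card (carrier G))" using sum_lin_chars_comm[OF comm one_closed] by simp
  finally show ?thesis by simp
qed

definition twist :: "('a \<Rightarrow> complex) \<Rightarrow> ('a \<Rightarrow> complex) \<Rightarrow> 'a \<Rightarrow> complex" where
  "twist \<chi> l = (\<lambda>g. \<chi> g * l g)"

definition lin_inv :: "('a \<Rightarrow> complex) \<Rightarrow> 'a \<Rightarrow> complex" where
  "lin_inv l = (\<lambda>g. if g \<in> carrier G then inverse (l g) else 0)"

definition lin_triv :: "'a \<Rightarrow> complex" where
  "lin_triv = (\<lambda>g. if g \<in> carrier G then 1 else 0)"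

lemma lin_triv: "lin_triv \<in> lin_chars"
  by (auto simp: lin_triv_def lin_chars_def)

lemma lin_inv: "l \<in> lin_chars \<Longrightarrow> lin_inv l \<in> lin_chars"
  by (auto simp: lin_inv_def lin_chars_def)

lemma twist_lin: "l \<in> lin_chars \<Longrightarrow> k \<in> lin_chars \<Longrightarrow> twist l k \<in> lin_chars"
  by (auto simp: twist_def lin_chars_def)

lemma twist_assoc: "twist (twist \<chi> l) k = twist \<chi> (twist l k)"
  by (simp add: twist_def mult.assoc)

lemma twist_commute: "twist l k = twist k l"
  by (simp add: twist_def mult.commute)

lemma twist_lin_inv: "l \<in> lin_chars \<Longrightarrow> twist l (lin_inv l) = lin_triv"
  using lin_char_nonzero by (auto simp: twist_def lin_inv_def lin_triv_def)

lemma twist_triv: "(\<And>x. x \<notin> carrier G \<Longrightarrow> \<chi> x = 0) \<Longrightarrow> twist \<chi> lin_triv = \<chi>"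
  by (auto simp: twist_def lin_triv_def)

lemma twist_cancel:
  assumes "l \<in> lin_chars" "\<And>x. x \<notin> carrier G \<Longrightarrow> \<chi> x = 0"
  shows "twist (twist \<chi> l) (lin_inv l) = \<chi>" "twist (twist \<chi> (lin_inv l)) l = \<chi>"
  using assms twist_triv by (simp_all add: twist_assoc twist_lin_inv twist_commute[of "lin_inv l"])

lemma rep_tensor_one_dim:
  assumes rep: "representation G n \<sigma>" "representation G 1 \<psi>" and g: "g \<in> carrier G"
  shows "rep_tensor \<sigma> \<psi> g = character \<psi> g \<cdot>\<^sub>m \<sigma> g"
  using rep_carrier[OF rep(1) g] rep_carrier[OF rep(2) g] one_dim_entry[OF rep(2) g]
  by (simp add: rep_tensor_def kronecker_one_dim) (auto simp: mult.commute)

lemma rep_tensor_rep: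
  assumes rep: "representation G n \<sigma>" "representation G 1 \<psi>"
  shows "representation G n (rep_tensor \<sigma> \<psi>)"
proof (rule representationI)
  note \<sigma> = rep_carrier[OF rep(1)] and l = one_dim_character[OF rep(2)]
  fix g h assume g: "g \<in> carrier G" and h: "h \<in> carrier G"
  have "character \<psi> g \<cdot>\<^sub>m \<sigma> g * (character \<psi> h \<cdot>\<^sub>m \<sigma> h) = character \<psi> (g \<otimes> h) \<cdot>\<^sub>m (\<sigma> g * \<sigma> h)"
    using mult_smult_assoc_mat[OF \<sigma>[OF g], of "character \<psi> h \<cdot>\<^sub>m \<sigma> h" n "character \<psi> g"]
      mult_smult_distrib[OF \<sigma>[OF g] \<sigma>[OF h], of "character \<psi> h"] \<sigma>[OF h] lin_char_mult[OF l g h]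
    by (simp add: smult_smult_mat)
  then show "rep_tensor \<sigma> \<psi> (g \<otimes> h) = rep_tensor \<sigma> \<psi> g * rep_tensor \<sigma> \<psi> h"
    using g h by (simp add: rep_tensor_one_dim[OF rep] rep_mult[OF rep(1)])
next
  show "rep_tensor \<sigma> \<psi> \<one> = 1\<^sub>m n"
    using rep_tensor_one_dim[OF rep one_closed] lin_char_one[OF one_dim_character[OF rep(2)]]
    by (auto simp: rep_one[OF rep(1)])
next
  fix g assume g: "g \<in> carrier G"
  show "rep_tensor \<sigma> \<psi> g \<in> carrier_mat n n"
    using rep_carrier[OF rep(1) g] by (simp add: rep_tensor_one_dim[OF rep g])
qed

lemma rep_tensor_character:
  assumes rep: "representation G n \<sigma>" "representation G 1 \<psi>"
  shows "character (rep_tensor \<sigma> \<psi>) = twist (character \<sigma>) (character \<psi>)"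
proof
  fix g
  show "character (rep_tensor \<sigma> \<psi>) g = twist (character \<sigma>) (character \<psi>) g"
    using rep_tensor_one_dim[OF rep] mtrace_smult[OF rep_carrier[OF rep(1)]]
    by (auto simp: twist_def character_def)
qed

lemma rep_tensor_irreducible:
  assumes irr: "irreducible_rep G n \<sigma>" and rep: "representation G 1 \<psi>"
  shows "irreducible_rep G n (rep_tensor \<sigma> \<psi>)"
  unfolding irreducible_rep_def
proof (intro conjI allI impI)
  show "representation G n (rep_tensor \<sigma> \<psi>)" by (rule rep_tensor_rep[OF irr_rep[OF irr] rep])
  show "0 < n" by (rule irr_dim_pos[OF irr])
  fix W assume W: "VectorSpace.subspace class_ring W (module_vec TYPE(complex) n) \<and>
    (\<forall>g\<in>carrier G. \<forall>w\<in>W. rep_tensor \<sigma> \<psi> g *\<^sub>v w \<in> W)"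
  have "\<sigma> g *\<^sub>v w \<in> W" if g: "g \<in> carrier G" and w: "w \<in> W" for g w
  proof -
    let ?c = "character \<psi> g"
    have c: "?c \<noteq> 0" by (rule lin_char_nonzero[OF one_dim_character[OF rep] g])
    have wc: "w \<in> carrier_vec n" using W w by (auto simp: subspace_vec_iff)
    note \<sigma> = rep_carrier[OF irr_rep[OF irr] g]
    have "rep_tensor \<sigma> \<psi> g *\<^sub>v w = ?c \<cdot>\<^sub>v (\<sigma> g *\<^sub>v w)"
      unfolding rep_tensor_one_dim[OF irr_rep[OF irr] rep g]
      using \<sigma> wc by (intro eq_vecI) auto
    then have "?c \<cdot>\<^sub>v (\<sigma> g *\<^sub>v w) \<in> W" using W g w by metis
    then have "inverse ?c \<cdot>\<^sub>v (?c \<cdot>\<^sub>v (\<sigma> g *\<^sub>v w)) \<in> W"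
      using W unfolding subspace_vec_iff by blast
    then show ?thesis using c by (simp add: smult_smult_assoc)
  qed
  then show "W = {0\<^sub>v n} \<or> W = carrier_vec n" using irr_invariant_subspace[OF irr] W by blast
qed

lemma twist_irr:
  assumes \<chi>: "\<chi> \<in> irr_chars" and l: "l \<in> lin_chars"
  shows "twist \<chi> l \<in> irr_chars"
proof -
  obtain n \<rho> where \<rho>: "irreducible_rep G n \<rho>" "\<chi> = character \<rho>" using \<chi> by (auto simp: irr_chars_def)
  have "twist \<chi> l = character (rep_tensor \<rho> (\<lambda>g. mat 1 1 (\<lambda>_. l g)))"
    using rep_tensor_character[OF irr_rep[OF \<rho>(1)] lin_char_rep(1)[OF l]] \<rho>(2) lin_char_rep(2)[OF l] by simp
  then show ?thesis using rep_tensor_irreducible[OF \<rho>(1) lin_char_rep(1)[OF l]] by (auto simp: irr_chars_def)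
qed

text \<open>Both sides are detected by characters, since tensoring with a one-dimensional representation
  multiplies characters and preserves irreducibility.\<close>
lemma twist_equivalent_iff:
  assumes irr: "irreducible_rep G n \<rho>" "irreducible_rep G n \<sigma>"
  shows "twist_equivalent G n \<rho> \<sigma> \<longleftrightarrow> (\<exists>l\<in>lin_chars. character \<rho> = twist (character \<sigma>) l)"
proof
  assume "twist_equivalent G n \<rho> \<sigma>"
  then obtain \<psi> where \<psi>: "representation G 1 \<psi>" "rep_iso G n \<rho> (rep_tensor \<sigma> \<psi>)"
    by (auto simp: twist_equivalent_def)
  have "character \<rho> = twist (character \<sigma>) (character \<psi>)"
    using rep_iso_character[OF irr_rep[OF irr(1)] rep_tensor_rep[OF irr_rep[OF irr(2)] \<psi>(1)] \<psi>(2)]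
      rep_tensor_character[OF irr_rep[OF irr(2)] \<psi>(1)] by simp
  then show "\<exists>l\<in>lin_chars. character \<rho> = twist (character \<sigma>) l" using one_dim_character[OF \<psi>(1)] by blast
next
  assume "\<exists>l\<in>lin_chars. character \<rho> = twist (character \<sigma>) l"
  then obtain l where l: "l \<in> lin_chars" "character \<rho> = twist (character \<sigma>) l" by blast
  let ?\<psi> = "\<lambda>g. mat 1 1 (\<lambda>_. l g) :: complex mat"
  note \<psi> = lin_char_rep[OF l(1)]
  have "character \<rho> = character (rep_tensor \<sigma> ?\<psi>)"
    using rep_tensor_character[OF irr_rep[OF irr(2)] \<psi>(1)] l(2) \<psi>(2) by simp
  then have "rep_iso G n \<rho> (rep_tensor \<sigma> ?\<psi>)"
    using irr_orthogonality(2)[OF irr(1) rep_tensor_irreducible[OF irr(2) \<psi>(1)]] by blast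
  then show "twist_equivalent G n \<rho> \<sigma>" unfolding twist_equivalent_def using \<psi>(1) by blast
qed

definition twist_orbit :: "('a \<Rightarrow> complex) \<Rightarrow> ('a \<Rightarrow> complex) set" where
  "twist_orbit \<chi> = twist \<chi> ` lin_chars"

lemma twist_orbit_self: "\<chi> \<in> irr_chars \<Longrightarrow> \<chi> \<in> twist_orbit \<chi>"
  unfolding twist_orbit_def using lin_triv twist_triv irr_char_outside by (metis imageI)

lemma twist_orbit_subset:
  assumes "l \<in> lin_chars"
  shows "twist_orbit (twist \<chi> l) \<subseteq> twist_orbit \<chi>"
  using assms twist_lin by (auto simp: twist_orbit_def twist_assoc)

lemma twist_orbit_twist:
  assumes \<chi>: "\<chi> \<in> irr_chars" and l: "l \<in> lin_chars"
  shows "twist_orbit (twist \<chi> l) = twist_orbit \<chi>"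
proof (rule equalityI)
  have "\<chi> = twist (twist \<chi> l) (lin_inv l)" using twist_cancel(1)[OF l] irr_char_outside[OF \<chi>] by simp
  then show "twist_orbit \<chi> \<subseteq> twist_orbit (twist \<chi> l)" using twist_orbit_subset[OF lin_inv[OF l]] by metis
qed (rule twist_orbit_subset[OF l])

lemma twist_orbit_eq_iff:
  assumes "\<chi> \<in> irr_chars" "\<phi> \<in> irr_chars"
  shows "twist_orbit \<chi> = twist_orbit \<phi> \<longleftrightarrow> (\<exists>l\<in>lin_chars. \<chi> = twist \<phi> l)"
proof
  assume "twist_orbit \<chi> = twist_orbit \<phi>"
  then have "\<chi> \<in> twist_orbit \<phi>" using twist_orbit_self[OF assms(1)] by simp
  then show "\<exists>l\<in>lin_chars. \<chi> = twist \<phi> l" by (auto simp: twist_orbit_def)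
qed (use twist_orbit_twist[OF assms(2)] in auto)

text \<open>The orbit of its character under multiplication by linear characters is a complete invariant of the
  twist isoclass of an irreducible representation.\<close>
lemma twist_isoclasses_count:
  shows "finite (twist_isoclasses G n)"
    and "twist_count G n = card (twist_orbit ` {\<chi> \<in> irr_chars. \<chi> \<one> = of_nat n})"
proof -
  let ?A = "{\<rho>. irreducible_rep G n \<rho>}"
  let ?F = "\<lambda>\<rho>. twist_orbit (character \<rho>)"
  have r: "{(\<rho>, \<sigma>). irreducible_rep G n \<rho> \<and> irreducible_rep G n \<sigma> \<and> twist_equivalent G n \<rho> \<sigma>} =
      {(\<rho>, \<sigma>). \<rho> \<in> ?A \<and> \<sigma> \<in> ?A \<and> ?F \<rho> = ?F \<sigma>}"
  proof -
    have "twist_equivalent G n \<rho> \<sigma> \<longleftrightarrow> ?F \<rho> = ?F \<sigma>"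
      if "irreducible_rep G n \<rho>" "irreducible_rep G n \<sigma>" for \<rho> \<sigma>
      using that twist_equivalent_iff[OF that] twist_orbit_eq_iff[of "character \<rho>" "character \<sigma>"]
      by (auto simp: irr_chars_def)
    then show ?thesis by auto
  qed
  have chars: "character ` ?A = {\<chi> \<in> irr_chars. \<chi> \<one> = of_nat n}"
  proof (intro equalityI subsetI)
    fix \<chi> assume "\<chi> \<in> character ` ?A"
    then show "\<chi> \<in> {\<chi> \<in> irr_chars. \<chi> \<one> = of_nat n}"
      using character_one[OF irr_rep] by (auto simp: irr_chars_def)
  next
    fix \<chi> assume \<chi>: "\<chi> \<in> {\<chi> \<in> irr_chars. \<chi> \<one> = of_nat n}"
    then obtain m \<rho> where \<rho>: "irreducible_rep G m \<rho>" "\<chi> = character \<rho>" by (auto simp: irr_chars_def)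
    then have "m = n" using \<chi> character_one[OF irr_rep[OF \<rho>(1)]] by simp
    then show "\<chi> \<in> character ` ?A" using \<rho> by blast
  qed
  have FA: "?F ` ?A = twist_orbit ` {\<chi> \<in> irr_chars. \<chi> \<one> = of_nat n}"
    unfolding chars[symmetric] by (simp add: image_image)
  then have fin: "finite (?F ` ?A)" using finite_irr_chars by simp
  show "finite (twist_isoclasses G n)"
    unfolding twist_isoclasses_def r by (rule quotient_kernel(1)[OF fin])
  show "twist_count G n = card (twist_orbit ` {\<chi> \<in> irr_chars. \<chi> \<one> = of_nat n})"
    unfolding twist_count_def twist_isoclasses_def r FA[symmetric] by (rule quotient_kernel(2)[OF fin])
qed

text \<open>Burnside's counting: each orbit is the image of \<open>lin_chars\<close>, and the fibres of this map are cosets of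
  the stabilizer.\<close>
lemma sum_stabilizers:
  "(\<Sum>\<chi>\<in>irr_chars. card {l \<in> lin_chars. twist \<chi> l = \<chi>}) = card (twist_orbit ` irr_chars) * card lin_chars"
proof -
  let ?s = "\<lambda>\<chi>. card {l \<in> lin_chars. twist \<chi> l = \<chi>}"
  have "(\<Sum>\<chi>\<in>irr_chars. ?s \<chi>) = (\<Sum>z\<in>twist_orbit ` irr_chars. \<Sum>\<chi>\<in>{\<chi> \<in> irr_chars. twist_orbit \<chi> = z}. ?s \<chi>)"
    by (rule sum.image_gen[OF finite_irr_chars])
  also have "\<dots> = (\<Sum>z\<in>twist_orbit ` irr_chars. card lin_chars)"
  proof (rule sum.cong[OF refl])
    fix z assume "z \<in> twist_orbit ` irr_chars"
    then obtain \<phi> where \<phi>: "\<phi> \<in> irr_chars" "z = twist_orbit \<phi>" by blast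
    have set: "{\<chi> \<in> irr_chars. twist_orbit \<chi> = z} = twist \<phi> ` lin_chars"
      using twist_orbit_eq_iff[OF _ \<phi>(1)] twist_irr[OF \<phi>(1)] \<phi>(2) by auto
    have fib: "?s \<chi> = card {l \<in> lin_chars. twist \<phi> l = \<chi>}" if "\<chi> \<in> twist \<phi> ` lin_chars" for \<chi>
    proof -
      obtain m where m: "m \<in> lin_chars" "\<chi> = twist \<phi> m" using \<open>\<chi> \<in> twist \<phi> ` lin_chars\<close> by blast
      have "bij_betw (\<lambda>l. twist l m) {l \<in> lin_chars. twist \<chi> l = \<chi>} {l \<in> lin_chars. twist \<phi> l = \<chi>}"
      proof (rule bij_betw_byWitness[where f' = "\<lambda>l. twist l (lin_inv m)"])
        show "\<forall>l\<in>{l \<in> lin_chars. twist \<chi> l = \<chi>}. twist (twist l m) (lin_inv m) = l"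
          using twist_cancel(1)[OF m(1)] lin_char_outside by blast
        show "\<forall>l\<in>{l \<in> lin_chars. twist \<phi> l = \<chi>}. twist (twist l (lin_inv m)) m = l"
          using twist_cancel(2)[OF m(1)] lin_char_outside by blast
        show "(\<lambda>l. twist l m) ` {l \<in> lin_chars. twist \<chi> l = \<chi>} \<subseteq> {l \<in> lin_chars. twist \<phi> l = \<chi>}"
        proof (intro image_subsetI CollectI conjI; elim CollectE conjE)
          fix l assume l: "l \<in> lin_chars" "twist \<chi> l = \<chi>"
          show "twist l m \<in> lin_chars" by (rule twist_lin[OF l(1) m(1)])
          have "twist \<phi> (twist l m) = twist \<chi> l"
            by (simp add: m(2) twist_assoc twist_commute[of l m])
          then show "twist \<phi> (twist l m) = \<chi>" using l(2) by simp
        qed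
        show "(\<lambda>l. twist l (lin_inv m)) ` {l \<in> lin_chars. twist \<phi> l = \<chi>} \<subseteq> {l \<in> lin_chars. twist \<chi> l = \<chi>}"
        proof safe
          fix l assume l: "l \<in> lin_chars" "\<chi> = twist \<phi> l"
          show "twist l (lin_inv m) \<in> lin_chars" using twist_lin lin_inv l m by blast
          have "twist (twist \<phi> l) (twist l (lin_inv m)) = twist (twist \<phi> m) (twist l (lin_inv m))"
            using l m by simp
          also have "twist m (twist l (lin_inv m)) = l"
            using twist_cancel(1)[OF m(1), of l] lin_char_outside[OF l(1)]
            by (metis twist_assoc twist_commute)
          then have "twist (twist \<phi> m) (twist l (lin_inv m)) = twist \<phi> l" by (simp add: twist_assoc)
          finally show "twist (twist \<phi> l) (twist l (lin_inv m)) = twist \<phi> l" .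
        qed
      qed
      then show ?thesis by (rule bij_betw_same_card)
    qed
    have "(\<Sum>\<chi>\<in>twist \<phi> ` lin_chars. ?s \<chi>) = (\<Sum>\<chi>\<in>twist \<phi> ` lin_chars. \<Sum>l\<in>{l \<in> lin_chars. twist \<phi> l = \<chi>}. 1)"
      by (intro sum.cong refl) (simp add: fib)
    also have "\<dots> = card lin_chars"
      using sum.image_gen[OF finite_lin_chars, of "\<lambda>_. 1 :: nat" "twist \<phi>"] by simp
    finally show "(\<Sum>\<chi>\<in>{\<chi> \<in> irr_chars. twist_orbit \<chi> = z}. ?s \<chi>) = card lin_chars" by (simp add: set)
  qed
  finally show ?thesis by simp
qed

text \<open>The number of \<open>l\<close> fixing \<open>\<chi>\<close> is a sum of inner products of \<open>\<chi> l\<close> with \<open>\<chi>\<close>. Exchanging the sums,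
  column orthogonality turns the sum over \<open>\<chi>\<close> into the order of a centralizer. Only elements killed by
  all linear characters contribute.\<close>
lemma card_twist_orbits:
  "of_nat (card (carrier G) * card lin_chars * card (twist_orbit ` irr_chars)) =
    (\<Sum>g\<in>carrier G. (\<Sum>l\<in>lin_chars. l g) * of_nat (card {h \<in> carrier G. h \<otimes> g = g \<otimes> h}))"
proof -
  let ?N = "of_nat (card (carrier G)) :: complex"
  have "of_nat (card (carrier G) * card lin_chars * card (twist_orbit ` irr_chars)) =
      ?N * (\<Sum>\<chi>\<in>irr_chars. of_nat (card {l \<in> lin_chars. twist \<chi> l = \<chi>}))"
    using arg_cong[OF sum_stabilizers, of "of_nat :: nat \<Rightarrow> complex"] by (auto simp: mult_ac)
  also have "\<dots> = (\<Sum>\<chi>\<in>irr_chars. \<Sum>l\<in>lin_chars. if twist \<chi> l = \<chi> then ?N else 0)"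
    by (simp add: sum_distrib_left sum.If_cases Collect_conj_eq Int_commute mult.commute)
  also have "\<dots> = (\<Sum>\<chi>\<in>irr_chars. \<Sum>l\<in>lin_chars. \<Sum>g\<in>carrier G. l g * (\<chi> g * \<chi> (inv g)))"
  proof (intro sum.cong refl)
    fix \<chi> l assume "\<chi> \<in> irr_chars" "l \<in> lin_chars"
    then show "(if twist \<chi> l = \<chi> then ?N else 0) = (\<Sum>g\<in>carrier G. l g * (\<chi> g * \<chi> (inv g)))"
      using irr_chars_orthogonality[OF twist_irr] by (simp add: twist_def mult_ac)
  qed
  also have "\<dots> = (\<Sum>g\<in>carrier G. \<Sum>l\<in>lin_chars. \<Sum>\<chi>\<in>irr_chars. l g * (\<chi> g * \<chi> (inv g)))"
    by (subst sum.swap, subst (2) sum.swap, subst sum.swap, rule refl)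
  also have "\<dots> = (\<Sum>g\<in>carrier G. (\<Sum>l\<in>lin_chars. l g) * of_nat (card {h \<in> carrier G. h \<otimes> g = g \<otimes> h}))"
    by (intro sum.cong refl) (simp add: sum_distrib_left[symmetric] sum_distrib_right[symmetric] sum_irr_chars_pair)
  finally show ?thesis .
qed

lemma card_irr_chars:
  "of_nat (card (carrier G) * card irr_chars) = (\<Sum>g\<in>carrier G. of_nat (card {h \<in> carrier G. h \<otimes> g = g \<otimes> h}) :: complex)"
proof -
  have "of_nat (card (carrier G) * card irr_chars) = (\<Sum>\<chi>\<in>irr_chars. \<Sum>g\<in>carrier G. \<chi> g * \<chi> (inv g))"
    by (simp add: irr_chars_orthogonality)
  also have "\<dots> = (\<Sum>g\<in>carrier G. \<Sum>\<chi>\<in>irr_chars. \<chi> g * \<chi> (inv g))" by (rule sum.swap)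
  also have "\<dots> = (\<Sum>g\<in>carrier G. of_nat (card {h \<in> carrier G. h \<otimes> g = g \<otimes> h}))"
    by (simp add: sum_irr_chars_pair)
  finally show ?thesis .
qed

section \<open>Multiplicities of characters of subgroups\<close>

text \<open>The usual projection onto the \<open>\<theta>\<close>-isotypic part of the restriction to \<open>H\<close>.\<close>
lemma isotypic_projection:
  assumes rep: "representation G n \<rho>" and H: "subgroup H G"
    and \<theta>: "\<And>x y. x \<in> H \<Longrightarrow> y \<in> H \<Longrightarrow> \<theta> (x \<otimes> y) = \<theta> x * \<theta> y" "\<theta> \<one> = (1 :: complex)"
  obtains E where "E \<in> carrier_mat n n" "E * E = E"
    "mtrace E = (\<Sum>h\<in>H. \<theta> (inv h) * character \<rho> h) / of_nat (card H)"
    "\<And>h. h \<in> H \<Longrightarrow> \<rho> h * E = \<theta> h \<cdot>\<^sub>m E"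
proof -
  have HG: "\<And>h. h \<in> H \<Longrightarrow> h \<in> carrier G" and Hinv: "\<And>h. h \<in> H \<Longrightarrow> inv h \<in> H"
    and Hmult: "\<And>h k. h \<in> H \<Longrightarrow> k \<in> H \<Longrightarrow> h \<otimes> k \<in> H" and H1: "\<one> \<in> H"
    using H by (auto simp: subgroup_def)
  have "finite H" using finite_subset[OF _ finite_carrier] HG by blast
  then have cH: "card H > 0" using H1 by (auto simp: card_gt_0_iff)
  have \<theta>inv: "\<theta> h * \<theta> (inv h) = 1" if "h \<in> H" for h
    using \<theta>(1)[OF that Hinv[OF that]] \<theta>(2) HG[OF that] by simp
  note \<rho> = rep_carrier[OF rep]
  define E where "E = msum n n (\<lambda>h. (\<theta> (inv h) / of_nat (card H)) \<cdot>\<^sub>m \<rho> h) H"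
  have E: "E \<in> carrier_mat n n" by (simp add: E_def)
  have car: "c \<cdot>\<^sub>m \<rho> h \<in> carrier_mat n n" if "h \<in> H" for c h using \<rho>[OF HG[OF that]] by simp
  have eig: "\<rho> k * E = \<theta> k \<cdot>\<^sub>m E" if k: "k \<in> H" for k
  proof -
    have bij: "bij_betw (\<lambda>h. k \<otimes> h) H H"
      by (rule bij_betw_byWitness[where f' = "\<lambda>h. inv k \<otimes> h"])
        (use k HG Hinv Hmult in \<open>auto simp: m_assoc[symmetric]\<close>)
    have "\<rho> k * E = msum n n (\<lambda>h. \<rho> k * ((\<theta> (inv h) / of_nat (card H)) \<cdot>\<^sub>m \<rho> h)) H"
      unfolding E_def by (rule mult_msum[OF \<rho>[OF HG[OF k]] car])
    also have "\<dots> = msum n n (\<lambda>h. \<theta> k \<cdot>\<^sub>m ((\<theta> (inv (k \<otimes> h)) / of_nat (card H)) \<cdot>\<^sub>m \<rho> (k \<otimes> h))) H"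
    proof (rule msum_cong[OF refl])
      fix h assume h: "h \<in> H"
      have "\<theta> (inv (k \<otimes> h)) * \<theta> k = \<theta> (inv h)"
        using h k HG Hinv Hmult \<theta>(1)[of "inv (k \<otimes> h)" k] by (simp add: inv_mult_group m_assoc)
      then show "\<rho> k * ((\<theta> (inv h) / of_nat (card H)) \<cdot>\<^sub>m \<rho> h) =
          \<theta> k \<cdot>\<^sub>m ((\<theta> (inv (k \<otimes> h)) / of_nat (card H)) \<cdot>\<^sub>m \<rho> (k \<otimes> h))"
        using mult_smult_distrib[OF \<rho>[OF HG[OF k]] \<rho>[OF HG[OF h]]] rep_mult[OF rep HG[OF k] HG[OF h]]
        by (simp add: smult_smult_mat mult.commute)
    qed
    also have "\<dots> = msum n n (\<lambda>h. \<theta> k \<cdot>\<^sub>m ((\<theta> (inv h) / of_nat (card H)) \<cdot>\<^sub>m \<rho> h)) H"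
      by (rule msum_reindex[OF bij, where f = "\<lambda>h. \<theta> k \<cdot>\<^sub>m ((\<theta> (inv h) / of_nat (card H)) \<cdot>\<^sub>m \<rho> h)"])
    also have "\<dots> = \<theta> k \<cdot>\<^sub>m E"
      using carrier_matD[OF \<rho>[OF HG]] by (intro eq_matI) (auto simp: E_def sum_distrib_left intro!: sum.cong)
    finally show ?thesis .
  qed
  have "E * E = msum n n (\<lambda>h. (\<theta> (inv h) / of_nat (card H)) \<cdot>\<^sub>m \<rho> h * E) H"
    by (subst E_def) (rule msum_mult[OF E car])
  also have "\<dots> = msum n n (\<lambda>h. (1 / of_nat (card H)) \<cdot>\<^sub>m E) H"
  proof (rule msum_cong[OF refl])
    fix h assume h: "h \<in> H"
    show "(\<theta> (inv h) / of_nat (card H)) \<cdot>\<^sub>m \<rho> h * E = (1 / of_nat (card H)) \<cdot>\<^sub>m E"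
      using mult_smult_assoc_mat[OF \<rho>[OF HG[OF h]] E] eig[OF h] \<theta>inv[OF h]
      by (simp add: smult_smult_mat mult.commute)
  qed
  also have "\<dots> = E" using cH E by (intro eq_matI) auto
  finally have idem: "E * E = E" .
  have "mtrace E = (\<Sum>h\<in>H. mtrace ((\<theta> (inv h) / of_nat (card H)) \<cdot>\<^sub>m \<rho> h))"
    unfolding E_def by (rule mtrace_msum[OF car])
  also have "\<dots> = (\<Sum>h\<in>H. \<theta> (inv h) / of_nat (card H) * character \<rho> h)"
    by (intro sum.cong refl) (use mtrace_smult[OF \<rho>[OF HG]] HG in \<open>simp add: character_def\<close>)
  also have "\<dots> = (\<Sum>h\<in>H. \<theta> (inv h) * character \<rho> h) / of_nat (card H)"
    by (simp add: sum_divide_distrib)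
  finally show ?thesis using that[OF E idem _ eig] by blast
qed

lemma subgroup_multiplicity_nat:
  assumes \<chi>: "\<chi> \<in> irr_chars" and H: "subgroup H G"
    and \<theta>: "\<And>x y. x \<in> H \<Longrightarrow> y \<in> H \<Longrightarrow> \<theta> (x \<otimes> y) = \<theta> x * \<theta> y" "\<theta> \<one> = (1 :: complex)"
  shows "(\<Sum>h\<in>H. \<theta> (inv h) * \<chi> h) / of_nat (card H) \<in> \<nat>"
proof -
  obtain n \<rho> where \<rho>: "irreducible_rep G n \<rho>" "\<chi> = character \<rho>" using \<chi> by (auto simp: irr_chars_def)
  obtain E where "E \<in> carrier_mat n n" "E * E = E"
    "mtrace E = (\<Sum>h\<in>H. \<theta> (inv h) * character \<rho> h) / of_nat (card H)"
    by (rule isotypic_projection[OF irr_rep[OF \<rho>(1)] H \<theta>]) auto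
  then show ?thesis using idempotent_mtrace(1) \<rho>(2) by metis
qed

text \<open>If the invariants of \<open>H\<close> have full dimension, the projection onto them is the identity.\<close>
lemma rep_trivial_on_subgroup:
  assumes rep: "representation G n \<rho>" and H: "subgroup H G"
    and full: "(\<Sum>h\<in>H. character \<rho> h) = of_nat (card H) * of_nat n" and h: "h \<in> H"
  shows "\<rho> h = 1\<^sub>m n"
proof -
  obtain E where E: "E \<in> carrier_mat n n" "E * E = E"
    "mtrace E = (\<Sum>h\<in>H. 1 * character \<rho> h) / of_nat (card H)"
    "\<And>h. h \<in> H \<Longrightarrow> \<rho> h * E = 1 \<cdot>\<^sub>m E"
    by (rule isotypic_projection[OF rep H, of "\<lambda>_. 1"]) auto
  have "finite H" using finite_subset[OF _ finite_carrier] H by (auto simp: subgroup_def)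
  then have "card H \<noteq> 0" using h by auto
  then have "mtrace E = of_nat n" using E(3) full by simp
  then have E1: "E = 1\<^sub>m n" by (rule idempotent_mtrace_full[OF E(1,2)])
  have "h \<in> carrier G" using h H by (auto simp: subgroup_def)
  have "\<rho> h = \<rho> h * E" using rep_carrier[OF rep \<open>h \<in> carrier G\<close>] by (simp add: E1)
  also have "\<dots> = 1 \<cdot>\<^sub>m E" by (rule E(4)[OF h])
  also have "\<dots> = 1\<^sub>m n" by (rule eq_matI) (auto simp: E1)
  finally show ?thesis .
qed

section \<open>The class equation\<close>

lemma card_transporter:
  assumes g: "g \<in> carrier G" and c: "c \<in> carrier G" and x0: "x0 \<in> carrier G" "g \<otimes> x0 = x0 \<otimes> c"
  shows "card {h \<in> carrier G. h \<otimes> g = g \<otimes> h} = card {x \<in> carrier G. g \<otimes> x = x \<otimes> c}"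
proof (rule bij_betw_same_card[OF bij_betw_byWitness[where f = "\<lambda>h. h \<otimes> x0" and f' = "\<lambda>x. x \<otimes> inv x0"]])
  have x0': "inv x0 \<otimes> g = c \<otimes> inv x0"
    using g c x0 by (metis inv_solve_left inv_solve_right m_assoc m_closed inv_closed)
  show "(\<lambda>h. h \<otimes> x0) ` {h \<in> carrier G. h \<otimes> g = g \<otimes> h} \<subseteq> {x \<in> carrier G. g \<otimes> x = x \<otimes> c}"
    using g c x0 by (auto simp: m_assoc) (metis m_assoc)
  show "(\<lambda>x. x \<otimes> inv x0) ` {x \<in> carrier G. g \<otimes> x = x \<otimes> c} \<subseteq> {h \<in> carrier G. h \<otimes> g = g \<otimes> h}"
  proof safe
    fix x assume x: "x \<in> carrier G" "g \<otimes> x = x \<otimes> c"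
    have "x \<otimes> inv x0 \<otimes> g = x \<otimes> (c \<otimes> inv x0)" using x g x0 x0' by (simp add: m_assoc)
    also have "\<dots> = g \<otimes> x \<otimes> inv x0" using x g c x0(1) by (simp add: m_assoc)
    also have "\<dots> = g \<otimes> (x \<otimes> inv x0)" using x(1) g x0(1) by (simp add: m_assoc)
    finally show "x \<otimes> inv x0 \<otimes> g = g \<otimes> (x \<otimes> inv x0)" .
  qed (use x0 in auto)
qed (use x0 in \<open>auto simp: m_assoc\<close>)

text \<open>The class equation, weighted so that every conjugacy class contributes the order of the group.\<close>
lemma sum_centralizers_class:
  assumes c: "c \<in> carrier G"
  shows "(\<Sum>g | g \<in> carrier G \<and> (\<exists>x\<in>carrier G. g \<otimes> x = x \<otimes> c). card {h \<in> carrier G. h \<otimes> g = g \<otimes> h}) = card (carrier G)"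
proof -
  let ?S = "{g. g \<in> carrier G \<and> (\<exists>x\<in>carrier G. g \<otimes> x = x \<otimes> c)}"
  let ?f = "\<lambda>x. x \<otimes> c \<otimes> inv x"
  have f_iff: "?f x = g \<longleftrightarrow> g \<otimes> x = x \<otimes> c" if "x \<in> carrier G" "g \<in> carrier G" for x g
    using that c by (metis inv_solve_right m_closed)
  have S: "?S = ?f ` carrier G"
    using f_iff c by (auto simp: image_iff) (metis inv_closed m_closed)+
  have "(\<Sum>g\<in>?S. card {h \<in> carrier G. h \<otimes> g = g \<otimes> h}) = (\<Sum>g\<in>?S. card {x \<in> carrier G. ?f x = g})"
  proof (rule sum.cong[OF refl])
    fix g assume "g \<in> ?S"
    then obtain x0 where g: "g \<in> carrier G" and x0: "x0 \<in> carrier G" "g \<otimes> x0 = x0 \<otimes> c" by blast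
    have "{x \<in> carrier G. g \<otimes> x = x \<otimes> c} = {x \<in> carrier G. ?f x = g}" using f_iff g by blast
    then show "card {h \<in> carrier G. h \<otimes> g = g \<otimes> h} = card {x \<in> carrier G. ?f x = g}"
      using card_transporter[OF g c x0] by simp
  qed
  also have "\<dots> = card (carrier G)"
    using sum.image_gen[OF finite_carrier, of "\<lambda>_. 1 :: nat" ?f] by (simp add: S)
  finally show ?thesis .
qed

lemma irr_char_conj:
  assumes \<chi>: "\<chi> \<in> irr_chars" and h: "h \<in> carrier G" "x \<in> carrier G" "y \<in> carrier G" "h \<otimes> y = x \<otimes> h"
  shows "\<chi> x = \<chi> y"
proof -
  obtain n \<rho> where \<rho>: "irreducible_rep G n \<rho>" "\<chi> = character \<rho>" using \<chi> by (auto simp: irr_chars_def)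
  have "x = h \<otimes> (y \<otimes> inv h)" using h by (metis inv_solve_right m_assoc inv_closed m_closed)
  moreover have "y \<otimes> inv h \<otimes> h = y" using h by (simp add: m_assoc)
  ultimately show ?thesis
    using character_mult_commute[OF irr_rep[OF \<rho>(1)] h(1), of "y \<otimes> inv h"] \<rho>(2) h by simp
qed

end

section \<open>Matrices of size two and their conjugacy classes\<close>

definition M2 :: "'a \<Rightarrow> 'a \<Rightarrow> 'a \<Rightarrow> 'a \<Rightarrow> 'a mat" where
  "M2 a b c d = mat 2 2 (\<lambda>(i, j). if i = 0 then (if j = 0 then a else b) else (if j = 0 then c else d))"

lemma less_2_iff: "i < (2::nat) \<longleftrightarrow> i = 0 \<or> i = 1" by auto

lemma M2_carrier [simp]: "M2 a b c d \<in> carrier_mat 2 2" by (simp add: M2_def)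

lemma M2_index [simp]: "M2 a b c d $$ (0, 0) = a" "M2 a b c d $$ (0, Suc 0) = b"
    "M2 a b c d $$ (Suc 0, 0) = c" "M2 a b c d $$ (Suc 0, Suc 0) = d"
  by (simp_all add: M2_def)

lemma M2_eq_iff [simp]: "M2 a b c d = M2 a' b' c' d' \<longleftrightarrow> a = a' \<and> b = b' \<and> c = c' \<and> d = d'"
  by (metis M2_index)

lemma M2_exhaust:
  assumes "A \<in> carrier_mat 2 2"
  obtains a b c d where "A = M2 a b c d"
proof
  show "A = M2 (A $$ (0, 0)) (A $$ (0, 1)) (A $$ (1, 0)) (A $$ (1, 1))"
    using assms by (intro eq_matI) (auto simp: M2_def less_2_iff)
qed

lemma M2_mult [simp]:
  "M2 a b c d * M2 a' b' c' d' =
    M2 (a * a' + b * c') (a * b' + b * d') (c * a' + d * c') (c * b' + (d::'a::semiring_0) * d')"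
  by (rule eq_matI) (auto simp: M2_def less_2_iff scalar_prod_def numeral_2_eq_2)

lemma M2_one: "1\<^sub>m 2 = M2 1 0 0 (1::'a::{zero,one})"
  by (rule eq_matI) (auto simp: M2_def less_2_iff)

lemma M2_det [simp]: "Determinant.det (M2 a b c d) = a * d - b * (c::'a::comm_ring_1)"
proof -
  have "Determinant.det (M2 a b c d) = (\<Sum>i<2. M2 a b c d $$ (i, 0) * cofactor (M2 a b c d) i 0)"
    by (rule laplace_expansion_column) auto
  moreover have "mat_delete (M2 a b c d) 0 0 = mat 1 1 (\<lambda>_. d)" "mat_delete (M2 a b c d) 1 0 = mat 1 1 (\<lambda>_. b)"
    by (auto simp: mat_delete_def M2_def)
  ultimately show ?thesis
    by (simp add: numeral_2_eq_2 cofactor_def det_single)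
qed

abbreviation GL2 :: "'f::{field,finite} mat monoid" where
  "GL2 \<equiv> GL TYPE('f) 2"

lemma M2_GL2 [simp]: "M2 a b c d \<in> carrier GL2 \<longleftrightarrow> a * d \<noteq> b * c"
  by (simp add: GL_carrier_det)

lemma GL2_cases:
  assumes "g \<in> carrier GL2"
  obtains a b c d where "g = M2 a b c d" "a * d \<noteq> b * c"
  using assms M2_exhaust[of g] by (metis GL_carrier_det M2_GL2)

lemma GL2_det_nonzero: "g \<in> carrier GL2 \<Longrightarrow> Determinant.det g \<noteq> 0"
  by (simp add: GL_carrier_det)

lemma GL2_det_mult: "g \<in> carrier GL2 \<Longrightarrow> h \<in> carrier GL2 \<Longrightarrow> Determinant.det (g * h) = Determinant.det g * Determinant.det h"
  by (auto simp: GL_carrier_det intro!: det_mult)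

lemma inj_M2: "inj (\<lambda>(a, b, c, d). M2 a b c d)"
  by (auto simp: inj_def)

lemma card_GL2_Collect:
  "card {g \<in> carrier GL2. P g} = card {(a, b, c, d). a * d \<noteq> b * c \<and> P (M2 a b c d)}"
proof -
  have "{g \<in> carrier GL2. P g} = (\<lambda>(a, b, c, d). M2 a b c d) ` {(a, b, c, d). a * d \<noteq> b * c \<and> P (M2 a b c d)}"
  proof (intro equalityI subsetI)
    fix g assume g: "g \<in> {g \<in> carrier GL2. P g}"
    then obtain a b c d where abcd: "g = M2 a b c d" "a * d \<noteq> b * c" by (auto elim: GL2_cases)
    have "g = (\<lambda>(a, b, c, d). M2 a b c d) (a, b, c, d)" using abcd by simp
    then show "g \<in> (\<lambda>(a, b, c, d). M2 a b c d) ` {(a, b, c, d). a * d \<noteq> b * c \<and> P (M2 a b c d)}"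
      by (rule image_eqI) (use g abcd in simp)
  qed auto
  then show ?thesis by (simp add: card_image inj_on_subset[OF inj_M2])
qed

lemma finite_GL2: "finite (carrier (GL2 :: 'f::{field,finite} mat monoid))"
proof (rule finite_subset)
  show "carrier GL2 \<subseteq> range (\<lambda>(a, b, c, d). M2 a b c (d::'f))"
  proof
    fix g :: "'f mat" assume "g \<in> carrier GL2"
    then obtain a b c d where "g = M2 a b c d" by (auto elim: GL2_cases)
    then have "g = (\<lambda>(a, b, c, d). M2 a b c d) (a, b, c, d)" by simp
    then show "g \<in> range (\<lambda>(a, b, c, d). M2 a b c (d::'f))" by (rule range_eqI)
  qed
qed simp

interpretation GL2: finite_group "GL2 :: 'f::{field,finite} mat monoid"
  using GL_group finite_GL2 by (auto simp: finite_group_def finite_group_axioms_def)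

lemma card_nonzero: "card (- {0 :: 'f::{field,finite}}) = CARD('f) - 1"
  by (simp add: Compl_eq_Diff_UNIV)

lemma card_GL2:
  "card (carrier (GL2 :: 'f::{field,finite} mat monoid)) = CARD('f) * (CARD('f) - 1)^2 * (CARD('f) + 1)"
proof -
  let ?q = "CARD('f)"
  let ?X = "{(a, b, c, d). a * d \<noteq> b * (c::'f)}"
  \<comment> \<open>The two Bruhat cells. In the big one the determinant \<open>e\<close> serves as a coordinate in place of \<open>b\<close>.\<close>
  let ?A = "(\<lambda>(b, a, d). (a, b, 0 :: 'f, d)) ` ((UNIV :: 'f set) \<times> (- {0 :: 'f}) \<times> (- {0 :: 'f}))"
  let ?B = "(\<lambda>(a, d, c, e). (a, (a * d - e) / c, c, d)) ` ((UNIV :: 'f set) \<times> UNIV \<times> (- {0}) \<times> (- {0}))"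
  have "?X = ?A \<union> ?B"
  proof (intro equalityI subsetI)
    fix t assume "t \<in> ?X"
    then obtain a b c d where t: "t = (a, b, c, d)" "a * d \<noteq> b * c" by auto
    show "t \<in> ?A \<union> ?B"
    proof (cases "c = 0")
      case True
      then have "t = (\<lambda>(b, a, d). (a, b, 0, d)) (b, a, d)" "(b, a, d) \<in> UNIV \<times> (- {0}) \<times> (- {0})"
        using t by auto
      then show ?thesis by blast
    next
      case False
      then have "t = (\<lambda>(a, d, c, e). (a, (a * d - e) / c, c, d)) (a, d, c, a * d - b * c)"
        "(a, d, c, a * d - b * c) \<in> UNIV \<times> UNIV \<times> (- {0}) \<times> (- {0})"
        using t by auto
      then show ?thesis by blast
    qed
  qed auto
  moreover have "?A \<inter> ?B = {}" by auto
  moreover have "card ?A = ?q * (?q - 1)^2"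
    by (subst card_image) (auto simp: inj_on_def card_cartesian_product card_nonzero power2_eq_square)
  moreover have "card ?B = ?q^2 * (?q - 1)^2"
    by (subst card_image) (auto simp: inj_on_def card_cartesian_product card_nonzero power2_eq_square)
  ultimately have "card ?X = ?q * (?q - 1)^2 + ?q^2 * (?q - 1)^2"
    by (simp add: card_Un_disjoint)
  moreover have "n * m\<^sup>2 + n\<^sup>2 * m\<^sup>2 = n * m\<^sup>2 * (n + 1)" for n m :: nat
    by (simp add: algebra_simps power2_eq_square)
  ultimately show ?thesis using card_GL2_Collect[of "\<lambda>_ :: 'f mat. True"] by simp
qed

text \<open>In the Borel subgroup only the nontrivial unipotent elements are conjugate to \<open>M2 1 1 0 1\<close> in the
  whole group, and the conjugating elements are themselves upper triangular. All sums of products of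
  character values at these elements reduce to this count.\<close>
lemma card_transporter_unipotent:
  fixes x y z :: "'f::{field,finite}"
  assumes "x \<noteq> 0" "z \<noteq> 0"
  shows "card {h \<in> carrier GL2. h * M2 1 1 0 1 = M2 x y 0 z * h} =
    (if x = 1 \<and> z = 1 \<and> y \<noteq> 0 then CARD('f) * (CARD('f) - 1) else 0)"
proof -
  have eq: "(a * d \<noteq> b * c \<and> M2 a b c d * M2 1 1 0 1 = M2 x y 0 z * M2 a b c d) \<longleftrightarrow>
      (x = 1 \<and> z = 1 \<and> y \<noteq> 0) \<and> c = 0 \<and> d \<noteq> 0 \<and> a = y * d" for a b c d
    using assms by (auto simp: algebra_simps)
  show ?thesis
  proof (cases "x = 1 \<and> z = 1 \<and> y \<noteq> 0")
    case True
    have "{(a, b, c, d). c = 0 \<and> d \<noteq> 0 \<and> a = y * d} = (\<lambda>(b, d). (y * d, b, 0 :: 'f, d)) ` ((UNIV :: 'f set) \<times> (- {0}))"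
      by auto
    moreover have "card ((\<lambda>(b, d). (y * d, b, 0 :: 'f, d)) ` ((UNIV :: 'f set) \<times> (- {0}))) = CARD('f) * (CARD('f) - 1)"
      by (subst card_image) (auto simp: inj_on_def card_cartesian_product card_nonzero)
    ultimately have "card {(a, b :: 'f, c :: 'f, d). c = 0 \<and> d \<noteq> 0 \<and> a = y * d} = CARD('f) * (CARD('f) - 1)"
      by simp
    then show ?thesis unfolding card_GL2_Collect eq using True by simp
  next
    case False
    show ?thesis unfolding card_GL2_Collect eq by (simp only: False if_False simp_thms) simp
  qed
qed

text \<open>A nonscalar matrix has a cyclic vector \<open>v\<close>. The conjugating matrix has the columns \<open>v\<close> and \<open>g v\<close>,
  where \<open>v\<close> can be chosen among \<open>(1, 0)\<close>, \<open>(0, 1)\<close> and \<open>(1, 1)\<close>.\<close>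
lemma companion_conjugate:
  fixes a b c d :: "'f::{field,finite}"
  assumes nonscalar: "\<not> (b = 0 \<and> c = 0 \<and> a = d)"
  shows "\<exists>x\<in>carrier GL2. M2 a b c d * x = x * M2 0 (- (a * d - b * c)) 1 (a + d)"
proof -
  consider "c \<noteq> 0" | "c = 0" "b \<noteq> 0" | "c = 0" "b = 0" "a \<noteq> d" using nonscalar by blast
  then show ?thesis
  proof cases
    case 1
    then show ?thesis by (intro bexI[of _ "M2 1 a 0 c"]) (auto simp: algebra_simps)
  next
    case 2
    then show ?thesis by (intro bexI[of _ "M2 0 b 1 d"]) (auto simp: algebra_simps)
  next
    case 3
    then show ?thesis by (intro bexI[of _ "M2 1 a 1 d"]) (auto simp: algebra_simps)
  qed
qed

text \<open>A nonscalar class is thus determined by determinant and trace.\<close>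
lemma GL2_class_companion:
  fixes \<delta> t :: "'f::{field,finite}"
  assumes \<delta>: "\<delta> \<noteq> 0"
  shows "{g. g \<in> carrier GL2 \<and> (\<exists>x\<in>carrier GL2. g * x = x * M2 0 (- \<delta>) 1 t)} =
    {M2 a b c d | a b c d. a * d - b * c = \<delta> \<and> a + d = t \<and> \<not> (b = 0 \<and> c = 0 \<and> a = d)}" (is "?L = ?R")
proof (intro equalityI subsetI)
  fix g assume "g \<in> ?L"
  then obtain x where x: "x \<in> carrier GL2" "g \<in> carrier GL2" "g * x = x * M2 0 (- \<delta>) 1 t" by blast
  obtain a b c d where g: "g = M2 a b c d" using x(2) by (auto elim: GL2_cases)
  obtain r s u v where xx: "x = M2 r s u v" "r * v \<noteq> s * u" using x(1) by (auto elim: GL2_cases)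
  have e: "a * r + b * u = s" "a * s + b * v = t * s - \<delta> * r" "c * r + d * u = v" "c * s + d * v = t * v - \<delta> * u"
    using x(3) by (auto simp: g xx algebra_simps)
  have ns: "\<not> (b = 0 \<and> c = 0 \<and> a = d)" using e xx(2) by (auto simp: algebra_simps)
  have "(a * d - b * c) * (r * v - s * u) = (a * r + b * u) * (c * s + d * v) - (a * s + b * v) * (c * r + d * u)"
    by (simp add: algebra_simps)
  also have "\<dots> = \<delta> * (r * v - s * u)" unfolding e by (simp add: algebra_simps)
  finally have "(a * d - b * c) * (r * v - s * u) = \<delta> * (r * v - s * u)" .
  moreover have "(a + d) * (r * v - s * u) = t * (r * v - s * u)"
  proof -
    \<comment> \<open>The derivative of the determinant along \<open>g\<close>, in the columns \<open>(r, u)\<close> and \<open>(s, v)\<close> of \<open>x\<close>.\<close>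
    have "(a + d) * (r * v - s * u) =
        ((a * r + b * u) * v - (c * r + d * u) * s) + (r * (c * s + d * v) - u * (a * s + b * v))"
      by (simp add: algebra_simps)
    also have "\<dots> = t * (r * v - s * u)" unfolding e by (simp add: algebra_simps)
    finally show ?thesis .
  qed
  ultimately show "g \<in> ?R" using xx(2) ns g by auto
next
  fix g assume "g \<in> ?R"
  then obtain a b c d where g: "g = M2 a b c d" "a * d - b * c = \<delta>" "a + d = t" "\<not> (b = 0 \<and> c = 0 \<and> a = d)" by blast
  have "a * d \<noteq> b * c" using g(2) \<delta> by auto
  then show "g \<in> ?L" using companion_conjugate[OF g(4)] g(1-3) by auto
qed

text \<open>By the class equation this counts conjugacy classes of determinant \<open>\<delta>\<close>: one nonscalar class for each
  trace, and the scalar matrices.\<close>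
lemma sum_centralizers_det:
  fixes \<delta> :: "'f::{field,finite}"
  assumes \<delta>: "\<delta> \<noteq> 0"
  shows "(\<Sum>g | g \<in> carrier GL2 \<and> Determinant.det g = \<delta>. card {h \<in> carrier GL2. h * g = g * h}) =
    card (carrier (GL2 :: 'f mat monoid)) * (CARD('f) + card {z. z^2 = \<delta>})"
proof -
  let ?C = "\<lambda>g :: 'f mat. card {h \<in> carrier GL2. h * g = g * h}"
  let ?D = "{g :: 'f mat. g \<in> carrier GL2 \<and> Determinant.det g = \<delta>}"
  let ?Z = "(\<lambda>z. M2 z 0 0 z) ` {z. z^2 = \<delta>}"
  let ?S = "\<lambda>t. {M2 a b c d | a b c d. a * d - b * c = \<delta> \<and> a + d = t \<and> \<not> (b = 0 \<and> c = 0 \<and> a = d)}"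
  have D: "?D = ?Z \<union> (\<Union>t. ?S t)"
  proof (intro equalityI subsetI)
    fix g assume g: "g \<in> ?D"
    then obtain a b c d where "g = M2 a b c d" "a * d - b * c = \<delta>" by (auto elim: GL2_cases)
    then show "g \<in> ?Z \<union> (\<Union>t. ?S t)" by (cases "b = 0 \<and> c = 0 \<and> a = d") (auto simp: power2_eq_square)
  next
    fix g assume "g \<in> ?Z \<union> (\<Union>t. ?S t)"
    then show "g \<in> ?D" using \<delta> by (auto simp: power2_eq_square)
  qed
  have fin: "finite A" if "A \<subseteq> carrier (GL2 :: 'f mat monoid)" for A
    using finite_subset[OF that finite_GL2] .
  have "?D \<subseteq> carrier GL2" by auto
  then have finD: "finite ?D" by (rule fin)
  have fin': "finite ?Z" "finite (\<Union>t. ?S t)" using finD unfolding D by blast+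
  have finS: "finite (?S t)" for t by (rule finite_subset[OF _ fin'(2)]) blast
  have disj: "?Z \<inter> (\<Union>t. ?S t) = {}" by auto
  have "(\<Sum>g\<in>?Z. ?C g) = (\<Sum>g\<in>?Z. card (carrier (GL2 :: 'f mat monoid)))"
  proof (rule sum.cong[OF refl])
    fix g assume "g \<in> ?Z"
    then obtain z where "g = M2 z 0 0 z" by blast
    then have "{h \<in> carrier GL2. h * g = g * h} = carrier GL2" by (auto elim!: GL2_cases)
    then show "?C g = card (carrier (GL2 :: 'f mat monoid))" by simp
  qed
  also have "\<dots> = card (carrier (GL2 :: 'f mat monoid)) * card {z. z^2 = \<delta>}"
    by (simp add: card_image inj_on_def)
  finally have Z: "(\<Sum>g\<in>?Z. ?C g) = card (carrier (GL2 :: 'f mat monoid)) * card {z. z^2 = \<delta>}" .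
  have S: "(\<Sum>g\<in>?S t. ?C g) = card (carrier (GL2 :: 'f mat monoid))" for t
  proof -
    have "M2 0 (- \<delta>) 1 t \<in> carrier GL2" using \<delta> by simp
    from GL2.sum_centralizers_class[OF this] show ?thesis
      by (simp only: GL_mult GL2_class_companion[OF \<delta>])
  qed
  have "(\<Sum>g\<in>(\<Union>t. ?S t). ?C g) = (\<Sum>t\<in>UNIV. \<Sum>g\<in>?S t. ?C g)"
  proof (rule sum.UNION_disjoint)
    show "\<forall>t\<in>UNIV. finite (?S t)" using finS by blast
    have "g $$ (0, 0) + g $$ (1, 1) = t" if gS: "g \<in> ?S t" for g t
    proof -
      obtain a b c d where "g = M2 a b c d" "a + d = t" using gS by blast
      then show ?thesis by simp
    qed
    then have "?S t \<inter> ?S t' = {}" if "t \<noteq> t'" for t t'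
      using that by (metis (no_types, lifting) disjoint_iff)
    then show "\<forall>t\<in>UNIV. \<forall>t'\<in>UNIV. t \<noteq> t' \<longrightarrow> ?S t \<inter> ?S t' = {}" by simp
  qed simp
  also have "\<dots> = CARD('f) * card (carrier (GL2 :: 'f mat monoid))" unfolding S by simp
  finally have U: "(\<Sum>g\<in>(\<Union>t. ?S t). ?C g) = CARD('f) * card (carrier (GL2 :: 'f mat monoid))" .
  show ?thesis unfolding D sum.union_disjoint[OF fin'(1,2) disj] Z U by (simp add: algebra_simps)
qed

section \<open>Characters of the multiplicative and the additive group of the field\<close>

definition unit_grp :: "'f::{field,finite} monoid" where
  "unit_grp = \<lparr>carrier = - {0}, monoid.mult = (*), one = 1\<rparr>"

definition add_grp :: "'f::{field,finite} monoid" where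
  "add_grp = \<lparr>carrier = UNIV, monoid.mult = (+), one = 0\<rparr>"

lemma unit_grp_simps [simp]: "carrier unit_grp = - {0}" "x \<otimes>\<^bsub>unit_grp\<^esub> y = x * y" "\<one>\<^bsub>unit_grp\<^esub> = 1"
  and add_grp_simps [simp]: "carrier add_grp = UNIV" "x \<otimes>\<^bsub>add_grp\<^esub> y = x + y" "\<one>\<^bsub>add_grp\<^esub> = 0"
  by (simp_all add: unit_grp_def add_grp_def)

interpretation U: finite_group "unit_grp :: 'f::{field,finite} monoid"
proof -
  have "group (unit_grp :: 'f monoid)"
  proof (rule groupI)
    fix x :: 'f assume "x \<in> carrier unit_grp"
    then show "\<exists>y\<in>carrier unit_grp. y \<otimes>\<^bsub>unit_grp\<^esub> x = \<one>\<^bsub>unit_grp\<^esub>"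
      by (intro bexI[of _ "inverse x"]) auto
  qed (auto simp: mult.assoc)
  then show "finite_group (unit_grp :: 'f monoid)" by (simp add: finite_group_def finite_group_axioms_def)
qed

interpretation A: finite_group "add_grp :: 'f::{field,finite} monoid"
proof -
  have "group (add_grp :: 'f monoid)"
  proof (rule groupI)
    fix x :: 'f
    show "\<exists>y\<in>carrier add_grp. y \<otimes>\<^bsub>add_grp\<^esub> x = \<one>\<^bsub>add_grp\<^esub>"
      by (intro bexI[of _ "- x"]) auto
  qed (auto simp: add.assoc)
  then show "finite_group (add_grp :: 'f monoid)" by (simp add: finite_group_def finite_group_axioms_def)
qed

lemma unit_inv [simp]: "x \<noteq> 0 \<Longrightarrow> inv\<^bsub>unit_grp\<^esub> x = inverse (x :: 'f::{field,finite})"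
  by (rule U.inv_equality) auto

lemma card_field_gt_1: "CARD('f::{field,finite}) > 1"
proof -
  have "card {0, 1 :: 'f} \<le> CARD('f)" by (rule card_mono) auto
  then show ?thesis by simp
qed

lemma U_sum_lin_chars: "(\<Sum>c\<in>U.lin_chars. c x) = (if x = 1 then of_nat CARD('f) - 1 else 0)"
  if "x \<noteq> 0" for x :: "'f::{field,finite}"
  using U.sum_lin_chars_comm[of x] that card_field_gt_1[where 'f = 'f]
  by (simp add: mult.commute card_nonzero of_nat_diff)

lemma U_card_lin_chars: "card (U.lin_chars :: ('f \<Rightarrow> complex) set) = CARD('f::{field,finite}) - 1"
  using U.card_lin_chars_comm[where 'f = 'f] by (simp add: mult.commute card_nonzero)

lemma U_lin_char_orthogonality:
  assumes "c \<in> U.lin_chars" "d \<in> U.lin_chars"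
  shows "(\<Sum>x\<in>- {0 :: 'f::{field,finite}}. c x * d (inverse x)) = (if c = d then of_nat CARD('f) - 1 else 0)"
proof -
  have "(\<Sum>x\<in>- {0 :: 'f}. c x * d (inverse x)) = (\<Sum>x\<in>- {0 :: 'f}. c x * d (inv\<^bsub>unit_grp\<^esub> x))"
    by (rule sum.cong) auto
  then show ?thesis
    using U.irr_chars_orthogonality[OF U.lin_chars_subset[OF assms(1)] U.lin_chars_subset[OF assms(2)]]
      card_field_gt_1[where 'f = 'f]
    by (simp add: card_nonzero of_nat_diff)
qed

lemma U_char_mult: "c \<in> U.lin_chars \<Longrightarrow> c (x * y) = c x * c y"
proof (cases "x = 0 \<or> y = 0")
  case True
  assume "c \<in> U.lin_chars"
  then have "c 0 = 0" by (rule U.lin_char_outside) simp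
  then show ?thesis using True by auto
next
  case False
  assume "c \<in> U.lin_chars"
  then show ?thesis using U.lin_char_mult[of c x y] False by simp
qed

lemma U_char_one: "c \<in> U.lin_chars \<Longrightarrow> c 1 = 1"
  using U.lin_char_one by simp

lemma U_char_inverse: "c \<in> U.lin_chars \<Longrightarrow> x \<noteq> 0 \<Longrightarrow> c (inverse x) = inverse (c x)"
  using U_char_mult[of c x "inverse x"] U_char_one[of c] by (simp add: inverse_unique)

text \<open>If all characters of the additive group were trivial at \<open>1\<close>, their values there would not sum to zero.\<close>
lemma nontrivial_additive_char:
  obtains \<psi> :: "'f::{field,finite} \<Rightarrow> complex" where "\<And>x y. \<psi> (x + y) = \<psi> x * \<psi> y" "\<psi> 0 = 1" "(\<Sum>x\<in>UNIV. \<psi> x) = 0"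
proof -
  have "\<exists>\<psi>\<in>A.lin_chars. \<psi> (1 :: 'f) \<noteq> 1"
  proof (rule ccontr)
    assume "\<not> ?thesis"
    then have "(\<Sum>\<psi>\<in>A.lin_chars. \<psi> (1 :: 'f)) = of_nat (card (A.lin_chars :: ('f \<Rightarrow> complex) set))"
      using sum.cong[of A.lin_chars A.lin_chars "\<lambda>\<psi>. \<psi> (1 :: 'f)" "\<lambda>_. 1 :: complex"] by auto
    moreover have "(\<Sum>\<psi>\<in>A.lin_chars. \<psi> (1 :: 'f)) = 0"
      using A.sum_lin_chars_comm[of "1 :: 'f"] by (simp add: add.commute)
    ultimately have "card (A.lin_chars :: ('f \<Rightarrow> complex) set) = 0" by simp
    then show False using A.card_lin_chars_comm[where 'f = 'f] by (simp add: add.commute)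
  qed
  then obtain \<psi> where \<psi>: "\<psi> \<in> A.lin_chars" "\<psi> (1 :: 'f) \<noteq> 1" by blast
  have mult: "\<psi> (x + y) = \<psi> x * \<psi> y" for x y using A.lin_char_mult[OF \<psi>(1), of x y] by simp
  have "(\<Sum>x\<in>UNIV. \<psi> x) = (\<Sum>x\<in>UNIV. \<psi> (1 + x))"
    using A.sum_left[of 1 \<psi>] by simp
  also have "\<dots> = \<psi> 1 * (\<Sum>x\<in>UNIV. \<psi> x)" by (simp add: mult sum_distrib_left)
  finally have "(\<psi> 1 - 1) * (\<Sum>x\<in>UNIV. \<psi> x) = 0" by (simp add: left_diff_distrib)
  then have "(\<Sum>x\<in>UNIV. \<psi> x) = 0" using \<psi>(2) by simp
  then show ?thesis using that[OF mult] A.lin_char_one[OF \<psi>(1)] by simp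
qed

section \<open>Multiplicities along the unipotent and the Borel subgroup\<close>

abbreviation unipotent :: "'f::{field,finite} \<Rightarrow> 'f mat" where
  "unipotent b \<equiv> M2 1 b 0 1"

lemma GL2_inv_upper: "x \<noteq> 0 \<Longrightarrow> z \<noteq> 0 \<Longrightarrow> inv\<^bsub>GL2\<^esub> (M2 x y 0 z) = M2 (inverse x) (- y / (x * z)) 0 (inverse z)"
  by (rule GL2.inv_equality) (auto simp: M2_one field_simps)

definition degree_char :: "('f::{field,finite} mat \<Rightarrow> complex) \<Rightarrow> complex" where
  "degree_char \<chi> = \<chi> (1\<^sub>m 2)"

text \<open>The multiplicity of a nontrivial character \<open>\<psi>\<close> of the unipotent group in the restriction of \<open>\<chi>\<close>.
  Since \<open>\<chi>\<close> takes the same value at all nontrivial unipotents, this expression does not involve \<open>\<psi>\<close>.\<close>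
definition whittaker_mult :: "('f::{field,finite} mat \<Rightarrow> complex) \<Rightarrow> complex" where
  "whittaker_mult \<chi> = (degree_char \<chi> - \<chi> (unipotent 1)) / of_nat CARD('f)"

text \<open>The multiplicity in \<open>\<chi>\<close> of the character of the Borel subgroup given by \<open>c\<close> and \<open>d\<close> on the diagonal;
  by Frobenius reciprocity also that of \<open>\<chi>\<close> in the representation induced from this character.\<close>
definition borel_mult :: "('f \<Rightarrow> complex) \<Rightarrow> ('f \<Rightarrow> complex) \<Rightarrow> ('f::{field,finite} mat \<Rightarrow> complex) \<Rightarrow> complex" where
  "borel_mult c d \<chi> = (\<Sum>x\<in>- {0}. \<Sum>z\<in>- {0}. \<Sum>y\<in>UNIV. c (inverse x) * d (inverse z) * \<chi> (M2 x y 0 z)) /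
     of_nat (CARD('f) * (CARD('f) - 1)^2)"

lemma irr_char_unipotent:
  assumes "\<chi> \<in> GL2.irr_chars" "b \<noteq> 0"
  shows "\<chi> (unipotent b) = \<chi> (unipotent 1)"
  by (rule GL2.irr_char_conj[OF assms(1), of "M2 b 0 0 1"]) (use assms in auto)

lemma sum_remove_zero:
  fixes f :: "'f::{field,finite} \<Rightarrow> complex"
  shows "(\<Sum>x\<in>UNIV. f x) = f 0 + (\<Sum>x\<in>- {0}. f x)"
  by (subst sum.remove[of UNIV 0]) (auto simp: Compl_eq_Diff_UNIV)

lemma subgroup_unipotent: "subgroup (range unipotent) (GL2 :: 'f::{field,finite} mat monoid)"
  by (rule GL2.subgroupI) (auto simp: GL2_inv_upper)

text \<open>The trace of the projection to a nontrivial additive character \<open>\<psi>\<close>, where the values of \<open>\<psi>\<close> at the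
  nonzero elements add up to \<open>-1\<close>.\<close>
lemma whittaker_mult_nat:
  fixes \<chi> :: "'f::{field,finite} mat \<Rightarrow> complex"
  assumes \<chi>: "\<chi> \<in> GL2.irr_chars"
  shows "whittaker_mult \<chi> \<in> \<nat>"
proof -
  obtain \<psi> :: "'f \<Rightarrow> complex" where \<psi>: "\<And>x y. \<psi> (x + y) = \<psi> x * \<psi> y" "\<psi> 0 = 1" "(\<Sum>x\<in>UNIV. \<psi> x) = 0"
    by (rule nontrivial_additive_char) blast
  have inj: "inj (unipotent :: 'f \<Rightarrow> 'f mat)" by (auto simp: inj_def)
  have "(\<Sum>h\<in>range unipotent. \<psi> ((inv\<^bsub>GL2\<^esub> h) $$ (0, 1)) * \<chi> h) / of_nat (card (range (unipotent :: 'f \<Rightarrow> 'f mat))) \<in> \<nat>"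
    by (rule GL2.subgroup_multiplicity_nat[OF \<chi> subgroup_unipotent, where \<theta> = "\<lambda>h. \<psi> (h $$ (0, 1))"])
      (auto simp: \<psi> M2_one add.commute)
  also have "(\<Sum>h\<in>range unipotent. \<psi> ((inv\<^bsub>GL2\<^esub> h) $$ (0, 1)) * \<chi> h) = (\<Sum>b\<in>UNIV. \<psi> (- b) * \<chi> (unipotent b))"
    by (subst sum.reindex[OF inj]) (simp add: GL2_inv_upper)
  also have "\<dots> = degree_char \<chi> + (\<Sum>b\<in>- {0}. \<psi> (- b) * \<chi> (unipotent 1))"
    unfolding sum_remove_zero[of "\<lambda>b. \<psi> (- b) * \<chi> (unipotent b)"]
    by (intro arg_cong2[where f = "(+)"] sum.cong refl arg_cong2[where f = "(*)"] irr_char_unipotent[OF \<chi>])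
      (simp_all add: \<psi> degree_char_def M2_one)
  also have "\<dots> = degree_char \<chi> + (\<Sum>b\<in>- {0}. \<psi> b) * \<chi> (unipotent 1)"
  proof -
    have "(\<Sum>b\<in>- {0}. \<psi> (- b)) = (\<Sum>b\<in>- {0}. \<psi> b)"
      by (rule sum.reindex_bij_betw[OF bij_betw_byWitness[where f' = uminus]]) auto
    then show ?thesis by (simp add: sum_distrib_right[symmetric])
  qed
  also have "(\<Sum>b\<in>- {0}. \<psi> b) = -1"
    using \<psi>(2,3) sum_remove_zero[of \<psi>] by (simp add: add_eq_0_iff)
  finally show ?thesis by (simp add: whittaker_mult_def card_image[OF inj])
qed

definition upper_tri :: "'f::{field,finite} mat set" where
  "upper_tri = (\<lambda>(x, z, y). M2 x y 0 z) ` ((- {0}) \<times> (- {0}) \<times> UNIV)"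

lemma upper_triI: "x \<noteq> 0 \<Longrightarrow> z \<noteq> 0 \<Longrightarrow> M2 x y 0 z \<in> upper_tri"
  unfolding upper_tri_def by (rule image_eqI[of _ _ "(x, z, y)"]) auto

lemma upper_triE: assumes "h \<in> upper_tri" obtains x y z where "h = M2 x y 0 z" "x \<noteq> 0" "z \<noteq> 0"
  using assms by (auto simp: upper_tri_def)

lemma subgroup_upper_tri: "subgroup upper_tri (GL2 :: 'f::{field,finite} mat monoid)"
proof (rule GL2.subgroupI)
  show "(upper_tri :: 'f mat set) \<noteq> {}" using upper_triI[of "1 :: 'f" 1 0] by auto
qed (auto intro!: upper_triI elim!: upper_triE simp: GL2_inv_upper)

lemma card_upper_tri: "card (upper_tri :: 'f::{field,finite} mat set) = CARD('f) * (CARD('f) - 1)^2"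
  unfolding upper_tri_def
  by (subst card_image) (auto simp: inj_on_def card_cartesian_product card_nonzero power2_eq_square)

lemma sum_upper_tri: "(\<Sum>h\<in>upper_tri. f h) = (\<Sum>x\<in>- {0}. \<Sum>z\<in>- {0}. \<Sum>y\<in>UNIV. f (M2 x y 0 z))"
proof -
  have "(\<Sum>h\<in>upper_tri. f h) = (\<Sum>p\<in>(- {0}) \<times> (- {0}) \<times> UNIV. f ((\<lambda>(x, z, y). M2 x y 0 z) p))"
    unfolding upper_tri_def by (subst sum.reindex) (auto simp: inj_on_def)
  then show ?thesis by (simp add: sum.cartesian_product split_def)
qed

lemma borel_mult_nat:
  fixes \<chi> :: "'f::{field,finite} mat \<Rightarrow> complex"
  assumes \<chi>: "\<chi> \<in> GL2.irr_chars" and c: "c \<in> U.lin_chars" and d: "d \<in> U.lin_chars"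
  shows "borel_mult c d \<chi> \<in> \<nat>"
proof -
  let ?\<theta> = "\<lambda>h. c (h $$ (0, 0)) * d (h $$ (1, 1))"
  have "(\<Sum>h\<in>upper_tri. ?\<theta> (inv\<^bsub>GL2\<^esub> h) * \<chi> h) / of_nat (card (upper_tri :: 'f mat set)) \<in> \<nat>"
    by (rule GL2.subgroup_multiplicity_nat[OF \<chi> subgroup_upper_tri, where \<theta> = ?\<theta>])
      (auto elim!: upper_triE simp: M2_one U_char_mult[OF c] U_char_mult[OF d] U_char_one[OF c] U_char_one[OF d])
  then show ?thesis
  proof -
    have "(\<Sum>h\<in>upper_tri. ?\<theta> (inv\<^bsub>GL2\<^esub> h) * \<chi> h) =
        (\<Sum>x\<in>- {0}. \<Sum>z\<in>- {0}. \<Sum>y\<in>UNIV. c (inverse x) * d (inverse z) * \<chi> (M2 x y 0 z))"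
      unfolding sum_upper_tri by (intro sum.cong refl) (simp add: GL2_inv_upper)
    then show ?thesis
      using \<open>(\<Sum>h\<in>upper_tri. ?\<theta> (inv\<^bsub>GL2\<^esub> h) * \<chi> h) / of_nat (card (upper_tri :: 'f mat set)) \<in> \<nat>\<close>
      by (simp only: card_upper_tri borel_mult_def)
  qed
qed

text \<open>The transformation law of principal series under the Weyl group, read off from characters: an upper
  triangular matrix with distinct diagonal entries is conjugate to the diagonal one, hence to the one
  with the entries exchanged.\<close>
lemma borel_mult_commute:
  fixes \<chi> :: "'f::{field,finite} mat \<Rightarrow> complex"
  assumes \<chi>: "\<chi> \<in> GL2.irr_chars"
  shows "borel_mult c d \<chi> = borel_mult d c \<chi>"
proof -
  have swap: "\<chi> (M2 x y 0 z) = \<chi> (M2 z y 0 x)" if "x \<noteq> 0" "z \<noteq> 0" for x y z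
  proof (cases "x = z")
    case False
    have d: "\<chi> (M2 x y 0 z) = \<chi> (M2 x 0 0 z)" if "x \<noteq> 0" "z \<noteq> 0" "x \<noteq> z" for x y z
      by (rule GL2.irr_char_conj[OF \<chi>, of "M2 1 (y / (z - x)) 0 1"]) (use that in \<open>auto simp: field_simps\<close>)
    have "\<chi> (M2 x 0 0 z) = \<chi> (M2 z 0 0 x)"
      by (rule GL2.irr_char_conj[OF \<chi>, of "M2 0 1 1 0"]) (use that in auto)
    then show ?thesis using d[of x z y] d[of z x y] that False by simp
  qed simp
  have "(\<Sum>x\<in>- {0}. \<Sum>z\<in>- {0}. \<Sum>y\<in>UNIV. c (inverse x) * d (inverse z) * \<chi> (M2 x y 0 z)) =
      (\<Sum>z\<in>- {0}. \<Sum>x\<in>- {0}. \<Sum>y\<in>UNIV. c (inverse x) * d (inverse z) * \<chi> (M2 x y 0 z))"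
    by (rule sum.swap)
  also have "\<dots> = (\<Sum>z\<in>- {0}. \<Sum>x\<in>- {0}. \<Sum>y\<in>UNIV. d (inverse z) * c (inverse x) * \<chi> (M2 z y 0 x))"
    by (intro sum.cong refl) (simp add: swap mult.commute)
  finally show ?thesis by (simp add: borel_mult_def)
qed

lemma sum_degree_sq:
  "(\<Sum>\<chi>\<in>GL2.irr_chars. degree_char \<chi> * degree_char (\<chi> :: 'f mat \<Rightarrow> complex)) = of_nat (card (carrier (GL2 :: 'f::{field,finite} mat monoid)))"
  using GL2.sum_irr_chars_regular[of "1\<^sub>m 2 :: 'f mat"] by (simp add: degree_char_def M2_one)

lemma sum_degree_at:
  assumes "g \<in> carrier GL2" "g \<noteq> 1\<^sub>m 2"
  shows "(\<Sum>\<chi>\<in>GL2.irr_chars. degree_char \<chi> * \<chi> g) = 0"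
  using GL2.sum_irr_chars_regular[OF assms(1)] assms(2) by (simp add: degree_char_def)

text \<open>The inverse demanded by column orthogonality disappears, since \<open>unipotent 1\<close> is conjugate to its
  inverse.\<close>
lemma sum_upper_unipotent:
  fixes x y z :: "'f::{field,finite}"
  assumes "x \<noteq> 0" "z \<noteq> 0"
  shows "(\<Sum>\<chi>\<in>GL2.irr_chars. \<chi> (M2 x y 0 z) * \<chi> (unipotent 1)) =
    (if x = 1 \<and> z = 1 \<and> y \<noteq> 0 then of_nat (CARD('f) * (CARD('f) - 1)) else 0)"
proof -
  have "(\<Sum>\<chi>\<in>GL2.irr_chars. \<chi> (M2 x y 0 z) * \<chi> (unipotent 1)) =
      (\<Sum>\<chi>\<in>GL2.irr_chars. \<chi> (M2 x y 0 z) * \<chi> (inv\<^bsub>GL2\<^esub> (unipotent 1)))"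
    by (intro sum.cong refl) (simp add: GL2_inv_upper irr_char_unipotent[of _ "-1"])
  also have "\<dots> = of_nat (card {h \<in> carrier GL2. h * unipotent 1 = M2 x y 0 z * h})"
    using GL2.sum_irr_chars_pair[of "M2 x y 0 z" "unipotent 1"] assms by simp
  also have "\<dots> = (if x = 1 \<and> z = 1 \<and> y \<noteq> 0 then of_nat (CARD('f) * (CARD('f) - 1)) else 0)"
    unfolding card_transporter_unipotent[OF assms] by simp
  finally show ?thesis .
qed

lemma of_nat_card_GL2:
  "(of_nat (card (carrier (GL2 :: 'f::{field,finite} mat monoid))) :: complex) =
    of_nat CARD('f) * (of_nat CARD('f) - 1)^2 * (of_nat CARD('f) + 1)"
  using card_field_gt_1[where 'f = 'f] by (simp add: card_GL2 of_nat_diff distrib_left)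

text \<open>The dimension of the endomorphism algebra of the Gelfand--Graev representation. As there are equally many
  irreducible characters of degree greater than one, no multiplicity will exceed one.\<close>
lemma sum_whittaker_sq:
  "(\<Sum>\<chi>\<in>GL2.irr_chars. whittaker_mult \<chi> * whittaker_mult (\<chi> :: 'f mat \<Rightarrow> complex)) =
    of_nat CARD('f::{field,finite}) * (of_nat CARD('f) - 1)"
proof -
  let ?q = "of_nat CARD('f) :: complex"
  have q0: "?q \<noteq> 0" by simp
  have "(\<Sum>\<chi>\<in>GL2.irr_chars. whittaker_mult \<chi> * whittaker_mult (\<chi> :: 'f mat \<Rightarrow> complex)) =
      (\<Sum>\<chi>\<in>GL2.irr_chars. degree_char \<chi> * degree_char (\<chi> :: 'f mat \<Rightarrow> complex) - 2 * (degree_char \<chi> * \<chi> (unipotent 1))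
        + \<chi> (unipotent 1) * \<chi> (unipotent 1)) / ?q^2"
    unfolding sum_divide_distrib
    by (intro sum.cong refl) (simp add: whittaker_mult_def power2_eq_square algebra_simps)
  also have "\<dots> = (of_nat (card (carrier (GL2 :: 'f mat monoid))) + ?q * (?q - 1)) / ?q^2"
  proof -
    have "(\<Sum>\<chi>\<in>GL2.irr_chars. degree_char \<chi> * \<chi> (unipotent (1::'f))) = 0"
      by (rule sum_degree_at) (auto simp: M2_one)
    moreover have "(\<Sum>\<chi>\<in>GL2.irr_chars. \<chi> (unipotent 1) * \<chi> (unipotent (1::'f))) = ?q * (?q - 1)"
      using sum_upper_unipotent[of "1::'f" 1 1] card_field_gt_1[where 'f = 'f] by (simp add: of_nat_diff)
    ultimately show ?thesis
      by (simp add: sum.distrib sum_subtractf sum_degree_sq sum_distrib_left[symmetric])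
  qed
  also have "\<dots> = ?q * (?q - 1)"
    using q0 by (simp add: of_nat_card_GL2 field_simps power2_eq_square)
  finally show ?thesis .
qed

lemma sum_swap_triple:
  "(\<Sum>i\<in>I. \<Sum>x\<in>X. \<Sum>z\<in>Z. \<Sum>y\<in>Y. f i x z y) = (\<Sum>x\<in>X. \<Sum>z\<in>Z. \<Sum>y\<in>Y. \<Sum>i\<in>I. f i x z y :: complex)"
proof -
  have "(\<Sum>i\<in>I. \<Sum>x\<in>X. \<Sum>z\<in>Z. \<Sum>y\<in>Y. f i x z y) = (\<Sum>x\<in>X. \<Sum>i\<in>I. \<Sum>z\<in>Z. \<Sum>y\<in>Y. f i x z y)" by (rule sum.swap)
  also have "\<dots> = (\<Sum>x\<in>X. \<Sum>z\<in>Z. \<Sum>i\<in>I. \<Sum>y\<in>Y. f i x z y)" by (intro sum.cong refl sum.swap)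
  also have "\<dots> = (\<Sum>x\<in>X. \<Sum>z\<in>Z. \<Sum>y\<in>Y. \<Sum>i\<in>I. f i x z y)" by (intro sum.cong refl sum.swap)
  finally show ?thesis .
qed

lemma sum_borel_mult_linear:
  fixes w :: "('f::{field,finite} mat \<Rightarrow> complex) \<Rightarrow> complex"
  shows "(\<Sum>\<chi>\<in>GL2.irr_chars. w \<chi> * borel_mult c d \<chi>) =
    (\<Sum>x\<in>- {0}. \<Sum>z\<in>- {0}. \<Sum>y\<in>UNIV. c (inverse x) * d (inverse z) * (\<Sum>\<chi>\<in>GL2.irr_chars. w \<chi> * \<chi> (M2 x y 0 z))) /
     of_nat (CARD('f) * (CARD('f) - 1)^2)"
proof -
  have "(\<Sum>\<chi>\<in>GL2.irr_chars. w \<chi> * borel_mult c d \<chi>) =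
    (\<Sum>\<chi>\<in>GL2.irr_chars. \<Sum>x\<in>- {0}. \<Sum>z\<in>- {0}. \<Sum>y\<in>UNIV.
      c (inverse x) * d (inverse z) * (w \<chi> * \<chi> (M2 x y 0 z))) / of_nat (CARD('f) * (CARD('f) - 1)^2)"
    by (simp add: borel_mult_def sum_divide_distrib sum_distrib_left mult_ac)
  also have "(\<Sum>\<chi>\<in>GL2.irr_chars. \<Sum>x\<in>- {0}. \<Sum>z\<in>- {0}. \<Sum>y\<in>UNIV.
      c (inverse x) * d (inverse z) * (w \<chi> * \<chi> (M2 x y 0 z))) =
    (\<Sum>x\<in>- {0}. \<Sum>z\<in>- {0}. \<Sum>y\<in>UNIV. \<Sum>\<chi>\<in>GL2.irr_chars.
      c (inverse x) * d (inverse z) * (w \<chi> * \<chi> (M2 x y 0 z)))"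
    by (rule sum_swap_triple)
  finally show ?thesis by (simp only: sum_distrib_left)
qed

text \<open>Only the unipotent part of the Borel subgroup contributes to the sums below.\<close>
lemma sum_nested_delta:
  fixes f :: "'f::{field,finite} \<Rightarrow> 'f \<Rightarrow> 'f \<Rightarrow> complex"
  assumes "\<And>x y z. x \<noteq> 0 \<Longrightarrow> z \<noteq> 0 \<Longrightarrow> \<not> (x = 1 \<and> z = 1) \<Longrightarrow> f x z y = 0"
  shows "(\<Sum>x\<in>- {0}. \<Sum>z\<in>- {0}. \<Sum>y\<in>UNIV. f x z y) = (\<Sum>y\<in>UNIV. f 1 1 y)"
proof -
  have "(\<Sum>x\<in>- {0}. \<Sum>z\<in>- {0}. \<Sum>y\<in>UNIV. f x z y) =
      (\<Sum>x\<in>- {0 :: 'f}. \<Sum>z\<in>- {0 :: 'f}. if x = 1 then (if z = 1 then (\<Sum>y\<in>UNIV. f 1 1 y) else 0) else 0)"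
    by (intro sum.cong refl) (use assms in auto)
  also have "\<dots> = (\<Sum>x\<in>- {0 :: 'f}. if x = 1 then (\<Sum>y\<in>UNIV. f 1 1 y) else 0)"
    by (intro sum.cong refl) (simp add: sum.delta)
  finally show ?thesis by (simp add: sum.delta)
qed

text \<open>The degree of an induced character: the index of the Borel subgroup.\<close>
lemma sum_degree_borel_mult:
  assumes c: "c \<in> U.lin_chars" and d: "d \<in> U.lin_chars"
  shows "(\<Sum>\<chi>\<in>GL2.irr_chars. degree_char (\<chi> :: 'f mat \<Rightarrow> complex) * borel_mult c d \<chi>) = of_nat CARD('f::{field,finite}) + 1"
proof -
  let ?q = "of_nat CARD('f) :: complex"
  let ?G = "of_nat (card (carrier (GL2 :: 'f mat monoid))) :: complex"
  have reg: "(\<Sum>\<chi>\<in>GL2.irr_chars. degree_char \<chi> * \<chi> (M2 x y 0 z)) = (if x = 1 \<and> z = 1 \<and> y = 0 then ?G else 0)"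
    if "x \<noteq> 0" "z \<noteq> 0" for x y z :: 'f
    using GL2.sum_irr_chars_regular[of "M2 x y 0 z"] that by (auto simp: M2_one degree_char_def)
  have "(\<Sum>x\<in>- {0}. \<Sum>z\<in>- {0}. \<Sum>y\<in>UNIV. c (inverse x) * d (inverse z) *
      (\<Sum>\<chi>\<in>GL2.irr_chars. degree_char \<chi> * \<chi> (M2 x y 0 z))) = (\<Sum>y\<in>UNIV. if y = (0::'f) then ?G else 0)"
    by (subst sum_nested_delta) (auto simp: reg U_char_one[OF c] U_char_one[OF d])
  then have "(\<Sum>\<chi>\<in>GL2.irr_chars. degree_char (\<chi> :: 'f mat \<Rightarrow> complex) * borel_mult c d \<chi>) = ?G / of_nat (CARD('f) * (CARD('f) - 1)^2)"
    unfolding sum_borel_mult_linear by simp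
  also have "\<dots> = ?q + 1"
  proof -
    have "?G = of_nat (CARD('f) * (CARD('f) - 1)^2) * (?q + 1)"
      by (simp only: card_GL2 of_nat_mult of_nat_add of_nat_1)
    moreover have "(of_nat (CARD('f) * (CARD('f) - 1)^2) :: complex) \<noteq> 0"
      using card_field_gt_1[where 'f = 'f] by simp
    ultimately show ?thesis by simp
  qed
  finally show ?thesis .
qed

lemma sum_unipotent_borel_mult:
  assumes c: "c \<in> U.lin_chars" and d: "d \<in> U.lin_chars"
  shows "(\<Sum>\<chi>\<in>GL2.irr_chars. \<chi> (unipotent (1 :: 'f::{field,finite})) * borel_mult c d \<chi>) = 1"
proof -
  let ?K = "of_nat (CARD('f) * (CARD('f) - 1)) :: complex"
  have reg: "(\<Sum>\<chi>\<in>GL2.irr_chars. \<chi> (unipotent 1) * \<chi> (M2 x y 0 z)) = (if x = 1 \<and> z = 1 \<and> y \<noteq> 0 then ?K else 0)"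
    if "x \<noteq> 0" "z \<noteq> 0" for x y z :: 'f
    using sum_upper_unipotent[OF that, of y] by (simp only: mult.commute)
  have "(\<Sum>x\<in>- {0}. \<Sum>z\<in>- {0}. \<Sum>y\<in>UNIV. c (inverse x) * d (inverse z) *
      (\<Sum>\<chi>\<in>GL2.irr_chars. \<chi> (unipotent 1) * \<chi> (M2 x y 0 z))) = (\<Sum>y\<in>UNIV. if y = (0::'f) then 0 else ?K)"
    by (subst sum_nested_delta) (auto simp: reg U_char_one[OF c] U_char_one[OF d] intro!: sum.cong)
  also have "\<dots> = (\<Sum>y\<in>- {0::'f}. ?K)" by (subst sum_remove_zero) simp
  also have "\<dots> = of_nat (CARD('f) * (CARD('f) - 1)^2)"
    by (simp add: card_nonzero power2_eq_square mult_ac)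
  finally show ?thesis
    unfolding sum_borel_mult_linear using card_field_gt_1[where 'f = 'f] by simp
qed

text \<open>Exactly one constituent of a representation induced from the Borel subgroup has a Whittaker model.\<close>
lemma sum_whittaker_borel_mult:
  assumes c: "c \<in> U.lin_chars" and d: "d \<in> U.lin_chars"
  shows "(\<Sum>\<chi>\<in>GL2.irr_chars. whittaker_mult (\<chi> :: 'f::{field,finite} mat \<Rightarrow> complex) * borel_mult c d \<chi>) = 1"
proof -
  let ?q = "of_nat CARD('f) :: complex"
  have "(\<Sum>\<chi>\<in>GL2.irr_chars. whittaker_mult (\<chi> :: 'f mat \<Rightarrow> complex) * borel_mult c d \<chi>) =
    ((\<Sum>\<chi>\<in>GL2.irr_chars. degree_char (\<chi> :: 'f mat \<Rightarrow> complex) * borel_mult c d \<chi>)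
      - (\<Sum>\<chi>\<in>GL2.irr_chars. \<chi> (unipotent 1) * borel_mult c d \<chi>)) / ?q"
    unfolding sum_subtractf[symmetric] sum_divide_distrib
    by (intro sum.cong refl) (simp add: whittaker_mult_def algebra_simps)
  then show ?thesis by (simp add: sum_degree_borel_mult[OF c d] sum_unipotent_borel_mult[OF c d])
qed

text \<open>The multiplicities of all characters of the Borel subgroup add up to the dimension of the unipotent
  invariants; each of the \<open>q - 1\<close> nontrivial characters of the unipotent group contributes
  \<open>whittaker_mult\<close> to the rest of the degree.\<close>
lemma sum_all_borel_mult:
  fixes \<chi> :: "'f::{field,finite} mat \<Rightarrow> complex"
  assumes \<chi>: "\<chi> \<in> GL2.irr_chars"
  shows "(\<Sum>c\<in>U.lin_chars. \<Sum>d\<in>U.lin_chars. borel_mult c d \<chi>) =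
    degree_char \<chi> - (of_nat CARD('f) - 1) * whittaker_mult \<chi>"
proof -
  let ?q = "of_nat CARD('f) :: complex"
  have q: "?q \<noteq> 0" "?q - 1 \<noteq> 0" "(of_nat (CARD('f) - 1) :: complex) = ?q - 1"
    using card_field_gt_1[where 'f = 'f] by (auto simp: of_nat_diff)
  let ?D = "of_nat (CARD('f) * (CARD('f) - 1)^2) :: complex"
  have "(\<Sum>c\<in>U.lin_chars. \<Sum>d\<in>U.lin_chars. borel_mult c d \<chi>) =
     (\<Sum>c\<in>U.lin_chars. \<Sum>d\<in>U.lin_chars. \<Sum>x\<in>- {0}. \<Sum>z\<in>- {0}. \<Sum>y\<in>UNIV.
        c (inverse x) * d (inverse z) * \<chi> (M2 x y 0 z)) / ?D"
    by (simp add: borel_mult_def sum_divide_distrib)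
  also have "(\<Sum>c\<in>U.lin_chars. \<Sum>d\<in>U.lin_chars. \<Sum>x\<in>- {0}. \<Sum>z\<in>- {0}. \<Sum>y\<in>UNIV.
        c (inverse x) * d (inverse z) * \<chi> (M2 x y 0 z)) =
     (\<Sum>c\<in>U.lin_chars. \<Sum>x\<in>- {0}. \<Sum>z\<in>- {0}. \<Sum>y\<in>UNIV.
        c (inverse x) * ((\<Sum>d\<in>U.lin_chars. d (inverse z)) * \<chi> (M2 x y 0 z)))"
  proof (rule sum.cong[OF refl])
    fix c :: "'f \<Rightarrow> complex"
    have "(\<Sum>d\<in>U.lin_chars. \<Sum>x\<in>- {0}. \<Sum>z\<in>- {0}. \<Sum>y\<in>UNIV. c (inverse x) * d (inverse z) * \<chi> (M2 x y 0 z)) =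
      (\<Sum>x\<in>- {0}. \<Sum>z\<in>- {0}. \<Sum>y\<in>UNIV. \<Sum>d\<in>U.lin_chars. c (inverse x) * d (inverse z) * \<chi> (M2 x y 0 z))"
      by (rule sum_swap_triple)
    then show "(\<Sum>d\<in>U.lin_chars. \<Sum>x\<in>- {0}. \<Sum>z\<in>- {0}. \<Sum>y\<in>UNIV. c (inverse x) * d (inverse z) * \<chi> (M2 x y 0 z)) =
      (\<Sum>x\<in>- {0}. \<Sum>z\<in>- {0}. \<Sum>y\<in>UNIV. c (inverse x) * ((\<Sum>d\<in>U.lin_chars. d (inverse z)) * \<chi> (M2 x y 0 z)))"
      by (simp only: sum_distrib_left sum_distrib_right mult.assoc)
  qed
  also have "\<dots> = (\<Sum>x\<in>- {0}. \<Sum>z\<in>- {0}. \<Sum>y\<in>UNIV.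
      (\<Sum>c\<in>U.lin_chars. c (inverse x)) * ((\<Sum>d\<in>U.lin_chars. d (inverse z)) * \<chi> (M2 x y 0 z)))"
    by (subst sum_swap_triple) (simp only: sum_distrib_right)
  also have "\<dots> = (\<Sum>y\<in>UNIV. (?q - 1)^2 * \<chi> (unipotent y))"
    by (subst sum_nested_delta) (auto simp: U_sum_lin_chars power2_eq_square mult.assoc)
  also have "\<dots> = (?q - 1)^2 * (degree_char \<chi> + (?q - 1) * \<chi> (unipotent 1))"
  proof -
    have "(\<Sum>y\<in>- {0}. \<chi> (unipotent y)) = (\<Sum>y\<in>- {0 :: 'f}. \<chi> (unipotent 1))"
      by (intro sum.cong refl irr_char_unipotent[OF \<chi>]) simp
    then show ?thesis
      unfolding sum_distrib_left[symmetric] sum_remove_zero[of "\<lambda>y. \<chi> (unipotent y)"]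
      by (simp add: degree_char_def M2_one card_nonzero q(3))
  qed
  finally have *: "(\<Sum>c\<in>U.lin_chars. \<Sum>d\<in>U.lin_chars. borel_mult c d \<chi>) =
      (?q - 1)^2 * (degree_char \<chi> + (?q - 1) * \<chi> (unipotent 1)) / (?q * (?q - 1)^2)"
    by (simp add: q(3))
  also have "\<dots> = (degree_char \<chi> + (?q - 1) * \<chi> (unipotent 1)) / ?q" using q by simp
  also have "\<dots> = degree_char \<chi> - (?q - 1) * whittaker_mult \<chi>"
    using q by (simp add: whittaker_mult_def field_simps)
  finally show ?thesis .
qed

section \<open>The linear characters and multiplicity one\<close>

definition det_char :: "('f \<Rightarrow> complex) \<Rightarrow> 'f::{field,finite} mat \<Rightarrow> complex" where
  "det_char c g = (if g \<in> carrier GL2 then c (Determinant.det g) else 0)"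

lemma GL2_mult_closed: "g \<in> carrier GL2 \<Longrightarrow> h \<in> carrier GL2 \<Longrightarrow> g * h \<in> carrier GL2"
  using GL2.m_closed by simp

text \<open>The upper and lower unipotent matrices generate the matrices of determinant one.\<close>
lemma rep_unipotent_trivial_det:
  fixes g :: "'f::{field,finite} mat"
  assumes rep: "representation GL2 n \<rho>" and triv: "\<And>b. \<rho> (unipotent b) = 1\<^sub>m n" and g: "g \<in> carrier GL2"
  shows "\<rho> g = \<rho> (M2 (Determinant.det g) 0 0 1)"
proof -
  have mult: "\<rho> (h * k) = \<rho> h * \<rho> k" if "h \<in> carrier GL2" "k \<in> carrier GL2" for h k
    using GL2.rep_mult[OF rep that] by simp
  have absorb: "\<rho> (h * k) = \<rho> k" if "\<rho> h = 1\<^sub>m n" "h \<in> carrier GL2" "k \<in> carrier GL2" for h k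
    using mult[OF that(2,3)] that(1) GL2.rep_carrier[OF rep that(3)] by simp
  have lower: "\<rho> (M2 1 0 b 1) = 1\<^sub>m n" for b
  proof -
    let ?w = "M2 0 1 1 0 :: 'f mat"
    \<comment> \<open>The lower unipotents are conjugate to the upper ones by the Weyl element.\<close>
    have "M2 1 0 b 1 = ?w * (unipotent b * ?w)" by simp
    also have "\<rho> \<dots> = \<rho> ?w * \<rho> ?w" using mult[of ?w "unipotent b * ?w"] absorb[OF triv, of b ?w] by simp
    also have "\<dots> = \<rho> (1\<^sub>m 2)" using mult[of ?w ?w] by (simp add: M2_one)
    finally show ?thesis using GL2.rep_one[OF rep] by simp
  qed
  have nonzero: "\<rho> (M2 a b c d) = \<rho> (M2 (a * d - b * c) 0 0 1)" if c: "c \<noteq> 0" and "a * d \<noteq> b * c" for a b c d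
  proof -
    define D where "D = a * d - b * c"
    have D0: "D \<noteq> 0" using \<open>a * d \<noteq> b * c\<close> by (simp add: D_def)
    have b: "b = (a * d - D) / c" using c by (simp add: D_def)
    \<comment> \<open>The solution of \<open>unipotent \<alpha> * M2 1 0 \<beta> 1 * unipotent \<gamma> * M2 D 0 0 1 = M2 a b c d\<close>.\<close>
    let ?\<alpha> = "(a - D) / c" and ?\<beta> = "c / D" and ?\<gamma> = "(d - 1) * D / c"
    have "M2 a b c d = unipotent ?\<alpha> * (M2 1 0 ?\<beta> 1 * (unipotent ?\<gamma> * M2 D 0 0 1))"
      unfolding b using c D0 by (simp add: field_simps)
    also have "\<rho> \<dots> = \<rho> (M2 D 0 0 1)"
    proof -
      have 1: "M2 D 0 0 1 \<in> carrier GL2" using D0 by simp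
      have 2: "unipotent ?\<gamma> * M2 D 0 0 1 \<in> carrier GL2" by (rule GL2_mult_closed[OF _ 1]) simp
      have 3: "M2 1 0 ?\<beta> 1 * (unipotent ?\<gamma> * M2 D 0 0 1) \<in> carrier GL2" by (rule GL2_mult_closed[OF _ 2]) simp
      show ?thesis
        using absorb[OF triv _ 3, of ?\<alpha>] absorb[OF lower _ 2, of ?\<beta>] absorb[OF triv _ 1, of ?\<gamma>]
        by (simp del: M2_mult)
    qed
    also have "D = a * d - b * c" by (rule D_def)
    finally show ?thesis .
  qed
  obtain a b c d where abcd: "g = M2 a b c d" "a * d \<noteq> b * c" using g by (auto elim: GL2_cases)
  show ?thesis
  proof (cases "c = 0")
    case True
    then have "a \<noteq> 0" using abcd by auto
    \<comment> \<open>Adding the first row to the second makes the lower left entry nonzero.\<close>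
    have "\<rho> g = \<rho> (M2 1 0 1 1 * g)" using absorb[OF lower, of 1 g] g by simp
    also have "\<dots> = \<rho> (M2 a b a (b + d))" using True by (simp add: abcd)
    also have "\<dots> = \<rho> (M2 (a * (b + d) - b * a) 0 0 1)"
      by (rule nonzero) (use \<open>a \<noteq> 0\<close> abcd True in \<open>auto simp: algebra_simps\<close>)
    finally show ?thesis using True abcd by (simp add: algebra_simps)
  next
    case False
    then show ?thesis using nonzero[OF False abcd(2)] abcd by simp
  qed
qed

lemma det_char_lin: "c \<in> U.lin_chars \<Longrightarrow> det_char c \<in> GL2.lin_chars"
  unfolding GL2.lin_chars_def
  by (auto simp: det_char_def U_char_one GL2_det_mult U_char_mult)
    (use GL2.m_closed GL2.one_closed in \<open>auto\<close>)

text \<open>A unipotent matrix is a commutator with a diagonal matrix as soon as the field contains some \<open>t\<close>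
  other than \<open>0\<close> and \<open>1\<close>. This fails for the field with two elements.\<close>
lemma lin_char_unipotent:
  fixes l :: "'f::{field,finite} mat \<Rightarrow> complex"
  assumes q: "CARD('f) > 2" and l: "l \<in> GL2.lin_chars"
  shows "l (unipotent b) = 1"
proof -
  have "\<exists>t :: 'f. t \<notin> {0, 1}"
  proof (rule ccontr)
    assume "\<nexists>t :: 'f. t \<notin> {0, 1}"
    then have "CARD('f) = card {0, 1 :: 'f}" by (intro arg_cong[where f = card]) blast
    then show False using q by simp
  qed
  then obtain t :: 'f where t: "t \<noteq> 0" "t \<noteq> 1" by blast
  let ?c = "b / (t - 1)"
  have "l (unipotent (t * ?c)) = l (unipotent ?c)"
    by (rule GL2.irr_char_conj[OF GL2.lin_chars_subset[OF l], of "M2 t 0 0 1"]) (use t in auto)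
  moreover have "unipotent (t * ?c) = unipotent b * unipotent ?c" using t by (simp add: field_simps)
  then have "l (unipotent (t * ?c)) = l (unipotent b) * l (unipotent ?c)"
    using GL2.lin_char_mult[OF l, of "unipotent b" "unipotent ?c"] by simp
  moreover have "l (unipotent ?c) \<noteq> 0" by (rule GL2.lin_char_nonzero[OF l]) simp
  ultimately show ?thesis by simp
qed

lemma GL2_lin_chars:
  assumes q: "CARD('f::{field,finite}) > 2"
  shows "(GL2.lin_chars :: ('f mat \<Rightarrow> complex) set) = det_char ` U.lin_chars"
proof (intro equalityI subsetI)
  fix l :: "'f mat \<Rightarrow> complex" assume l: "l \<in> GL2.lin_chars"
  note rep = GL2.lin_char_rep(1)[OF l]
  have "mat 1 1 (\<lambda>_. l (unipotent b)) = 1\<^sub>m 1" for b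
    using lin_char_unipotent[OF q l] by (intro eq_matI) auto
  from rep_unipotent_trivial_det[OF rep this]
  have "mat 1 1 (\<lambda>_. l g) = mat 1 1 (\<lambda>_. l (M2 (Determinant.det g) 0 0 1))" if "g \<in> carrier GL2" for g
    using that by blast
  then have det: "l g = l (M2 (Determinant.det g) 0 0 1)" if "g \<in> carrier GL2" for g
    using that by (metis index_mat(1) less_numeral_extra(1) old.prod.case)
  define c where "c x = (if x = 0 then 0 else l (M2 x 0 0 1))" for x
  have "c (x * y) = c x * c y" if "x \<noteq> 0" "y \<noteq> 0" for x y
    using GL2.lin_char_mult[OF l, of "M2 x 0 0 1" "M2 y 0 0 1"] that by (simp add: c_def)
  moreover have "c 1 = 1" "c 0 = 0" using GL2.lin_char_one[OF l] by (simp_all add: c_def M2_one)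
  ultimately have "c \<in> U.lin_chars" by (simp add: U.lin_chars_def)
  moreover have "l = det_char c"
  proof
    fix g
    show "l g = det_char c g"
    proof (cases "g \<in> carrier GL2")
      case True
      then have "det_char c g = l (M2 (Determinant.det g) 0 0 1)"
        using GL2_det_nonzero[OF True] by (simp add: det_char_def c_def)
      then show ?thesis using det[OF True] by (metis)
    next
      case False
      then show ?thesis using GL2.lin_char_outside[OF l] by (simp add: det_char_def)
    qed
  qed
  ultimately show "l \<in> det_char ` U.lin_chars" by blast
qed (use det_char_lin in blast)

lemma det_char_diag: "x \<noteq> 0 \<Longrightarrow> det_char c (M2 x y 0 z) = (if z = 0 then 0 else c (x * z))"
  by (simp add: det_char_def)

lemma inj_det_char: "inj_on det_char (U.lin_chars :: ('f::{field,finite} \<Rightarrow> complex) set)"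
proof (rule inj_onI, rule ext)
  fix c d :: "'f \<Rightarrow> complex" and x
  assume c: "c \<in> U.lin_chars" and d: "d \<in> U.lin_chars" and eq: "det_char c = det_char d"
  show "c x = d x"
  proof (cases "x = 0")
    case True
    then show ?thesis using U.lin_char_outside[OF c, of x] U.lin_char_outside[OF d, of x] by simp
  next
    case False
    then show ?thesis using fun_cong[OF eq, of "M2 x 0 0 1"] by (simp add: det_char_def)
  qed
qed

lemma card_GL2_lin_chars:
  assumes "CARD('f::{field,finite}) > 2"
  shows "card (GL2.lin_chars :: ('f mat \<Rightarrow> complex) set) = CARD('f) - 1"
  unfolding GL2_lin_chars[OF assms] by (simp add: card_image[OF inj_det_char] U_card_lin_chars)

lemma degree_lin: "l \<in> GL2.lin_chars \<Longrightarrow> degree_char l = 1"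
  using GL2.lin_char_one by (simp add: degree_char_def)

text \<open>Without a nontrivial character the unipotent group acts trivially, so the representation factors
  through the determinant and is one-dimensional.\<close>
lemma whittaker_zero_iff:
  fixes \<chi> :: "'f::{field,finite} mat \<Rightarrow> complex"
  assumes q: "CARD('f) > 2" and \<chi>: "\<chi> \<in> GL2.irr_chars"
  shows "whittaker_mult \<chi> = 0 \<longleftrightarrow> \<chi> \<in> GL2.lin_chars"
proof
  assume l: "\<chi> \<in> GL2.lin_chars"
  show "whittaker_mult \<chi> = 0" by (simp add: whittaker_mult_def lin_char_unipotent[OF q l] degree_lin[OF l])
next
  assume w: "whittaker_mult \<chi> = 0"
  obtain n \<rho> where \<rho>: "irreducible_rep GL2 n \<rho>" "\<chi> = GL2.character \<rho>" using \<chi> by (auto simp: GL2.irr_chars_def)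
  note rep = GL2.irr_rep[OF \<rho>(1)]
  have deg: "degree_char \<chi> = of_nat n" using GL2.character_one[OF rep] by (simp add: \<rho>(2) degree_char_def)
  have u1: "\<chi> (unipotent 1) = of_nat n" using w deg by (simp add: whittaker_mult_def)
  have u: "\<chi> (unipotent b) = of_nat n" for b
    using u1 deg irr_char_unipotent[OF \<chi>, of b] by (cases "b = 0") (simp_all add: degree_char_def M2_one)
  have "(\<Sum>h\<in>range unipotent. GL2.character \<rho> h) = of_nat (card (range (unipotent :: 'f \<Rightarrow> 'f mat))) * of_nat n"
  proof -
    have "(\<Sum>h\<in>range unipotent. GL2.character \<rho> h) = (\<Sum>h\<in>range (unipotent :: 'f \<Rightarrow> 'f mat). of_nat n)"
      by (rule sum.cong) (use u \<rho>(2) in auto)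
    then show ?thesis by simp
  qed
  from GL2.rep_trivial_on_subgroup[OF rep subgroup_unipotent this]
  have triv: "\<rho> (unipotent b) = 1\<^sub>m n" for b by blast
  note det = rep_unipotent_trivial_det[OF rep triv]
  have "n = 1"
  proof (rule GL2.irr_commuting_dim[OF \<rho>(1)])
    fix g h :: "'f mat" assume g: "g \<in> carrier GL2" and h: "h \<in> carrier GL2"
    have "\<rho> g * \<rho> h = \<rho> (g * h)" using GL2.rep_mult[OF rep g h] by simp
    also have "\<dots> = \<rho> (h * g)"
      using det[of "g * h"] det[of "h * g"] GL2.m_closed[OF g h] GL2.m_closed[OF h g] g h
      by (simp add: GL2_det_mult mult.commute)
    also have "\<dots> = \<rho> h * \<rho> g" using GL2.rep_mult[OF rep h g] by simp
    finally show "\<rho> g * \<rho> h = \<rho> h * \<rho> g" .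
  qed
  then show "\<chi> \<in> GL2.lin_chars" using \<chi> deg by (simp add: GL2.lin_chars_irr degree_char_def)
qed

lemma sum_centralizers_GL2:
  "(\<Sum>g\<in>carrier (GL2 :: 'f mat monoid). card {h \<in> carrier GL2. h * g = g * h}) =
    card (carrier (GL2 :: 'f::{field,finite} mat monoid)) * ((CARD('f) - 1) * (CARD('f) + 1))"
proof -
  let ?C = "\<lambda>g :: 'f mat. card {h \<in> carrier GL2. h * g = g * h}"
  have "(\<Sum>g\<in>carrier GL2. ?C g) = (\<Sum>\<delta>\<in>- {0}. \<Sum>g | g \<in> carrier GL2 \<and> Determinant.det g = \<delta>. ?C g)"
    by (intro sum.group[symmetric]) (auto dest: GL2_det_nonzero)
  also have "\<dots> = (\<Sum>\<delta>\<in>- {0}. card (carrier (GL2 :: 'f mat monoid)) * (CARD('f) + card {z :: 'f. z^2 = \<delta>}))"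
    by (intro sum.cong refl sum_centralizers_det) simp
  also have "\<dots> = card (carrier (GL2 :: 'f mat monoid)) *
      ((CARD('f) - 1) * CARD('f) + (\<Sum>\<delta>\<in>- {0}. card {z :: 'f. z^2 = \<delta>}))"
    by (simp add: sum_distrib_left[symmetric] sum.distrib card_nonzero)
  also have "(\<Sum>\<delta>\<in>- {0}. card {z :: 'f. z^2 = \<delta>}) = (\<Sum>\<delta>\<in>- {0}. \<Sum>z | (z :: 'f) \<in> - {0} \<and> z^2 = \<delta>. 1)"
  proof (rule sum.cong[OF refl])
    fix \<delta> :: 'f assume "\<delta> \<in> - {0}"
    then have "{z. z \<in> - {0} \<and> z^2 = \<delta>} = {z. z^2 = \<delta>}" by auto
    then show "card {z. z^2 = \<delta>} = (\<Sum>z | z \<in> - {0} \<and> z^2 = \<delta>. 1)" by simp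
  qed
  also have "\<dots> = (\<Sum>z\<in>- {0 :: 'f}. 1)" by (rule sum.group) auto
  also have "\<dots> = CARD('f) - 1" by (simp add: card_nonzero)
  finally show ?thesis by (simp only: distrib_left mult_1_right)
qed

lemma card_GL2_irr_chars:
  "card (GL2.irr_chars :: ('f::{field,finite} mat \<Rightarrow> complex) set) = (CARD('f) - 1) * (CARD('f) + 1)"
proof -
  let ?N = "card (carrier (GL2 :: 'f mat monoid))"
  have "(of_nat (?N * card (GL2.irr_chars :: ('f mat \<Rightarrow> complex) set)) :: complex) =
      of_nat (\<Sum>g\<in>carrier (GL2 :: 'f mat monoid). card {h \<in> carrier GL2. h * g = g * h})"
    using GL2.card_irr_chars[where 'f = 'f] by (simp only: GL_mult of_nat_sum)
  then have "?N * card (GL2.irr_chars :: ('f mat \<Rightarrow> complex) set) = ?N * ((CARD('f) - 1) * (CARD('f) + 1))"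
    unfolding of_nat_eq_iff sum_centralizers_GL2 .
  then show ?thesis using GL2.card_carrier_pos[where 'f = 'f] by (simp only: mult_cancel1) auto
qed

lemma Nats_valued:
  fixes f :: "'b \<Rightarrow> 'c::semiring_1"
  assumes "\<And>x. x \<in> S \<Longrightarrow> f x \<in> \<nat>"
  obtains w :: "'b \<Rightarrow> nat" where "\<And>x. x \<in> S \<Longrightarrow> f x = of_nat (w x)"
proof -
  have "\<forall>x\<in>S. \<exists>n. f x = of_nat n"
  proof
    fix x assume "x \<in> S"
    from assms[OF this] show "\<exists>n. f x = of_nat n" by (rule Nats_cases) blast
  qed
  from bchoice[OF this] show ?thesis using that by blast
qed

text \<open>There are \<open>(q - 1) * (q + 1)\<close> irreducible characters, \<open>q - 1\<close> of them linear. The squares of the other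
  multiplicities are at least one and sum to \<open>q * (q - 1)\<close>, their number.\<close>
lemma whittaker_one:
  fixes \<chi> :: "'f::{field,finite} mat \<Rightarrow> complex"
  assumes q: "CARD('f) > 2" and \<chi>: "\<chi> \<in> GL2.irr_chars" "\<chi> \<notin> GL2.lin_chars"
  shows "whittaker_mult \<chi> = 1"
proof -
  let ?I = "GL2.irr_chars :: ('f mat \<Rightarrow> complex) set"
  let ?X = "?I - GL2.lin_chars"
  obtain w where w: "\<And>\<chi>. \<chi> \<in> ?I \<Longrightarrow> whittaker_mult \<chi> = of_nat (w \<chi>)"
    using Nats_valued[of ?I whittaker_mult] whittaker_mult_nat by blast
  have w0: "w \<chi> = 0 \<longleftrightarrow> \<chi> \<in> GL2.lin_chars" if "\<chi> \<in> ?I" for \<chi>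
    using whittaker_zero_iff[OF q that] w[OF that] by simp
  have fin: "finite ?X" using GL2.finite_irr_chars by simp
  have sub: "GL2.lin_chars \<subseteq> ?I" using GL2.lin_chars_subset by blast
  have "(\<Sum>\<chi>\<in>?I. (w \<chi>)^2) = CARD('f) * (CARD('f) - 1)"
  proof -
    have "(of_nat (\<Sum>\<chi>\<in>?I. (w \<chi>)^2) :: complex) = (\<Sum>\<chi>\<in>?I. whittaker_mult \<chi> * whittaker_mult \<chi>)"
      by (simp add: w power2_eq_square)
    also have "\<dots> = of_nat (CARD('f) * (CARD('f) - 1))"
      unfolding sum_whittaker_sq using card_field_gt_1[where 'f = 'f] by (simp add: of_nat_diff)
    finally show ?thesis by (simp only: of_nat_eq_iff)
  qed
  moreover have "(\<Sum>\<chi>\<in>?I. (w \<chi>)^2) = (\<Sum>\<chi>\<in>?X. (w \<chi>)^2)"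
    by (rule sum.mono_neutral_right) (use w0 GL2.finite_irr_chars in auto)
  moreover have "card ?X = CARD('f) * (CARD('f) - 1)"
  proof -
    have "card ?X = (CARD('f) - 1) * (CARD('f) + 1) - (CARD('f) - 1)"
      using sub by (subst card_Diff_subset) (auto simp: card_GL2_irr_chars card_GL2_lin_chars[OF q])
    then show ?thesis by (simp add: algebra_simps)
  qed
  ultimately have "(\<Sum>\<chi>\<in>?X. (w \<chi>)^2) = (\<Sum>\<chi>\<in>?X. 1)" by simp
  moreover have "1 \<le> (w \<chi>)^2" if "\<chi> \<in> ?X" for \<chi>
  proof -
    have "w \<chi> \<noteq> 0" using w0[of \<chi>] that by blast
    then show ?thesis by (simp add: Suc_le_eq)
  qed
  ultimately have "\<forall>\<chi>\<in>?X. 1 = (w \<chi>)^2"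
    using sum_mono_inv[of "\<lambda>_. 1" ?X "\<lambda>\<chi>. (w \<chi>)^2"] fin by metis
  then have "w \<chi> = 1" using \<chi> by (simp add: power2_eq_square)
  then show ?thesis using w[OF \<chi>(1)] by simp
qed

lemma borel_mult_det_char:
  fixes l :: "'f::{field,finite} \<Rightarrow> complex"
  assumes c: "c \<in> U.lin_chars" and d: "d \<in> U.lin_chars" and l: "l \<in> U.lin_chars"
  shows "borel_mult c d (det_char l) = (if c = l \<and> d = l then 1 else 0)"
proof -
  let ?q = "of_nat CARD('f) :: complex"
  have q: "?q \<noteq> 0" "?q - 1 \<noteq> 0" "(of_nat (CARD('f) - 1) :: complex) = ?q - 1"
    using card_field_gt_1[where 'f = 'f] by (auto simp: of_nat_diff)
  have "(\<Sum>x\<in>- {0}. \<Sum>z\<in>- {0}. \<Sum>y\<in>(UNIV :: 'f set). c (inverse x) * d (inverse z) * det_char l (M2 x y 0 z)) =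
      (\<Sum>x\<in>- {0}. \<Sum>z\<in>- {0}. ?q * (l x * c (inverse x)) * (l z * d (inverse z)))"
    by (intro sum.cong refl) (simp add: det_char_diag U_char_mult[OF l])
  also have "\<dots> = (\<Sum>x\<in>- {0}. ?q * (l x * c (inverse x))) * (\<Sum>z\<in>- {0}. l z * d (inverse z))"
    by (simp only: sum_product)
  also have "\<dots> = ?q * (\<Sum>x\<in>- {0}. l x * c (inverse x)) * (\<Sum>z\<in>- {0}. l z * d (inverse z))"
    by (simp only: sum_distrib_left)
  finally show ?thesis
    unfolding borel_mult_def U_lin_char_orthogonality[OF l c] U_lin_char_orthogonality[OF l d]
    using q by (auto simp: power2_eq_square)
qed

lemma borel_mult_twist:
  fixes \<chi> :: "'f::{field,finite} mat \<Rightarrow> complex"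
  assumes l: "l \<in> U.lin_chars"
  shows "borel_mult c d (GL2.twist \<chi> (det_char l)) =
    borel_mult (U.twist c (U.lin_inv l)) (U.twist d (U.lin_inv l)) \<chi>"
proof -
  have inv: "U.lin_inv l (inverse x) = l x" if "x \<noteq> 0" for x
    using that by (simp add: U.lin_inv_def U_char_inverse[OF l])
  have "(\<Sum>x\<in>- {0}. \<Sum>z\<in>- {0}. \<Sum>y\<in>UNIV. c (inverse x) * d (inverse z) * GL2.twist \<chi> (det_char l) (M2 x y 0 z)) =
    (\<Sum>x\<in>- {0}. \<Sum>z\<in>- {0}. \<Sum>y\<in>UNIV. U.twist c (U.lin_inv l) (inverse x) * U.twist d (U.lin_inv l) (inverse z) * \<chi> (M2 x y 0 z))"
    by (intro sum.cong refl) (simp add: GL2.twist_def U.twist_def det_char_diag U_char_mult[OF l] inv)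
  then show ?thesis by (simp only: borel_mult_def)
qed

section \<open>Principal series\<close>

definition generic_chars :: "('f::{field,finite} mat \<Rightarrow> complex) set" where
  "generic_chars = GL2.irr_chars - GL2.lin_chars"

text \<open>Among the constituents of the representation induced from \<open>(c, d)\<close> exactly one is not linear. What
  remains of the total degree \<open>q + 1\<close> is due to a linear character extending \<open>(c, d)\<close>, which exists only
  if \<open>c = d\<close>.\<close>
lemma principal_series:
  fixes c d :: "'f::{field,finite} \<Rightarrow> complex"
  assumes q: "CARD('f) > 2" and c: "c \<in> U.lin_chars" and d: "d \<in> U.lin_chars"
  obtains \<pi> :: "'f mat \<Rightarrow> complex" where "\<pi> \<in> generic_chars" "borel_mult c d \<pi> = 1"
    "\<And>\<chi>. \<chi> \<in> generic_chars \<Longrightarrow> borel_mult c d \<chi> \<noteq> 0 \<Longrightarrow> \<chi> = \<pi>"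
    "degree_char \<pi> = of_nat CARD('f) + (if c = d then 0 else 1)"
proof -
  let ?X = "generic_chars :: ('f mat \<Rightarrow> complex) set"
  let ?I = "GL2.irr_chars :: ('f mat \<Rightarrow> complex) set"
  have fin: "finite ?X" using GL2.finite_irr_chars by (simp add: generic_chars_def)
  obtain e where e: "\<And>\<chi>. \<chi> \<in> ?I \<Longrightarrow> borel_mult c d \<chi> = of_nat (e \<chi>)"
    using Nats_valued[of ?I "borel_mult c d"] borel_mult_nat[OF _ c d] by blast
  \<comment> \<open>On non-linear characters the Whittaker multiplicity is one, on linear ones it is zero.\<close>
  have "(of_nat (\<Sum>\<chi>\<in>?X. e \<chi>) :: complex) = (\<Sum>\<chi>\<in>?X. whittaker_mult \<chi> * borel_mult c d \<chi>)"
    by (auto simp: generic_chars_def whittaker_one[OF q] e intro!: sum.cong)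
  also have "\<dots> = (\<Sum>\<chi>\<in>?I. whittaker_mult \<chi> * borel_mult c d \<chi>)"
    by (rule sum.mono_neutral_left)
      (use GL2.finite_irr_chars whittaker_zero_iff[OF q] in \<open>auto simp: generic_chars_def\<close>)
  also have "\<dots> = of_nat 1" by (simp add: sum_whittaker_borel_mult[OF c d])
  finally have "(\<Sum>\<chi>\<in>?X. e \<chi>) = 1" by (simp only: of_nat_eq_iff)
  then obtain \<pi> where \<pi>: "\<pi> \<in> ?X" "e \<pi> = 1" and others: "\<And>\<chi>. \<chi> \<in> ?X \<Longrightarrow> \<chi> \<noteq> \<pi> \<Longrightarrow> e \<chi> = 0"
    using sum_eq_1_iff[OF fin, of e] by metis
  have bm: "borel_mult c d \<chi> = (if \<chi> = \<pi> then 1 else 0)" if "\<chi> \<in> ?X" for \<chi>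
    using e[of \<chi>] others[of \<chi>] that \<pi> by (auto simp: generic_chars_def)
  have "of_nat CARD('f) + 1 = (\<Sum>\<chi>\<in>?I. degree_char \<chi> * borel_mult c d \<chi>)"
    by (simp add: sum_degree_borel_mult[OF c d])
  also have "\<dots> = (\<Sum>\<chi>\<in>?X. degree_char \<chi> * borel_mult c d \<chi>) + (\<Sum>\<chi>\<in>GL2.lin_chars. degree_char \<chi> * borel_mult c d \<chi>)"
    unfolding generic_chars_def
    by (rule sum.subset_diff) (use GL2.lin_chars_subset GL2.finite_irr_chars in auto)
  also have "(\<Sum>\<chi>\<in>?X. degree_char \<chi> * borel_mult c d \<chi>) = (\<Sum>\<chi>\<in>?X. if \<chi> = \<pi> then degree_char \<pi> else 0)"
    by (rule sum.cong) (auto simp: bm)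
  also have "\<dots> = degree_char \<pi>" using fin \<pi> by simp
  also have "(\<Sum>\<chi>\<in>GL2.lin_chars. degree_char \<chi> * borel_mult c d (\<chi> :: 'f mat \<Rightarrow> complex)) =
      (\<Sum>l\<in>U.lin_chars. borel_mult c d (det_char (l :: 'f \<Rightarrow> complex)))"
    unfolding GL2_lin_chars[OF q]
    by (subst sum.reindex[OF inj_det_char]) (simp add: degree_lin[OF det_char_lin])
  also have "\<dots> = (\<Sum>l\<in>U.lin_chars. if l = c then (if c = d then 1 else 0) else 0)"
    by (rule sum.cong) (auto simp: borel_mult_det_char[OF c d])
  also have "\<dots> = (if c = d then 1 else 0)" using c by simp
  finally have "degree_char \<pi> = of_nat CARD('f) + (if c = d then 0 else 1)"
    by (auto simp: algebra_simps)
  then show ?thesis using that[OF \<pi>(1)] bm \<pi>(1) by (metis (full_types))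
qed

lemma cuspidal_degree:
  fixes \<chi> :: "'f::{field,finite} mat \<Rightarrow> complex"
  assumes q: "CARD('f) > 2" and \<chi>: "\<chi> \<in> generic_chars"
    and zero: "\<And>c d. c \<in> U.lin_chars \<Longrightarrow> d \<in> U.lin_chars \<Longrightarrow> borel_mult c d \<chi> = 0"
  shows "degree_char \<chi> = of_nat CARD('f) - 1"
  using sum_all_borel_mult[of \<chi>] whittaker_one[OF q, of \<chi>] \<chi> zero by (simp add: generic_chars_def)

text \<open>For degree \<open>q + 1\<close> the space of unipotent invariants has dimension two, which \<open>(c, d)\<close> and \<open>(d, c)\<close>
  already exhaust.\<close>
lemma principal_series_pairs:
  fixes \<chi> :: "'f::{field,finite} mat \<Rightarrow> complex"
  assumes q: "CARD('f) > 2" and \<chi>: "\<chi> \<in> generic_chars"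
    and cd: "c \<in> U.lin_chars" "d \<in> U.lin_chars" "c \<noteq> d" "borel_mult c d \<chi> \<noteq> 0"
    and cd': "c' \<in> U.lin_chars" "d' \<in> U.lin_chars" "borel_mult c' d' \<chi> \<noteq> 0"
  shows "(c', d') = (c, d) \<or> (c', d') = (d, c)"
proof (rule ccontr)
  assume not: "\<not> ?thesis"
  let ?L = "U.lin_chars :: ('f \<Rightarrow> complex) set"
  have irr: "\<chi> \<in> GL2.irr_chars" "\<chi> \<notin> GL2.lin_chars" using \<chi> by (auto simp: generic_chars_def)
  have "borel_mult (fst p) (snd p) \<chi> \<in> \<nat>" if "p \<in> ?L \<times> ?L" for p
    using borel_mult_nat[OF irr(1)] that by auto
  then obtain e where e: "\<And>p. p \<in> ?L \<times> ?L \<Longrightarrow> borel_mult (fst p) (snd p) \<chi> = of_nat (e p)"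
    using Nats_valued[of "?L \<times> ?L" "\<lambda>p. borel_mult (fst p) (snd p) \<chi>"] by blast
  obtain \<pi> where "\<And>\<phi>. \<phi> \<in> generic_chars \<Longrightarrow> borel_mult c d \<phi> \<noteq> 0 \<Longrightarrow> \<phi> = \<pi>"
    "degree_char \<pi> = of_nat CARD('f) + (if c = d then 0 else 1)"
    using principal_series[OF q cd(1,2)] by metis
  then have deg: "degree_char \<chi> = of_nat CARD('f) + 1" using \<chi> cd by auto
  have "(of_nat (\<Sum>p\<in>?L \<times> ?L. e p) :: complex) = (\<Sum>c\<in>?L. \<Sum>d\<in>?L. borel_mult c d \<chi>)"
    by (simp add: sum.cartesian_product split_def e)
  also have "\<dots> = of_nat 2"
    unfolding sum_all_borel_mult[OF irr(1)] deg whittaker_one[OF q irr] by simp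
  finally have two: "(\<Sum>p\<in>?L \<times> ?L. e p) = 2" by (simp only: of_nat_eq_iff)
  have "borel_mult d c \<chi> \<noteq> 0" using cd(4) borel_mult_commute[OF irr(1)] by metis
  then have ge: "1 \<le> e (c, d)" "1 \<le> e (d, c)" "1 \<le> e (c', d')"
    using e[of "(c, d)"] e[of "(d, c)"] e[of "(c', d')"] cd cd' by (auto simp: Suc_le_eq intro!: Nat.gr0I)
  \<comment> \<open>A third pair would make the invariants at least three-dimensional.\<close>
  have "3 \<le> (\<Sum>p\<in>{(c, d), (d, c), (c', d')}. e p)" using ge cd(3) not by auto
  also have "\<dots> \<le> (\<Sum>p\<in>?L \<times> ?L. e p)" using cd cd' by (intro sum_mono2) auto
  finally show False using two by simp
qed

text \<open>Every fibre is an orbit of the involution, and orbits of length one are counted twice on the right.\<close>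
lemma double_card_image_involution:
  assumes fin: "finite A" and inv: "\<And>x. x \<in> A \<Longrightarrow> i x \<in> A" "\<And>x. x \<in> A \<Longrightarrow> i (i x) = x"
    and fib: "\<And>x y. x \<in> A \<Longrightarrow> y \<in> A \<Longrightarrow> f x = f y \<longleftrightarrow> y = x \<or> y = i x"
  shows "2 * card (f ` A) = card A + card {x \<in> A. i x = x}"
proof -
  have "card A + card {x \<in> A. i x = x} = (\<Sum>x\<in>A. 1 + (if i x = x then 1 else 0))"
    using fin by (simp add: sum_Suc sum.If_cases Collect_conj_eq Int_commute)
  also have "\<dots> = (\<Sum>y\<in>f ` A. \<Sum>x\<in>{x \<in> A. f x = y}. 1 + (if i x = x then 1 else 0))"
    by (rule sum.image_gen[OF fin])
  also have "\<dots> = (\<Sum>y\<in>f ` A. 2)"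
  proof (rule sum.cong[OF refl])
    fix y assume "y \<in> f ` A"
    then obtain a where a: "a \<in> A" "y = f a" by blast
    have "f a = f (i a)" using fib[OF a(1) inv(1)[OF a(1)]] by simp
    moreover have "x = a \<or> x = i a" if "x \<in> A" "f x = y" for x using fib[OF a(1) that(1)] that a(2) by simp
    ultimately have "{x \<in> A. f x = y} = {a, i a}" using a inv(1)[OF a(1)] by auto
    then show "(\<Sum>x\<in>{x \<in> A. f x = y}. 1 + (if i x = x then 1 else 0)) = (2 :: nat)"
      using inv(2)[OF a(1)] by (cases "i a = a") auto
  qed
  finally show ?thesis by simp
qed

section \<open>Twist orbits by degree\<close>

definition orbits_of_degree :: "complex \<Rightarrow> ('f::{field,finite} mat \<Rightarrow> complex) set set" where
  "orbits_of_degree n = GL2.twist_orbit ` {\<chi> \<in> GL2.irr_chars. degree_char \<chi> = n}"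

lemma twist_count_orbits: "twist_count (GL2 :: 'f::{field,finite} mat monoid) n = card (orbits_of_degree (of_nat n) :: ('f mat \<Rightarrow> complex) set set)"
  using GL2.twist_isoclasses_count(2)[where 'f = 'f, of n] by (simp add: orbits_of_degree_def degree_char_def)

lemma degree_twist: "l \<in> GL2.lin_chars \<Longrightarrow> degree_char (GL2.twist \<chi> l) = degree_char \<chi>"
  using degree_lin[of l] by (simp add: degree_char_def GL2.twist_def)

lemma degree_orbit:
  assumes "\<chi> \<in> GL2.irr_chars" "\<phi> \<in> GL2.irr_chars" "GL2.twist_orbit \<chi> = GL2.twist_orbit \<phi>"
  shows "degree_char \<chi> = degree_char \<phi>"
  using assms GL2.twist_orbit_eq_iff[OF assms(1,2)] degree_twist by auto

lemma finite_orbits_of_degree: "finite (orbits_of_degree n :: ('f::{field,finite} mat \<Rightarrow> complex) set set)"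
  using GL2.finite_irr_chars[where 'f = 'f] by (simp add: orbits_of_degree_def)

text \<open>The linear characters factor through the determinant, so only conjugacy classes of determinant one
  contribute to the orbit count.\<close>
lemma card_all_orbits:
  assumes q: "CARD('f::{field,finite}) > 2"
  shows "card (GL2.twist_orbit ` (GL2.irr_chars :: ('f mat \<Rightarrow> complex) set)) = CARD('f) + card {z :: 'f. z^2 = 1}"
proof -
  let ?N = "card (carrier (GL2 :: 'f mat monoid))"
  let ?O = "card (GL2.twist_orbit ` (GL2.irr_chars :: ('f mat \<Rightarrow> complex) set))"
  let ?C = "\<lambda>g :: 'f mat. card {h \<in> carrier GL2. h * g = g * h}"
  have lin: "(\<Sum>l\<in>GL2.lin_chars. l g) = (if Determinant.det g = 1 then of_nat (CARD('f) - 1) else 0)"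
    if g: "g \<in> carrier GL2" for g :: "'f mat"
  proof -
    have "(\<Sum>l\<in>GL2.lin_chars. l g) = (\<Sum>c\<in>U.lin_chars. c (Determinant.det g))"
      unfolding GL2_lin_chars[OF q] using g by (subst sum.reindex[OF inj_det_char]) (simp add: det_char_def)
    then show ?thesis
      using U_sum_lin_chars[OF GL2_det_nonzero[OF g]] q by (simp add: of_nat_diff)
  qed
  have "(of_nat (?N * (CARD('f) - 1) * ?O) :: complex) =
      (\<Sum>g\<in>carrier GL2. (\<Sum>l\<in>GL2.lin_chars. l g) * of_nat (?C g))"
    using GL2.card_twist_orbits[where 'f = 'f] by (simp only: card_GL2_lin_chars[OF q] GL_mult)
  also have "\<dots> = (\<Sum>g\<in>carrier GL2. if Determinant.det g = 1 then of_nat ((CARD('f) - 1) * ?C g) else 0)"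
    by (rule sum.cong) (auto simp: lin)
  also have "\<dots> = (\<Sum>g | g \<in> carrier GL2 \<and> Determinant.det g = 1. of_nat ((CARD('f) - 1) * ?C g))"
    by (simp add: sum.inter_filter[symmetric] finite_GL2)
  also have "\<dots> = of_nat ((CARD('f) - 1) * (\<Sum>g | g \<in> carrier GL2 \<and> Determinant.det g = 1. ?C g))"
    by (simp add: sum_distrib_left)
  also have "(\<Sum>g | g \<in> carrier GL2 \<and> Determinant.det g = 1. ?C g) = ?N * (CARD('f) + card {z :: 'f. z^2 = 1})"
    by (rule sum_centralizers_det) simp
  finally have "?N * (CARD('f) - 1) * ?O = (CARD('f) - 1) * (?N * (CARD('f) + card {z :: 'f. z^2 = 1}))"
    by (simp only: of_nat_eq_iff)
  then have "(?N * (CARD('f) - 1)) * ?O = (?N * (CARD('f) - 1)) * (CARD('f) + card {z :: 'f. z^2 = 1})"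
    by (simp only: mult_ac)
  moreover have "?N * (CARD('f) - 1) \<noteq> 0" using GL2.card_carrier_pos[where 'f = 'f] q by (simp del: GL2.finite_carrier)
  ultimately show ?thesis by (simp only: mult_cancel1 simp_thms)
qed

lemma orbit_lin_chars:
  fixes l :: "'f::{field,finite} mat \<Rightarrow> complex"
  assumes l: "l \<in> GL2.lin_chars"
  shows "GL2.twist_orbit l = GL2.lin_chars"
proof (intro equalityI subsetI)
  fix k :: "'f mat \<Rightarrow> complex" assume k: "k \<in> GL2.lin_chars"
  have "k = GL2.twist (GL2.twist k (GL2.lin_inv l)) l"
    using GL2.twist_cancel(2)[OF l, of k] GL2.lin_char_outside[OF k] by simp
  also have "\<dots> = GL2.twist l (GL2.twist k (GL2.lin_inv l))" by (rule GL2.twist_commute)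
  finally show "k \<in> GL2.twist_orbit l"
    unfolding GL2.twist_orbit_def using GL2.twist_lin[OF k GL2.lin_inv[OF l]] by blast
qed (use l GL2.twist_lin in \<open>auto simp: GL2.twist_orbit_def\<close>)

lemma card_orbits_degree_one: "card (orbits_of_degree 1 :: ('f::{field,finite} mat \<Rightarrow> complex) set set) = 1"
proof -
  have "{\<chi> \<in> GL2.irr_chars. degree_char \<chi> = 1} = (GL2.lin_chars :: ('f mat \<Rightarrow> complex) set)"
    using GL2.lin_chars_irr[where 'f = 'f] by (simp add: degree_char_def)
  moreover have "GL2.twist_orbit ` (GL2.lin_chars :: ('f mat \<Rightarrow> complex) set) = {GL2.lin_chars}"
    using orbit_lin_chars GL2.lin_triv by auto
  ultimately show ?thesis by (simp add: orbits_of_degree_def)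
qed

lemma generic_twist:
  assumes \<chi>: "\<chi> \<in> generic_chars" and l: "l \<in> U.lin_chars"
  shows "GL2.twist \<chi> (det_char l) \<in> generic_chars"
proof -
  note dl = det_char_lin[OF l]
  have irr: "\<chi> \<in> GL2.irr_chars" "\<chi> \<notin> GL2.lin_chars" using \<chi> by (auto simp: generic_chars_def)
  have "degree_char \<chi> \<noteq> 1" using irr by (auto simp: GL2.lin_chars_irr degree_char_def)
  then have "GL2.twist \<chi> (det_char l) \<notin> GL2.lin_chars" using degree_twist[OF dl, of \<chi>] degree_lin by metis
  then show ?thesis using GL2.twist_irr[OF irr(1) dl] by (simp add: generic_chars_def)
qed

text \<open>The unipotent invariants have dimension \<open>0\<close>, \<open>1\<close> or \<open>2\<close>; they add to the \<open>q - 1\<close> dimensions coming from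
  the nontrivial characters of the unipotent group.\<close>
lemma degree_cases:
  fixes \<chi> :: "'f::{field,finite} mat \<Rightarrow> complex"
  assumes q: "CARD('f) > 2" and \<chi>: "\<chi> \<in> generic_chars"
  obtains (cuspidal) "degree_char \<chi> = of_nat CARD('f) - 1"
  | (steinberg) c where "c \<in> U.lin_chars" "borel_mult c c \<chi> \<noteq> 0" "degree_char \<chi> = of_nat CARD('f)"
  | (principal) c d where "c \<in> U.lin_chars" "d \<in> U.lin_chars" "c \<noteq> d" "borel_mult c d \<chi> \<noteq> 0"
      "degree_char \<chi> = of_nat CARD('f) + 1"
proof (cases "\<exists>c\<in>U.lin_chars. \<exists>d\<in>U.lin_chars. borel_mult c d \<chi> \<noteq> 0")
  case True
  then obtain c d where cd: "c \<in> U.lin_chars" "d \<in> U.lin_chars" "borel_mult c d \<chi> \<noteq> 0" by blast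
  obtain \<pi> where "\<And>\<phi>. \<phi> \<in> generic_chars \<Longrightarrow> borel_mult c d \<phi> \<noteq> 0 \<Longrightarrow> \<phi> = \<pi>"
    "degree_char \<pi> = of_nat CARD('f) + (if c = d then 0 else 1)"
    using principal_series[OF q cd(1,2)] by metis
  then have "degree_char \<chi> = of_nat CARD('f) + (if c = d then 0 else 1)" using \<chi> cd(3) by blast
  then show ?thesis using steinberg principal cd by (cases "c = d") auto
next
  case False
  then show ?thesis using cuspidal cuspidal_degree[OF q \<chi>] by blast
qed

lemma principal_series_unique:
  fixes \<chi> \<phi> :: "'f::{field,finite} mat \<Rightarrow> complex"
  assumes q: "CARD('f) > 2" and "c \<in> U.lin_chars" "d \<in> U.lin_chars"
    and "\<chi> \<in> generic_chars" "borel_mult c d \<chi> \<noteq> 0" "\<phi> \<in> generic_chars" "borel_mult c d \<phi> \<noteq> 0"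
  shows "\<chi> = \<phi>"
  using principal_series[OF q assms(2,3)] assms(4-) by metis

text \<open>Twisting by the inverse of \<open>d\<close> moves the pair \<open>(c, d)\<close> to \<open>(c / d, 1)\<close>.\<close>
lemma orbit_normalise:
  fixes \<chi> :: "'f::{field,finite} mat \<Rightarrow> complex"
  assumes q: "CARD('f) > 2" and \<chi>: "\<chi> \<in> generic_chars"
    and c: "c \<in> U.lin_chars" and d: "d \<in> U.lin_chars" and nz: "borel_mult c d \<chi> \<noteq> 0"
    and \<pi>: "\<pi> \<in> generic_chars" "borel_mult (U.twist c (U.lin_inv d)) U.lin_triv \<pi> \<noteq> 0"
  shows "GL2.twist_orbit \<chi> = GL2.twist_orbit \<pi>"
proof -
  let ?i = "U.lin_inv d"
  have i: "?i \<in> U.lin_chars" by (rule U.lin_inv[OF d])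
  let ?t = "GL2.twist \<chi> (det_char ?i)"
  have inv_inv: "U.lin_inv ?i = d"
    using U.lin_char_outside[OF d] by (auto simp: U.lin_inv_def)
  have "borel_mult (U.twist c ?i) U.lin_triv ?t = borel_mult (U.twist (U.twist c ?i) d) (U.twist U.lin_triv d) \<chi>"
    unfolding borel_mult_twist[OF i] inv_inv ..
  also have "U.twist (U.twist c ?i) d = c" using U.twist_cancel(2)[OF d, of c] U.lin_char_outside[OF c] by blast
  also have "U.twist U.lin_triv d = d"
    using U.twist_triv[of d] U.lin_char_outside[OF d] U.twist_commute[of d] by metis
  finally have "borel_mult (U.twist c ?i) U.lin_triv ?t \<noteq> 0" using nz by simp
  then have "?t = \<pi>"
    using principal_series_unique[OF q U.twist_lin[OF c i] U.lin_triv generic_twist[OF \<chi> i] _ \<pi>] by blast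
  then show ?thesis
    using GL2.twist_orbit_twist[of \<chi>, OF _ det_char_lin[OF i]] \<chi> by (simp add: generic_chars_def)
qed

lemma card_orbits_steinberg:
  assumes q: "CARD('f::{field,finite}) > 2"
  shows "card (orbits_of_degree (of_nat CARD('f)) :: ('f mat \<Rightarrow> complex) set set) = 1"
proof -
  let ?q = "of_nat CARD('f) :: complex"
  obtain \<pi> :: "'f mat \<Rightarrow> complex" where \<pi>: "\<pi> \<in> generic_chars" "borel_mult U.lin_triv U.lin_triv \<pi> = 1"
    "degree_char \<pi> = ?q"
    using principal_series[OF q U.lin_triv U.lin_triv] by (metis (full_types) add.right_neutral)
  have "GL2.twist_orbit \<chi> = GL2.twist_orbit \<pi>" if \<chi>: "\<chi> \<in> GL2.irr_chars" "degree_char \<chi> = ?q" for \<chi>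
  proof -
    have "?q \<noteq> 1" using q by (metis less_numeral_extra(4) of_nat_eq_1_iff one_less_numeral_iff order_less_trans semiring_norm(76))
    then have gen: "\<chi> \<in> generic_chars" using \<chi> degree_lin[of \<chi>] by (auto simp: generic_chars_def)
    then show ?thesis
    proof (cases rule: degree_cases[OF q, consumes 1, case_names cuspidal steinberg principal])
      case (steinberg c)
      have "U.twist c (U.lin_inv c) = U.lin_triv" by (rule U.twist_lin_inv[OF steinberg(1)])
      then show ?thesis using orbit_normalise[OF q gen steinberg(1,1,2) \<pi>(1)] \<pi>(2) by simp
    qed (use \<chi> in auto)
  qed
  then have "orbits_of_degree ?q \<subseteq> {GL2.twist_orbit \<pi>}" by (auto simp: orbits_of_degree_def)
  moreover have "GL2.twist_orbit \<pi> \<in> orbits_of_degree ?q"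
    using \<pi>(1,3) unfolding orbits_of_degree_def generic_chars_def by blast
  ultimately have "orbits_of_degree ?q = {GL2.twist_orbit \<pi>}" by blast
  then show ?thesis by simp
qed

text \<open>The linear characters of order at most two are counted by summing the inner products of \<open>c\<close> with its
  inverse, which amounts to summing \<open>c (x * x)\<close> over all \<open>x\<close> and \<open>c\<close>.\<close>
lemma card_involutive_lin_chars:
  "card {c \<in> U.lin_chars. U.lin_inv c = (c :: 'f::{field,finite} \<Rightarrow> complex)} = card {z :: 'f. z^2 = 1}"
proof -
  let ?q = "of_nat CARD('f) :: complex"
  have q1: "?q - 1 \<noteq> 0" using card_field_gt_1[where 'f = 'f] by simp
  have inv: "U.lin_inv c (inverse x) = c x" if "c \<in> U.lin_chars" "x \<noteq> 0" for c and x :: 'f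
    using that by (simp add: U.lin_inv_def U_char_inverse)
  have "(?q - 1) * of_nat (card {c \<in> U.lin_chars. U.lin_inv c = (c :: 'f \<Rightarrow> complex)}) =
      (\<Sum>c\<in>U.lin_chars. if c = U.lin_inv (c :: 'f \<Rightarrow> complex) then ?q - 1 else 0)"
  proof -
    have "{c \<in> U.lin_chars. U.lin_inv c = (c :: 'f \<Rightarrow> complex)} = U.lin_chars \<inter> {c. c = U.lin_inv c}" by auto
    then show ?thesis by (simp add: sum.If_cases mult.commute)
  qed
  also have "\<dots> = (\<Sum>c\<in>U.lin_chars. \<Sum>x\<in>- {0 :: 'f}. c x * U.lin_inv c (inverse x))"
    by (intro sum.cong refl) (simp only: U_lin_char_orthogonality U.lin_inv)
  also have "\<dots> = (\<Sum>c\<in>U.lin_chars. \<Sum>x\<in>- {0 :: 'f}. c (x * x))"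
    by (intro sum.cong refl) (simp add: inv U_char_mult)
  also have "\<dots> = (\<Sum>x\<in>- {0 :: 'f}. \<Sum>c\<in>U.lin_chars. c (x * x))" by (rule sum.swap)
  also have "\<dots> = (\<Sum>x\<in>- {0 :: 'f}. if x * x = 1 then ?q - 1 else 0)"
    by (intro sum.cong refl) (simp add: U_sum_lin_chars)
  also have "\<dots> = (?q - 1) * of_nat (card {x \<in> - {0 :: 'f}. x * x = 1})"
  proof -
    have "{x \<in> - {0 :: 'f}. x * x = 1} = - {0} \<inter> {x. x * x = 1}" by auto
    then show ?thesis by (simp add: sum.If_cases mult.commute)
  qed
  also have "{x \<in> - {0 :: 'f}. x * x = 1} = {z. z^2 = 1}" by (auto simp: power2_eq_square)
  finally show ?thesis using q1 by simp
qed

text \<open>Every orbit of degree \<open>q + 1\<close> contains the principal series \<open>P c\<close> with parameters \<open>(c, 1)\<close> for some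
  nontrivial \<open>c\<close>. The twist of \<open>P c\<close> by \<open>l\<close> contains the pairs \<open>(c l, l)\<close> and \<open>(l, c l)\<close> only. One of
  them has second entry \<open>1\<close> just for \<open>l = 1\<close> and for \<open>l = inverse c\<close>, so orbits correspond to the
  classes \<open>{c, inverse c}\<close>.\<close>
lemma card_orbits_principal:
  assumes q: "CARD('f::{field,finite}) > 2"
  shows "2 * card (orbits_of_degree (of_nat CARD('f) + 1) :: ('f mat \<Rightarrow> complex) set set) =
    (CARD('f) - 2) + (card {z :: 'f. z^2 = 1} - 1)"
proof -
  let ?q = "of_nat CARD('f) :: complex"
  let ?A = "U.lin_chars - {U.lin_triv} :: ('f \<Rightarrow> complex) set"
  have "\<forall>c\<in>?A. \<exists>\<pi> :: 'f mat \<Rightarrow> complex. \<pi> \<in> generic_chars \<and> borel_mult c U.lin_triv \<pi> \<noteq> 0 \<and> degree_char \<pi> = ?q + 1"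
  proof
    fix c assume c: "c \<in> ?A"
    then have "c \<in> U.lin_chars" "c \<noteq> U.lin_triv" by simp_all
    obtain \<pi> :: "'f mat \<Rightarrow> complex" where "\<pi> \<in> generic_chars" "borel_mult c U.lin_triv \<pi> = 1"
      "degree_char \<pi> = ?q + (if c = U.lin_triv then 0 else 1)"
      by (rule principal_series[OF q \<open>c \<in> U.lin_chars\<close> U.lin_triv])
    then show "\<exists>\<pi> :: 'f mat \<Rightarrow> complex. \<pi> \<in> generic_chars \<and> borel_mult c U.lin_triv \<pi> \<noteq> 0 \<and> degree_char \<pi> = ?q + 1"
      using \<open>c \<noteq> U.lin_triv\<close> by (intro exI[of _ \<pi>]) simp
  qed
  from bchoice[OF this] obtain P :: "('f \<Rightarrow> complex) \<Rightarrow> 'f mat \<Rightarrow> complex"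
    where P: "\<And>c. c \<in> ?A \<Longrightarrow> P c \<in> generic_chars" "\<And>c. c \<in> ?A \<Longrightarrow> borel_mult c U.lin_triv (P c) \<noteq> 0"
      "\<And>c. c \<in> ?A \<Longrightarrow> degree_char (P c) = ?q + 1" by blast
  let ?f = "\<lambda>c. GL2.twist_orbit (P c)"
  have Pirr: "P c \<in> GL2.irr_chars" if "c \<in> ?A" for c using P(1)[OF that] by (simp add: generic_chars_def)
  have trivtw: "U.twist U.lin_triv l = l" if "l \<in> U.lin_chars" for l :: "'f \<Rightarrow> complex"
    using U.twist_triv[of l] U.lin_char_outside[OF that] U.twist_commute[of l] by metis
  have quot_triv: "c = l" if "U.twist c (U.lin_inv l) = U.lin_triv" "c \<in> U.lin_chars" "l \<in> U.lin_chars" for c l :: "'f \<Rightarrow> complex"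
  proof -
    have "c = U.twist (U.twist c (U.lin_inv l)) l"
      using U.twist_cancel(2)[OF that(3), of c] U.lin_char_outside[OF that(2)] by simp
    then show ?thesis using trivtw[OF that(3)] that(1) by simp
  qed
  have inv_inv: "U.lin_inv (U.lin_inv c) = c" if "c \<in> U.lin_chars" for c :: "'f \<Rightarrow> complex"
    using U.lin_char_outside[OF that] by (auto simp: U.lin_inv_def)
  have inv_triv: "U.lin_inv U.lin_triv = (U.lin_triv :: 'f \<Rightarrow> complex)"
    by (auto simp: U.lin_inv_def U.lin_triv_def)
  have image: "orbits_of_degree (?q + 1) = ?f ` ?A"
  proof (intro equalityI subsetI)
    fix z :: "('f mat \<Rightarrow> complex) set" assume "z \<in> orbits_of_degree (?q + 1)"
    then obtain \<chi> where \<chi>: "\<chi> \<in> GL2.irr_chars" "degree_char \<chi> = ?q + 1" "z = GL2.twist_orbit \<chi>"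
      by (auto simp: orbits_of_degree_def)
    have gen: "\<chi> \<in> generic_chars" using \<chi>(1,2) degree_lin[of \<chi>] by (auto simp: generic_chars_def)
    then show "z \<in> ?f ` ?A"
    proof (cases rule: degree_cases[OF q, consumes 1, case_names cuspidal steinberg principal])
      case (principal c d)
      let ?c = "U.twist c (U.lin_inv d)"
      have "?c \<in> U.lin_chars" by (rule U.twist_lin[OF principal(1) U.lin_inv[OF principal(2)]])
      moreover have "?c \<noteq> U.lin_triv" using quot_triv[OF _ principal(1,2)] principal(3) by blast
      ultimately have c: "?c \<in> ?A" by simp
      have "z = ?f ?c" unfolding \<chi>(3) by (rule orbit_normalise[OF q gen principal(1,2,4) P(1)[OF c] P(2)[OF c]])
      then show ?thesis using c by blast
    next
      case cuspidal
      then have "?q - 1 = ?q + 1" using \<chi>(2) by simp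
      then show ?thesis by (simp add: algebra_simps)
    qed (use \<chi> in auto)
  qed (use P Pirr in \<open>auto simp: orbits_of_degree_def\<close>)
  have fib: "?f c = ?f c' \<longleftrightarrow> c' = c \<or> c' = U.lin_inv c" if c: "c \<in> ?A" and c': "c' \<in> ?A" for c c'
  proof
    assume "?f c = ?f c'"
    then obtain m where "m \<in> GL2.lin_chars" "P c = GL2.twist (P c') m"
      using GL2.twist_orbit_eq_iff[OF Pirr[OF c] Pirr[OF c']] by blast
    then obtain l where l: "l \<in> U.lin_chars" and tw: "P c = GL2.twist (P c') (det_char l)"
      using GL2_lin_chars[OF q] by auto
    note il = U.lin_inv[OF l]
    have "borel_mult (U.twist c (U.lin_inv l)) (U.twist U.lin_triv (U.lin_inv l)) (P c') \<noteq> 0"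
      using P(2)[OF c] unfolding tw borel_mult_twist[OF l] .
    then have "borel_mult (U.twist c (U.lin_inv l)) (U.lin_inv l) (P c') \<noteq> 0" by (simp add: trivtw[OF il])
    then have "(U.twist c (U.lin_inv l), U.lin_inv l) = (c', U.lin_triv) \<or>
        (U.twist c (U.lin_inv l), U.lin_inv l) = (U.lin_triv, c')"
      using principal_series_pairs[OF q P(1)[OF c'] _ U.lin_triv _ P(2)[OF c'], of "U.twist c (U.lin_inv l)" "U.lin_inv l"]
        c' c il U.twist_lin by blast
    then show "c' = c \<or> c' = U.lin_inv c"
    proof
      assume "(U.twist c (U.lin_inv l), U.lin_inv l) = (c', U.lin_triv)"
      then have "c' = U.twist c U.lin_triv" by auto
      then show ?thesis using U.twist_triv[of c] U.lin_char_outside[of c] c by blast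
    next
      assume "(U.twist c (U.lin_inv l), U.lin_inv l) = (U.lin_triv, c')"
      then show ?thesis using quot_triv[of c l] c l by auto
    qed
  next
    assume "c' = c \<or> c' = U.lin_inv c"
    then show "?f c = ?f c'"
    proof
      assume eq: "c' = U.lin_inv c"
      have cc: "c \<in> U.lin_chars" using c by blast
      have "borel_mult U.lin_triv c (P c) \<noteq> 0"
        using P(2)[OF c] borel_mult_commute[OF Pirr[OF c], of c U.lin_triv] by simp
      moreover have "U.twist U.lin_triv (U.lin_inv c) = c'" using trivtw[OF U.lin_inv[OF cc]] eq by simp
      ultimately show ?thesis
        using orbit_normalise[OF q P(1)[OF c] U.lin_triv cc _ P(1)[OF c']] P(2)[OF c'] by simp
    qed simp
  qed
  have inv_A: "U.lin_inv c \<in> ?A" if "c \<in> ?A" for c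
    using that U.lin_inv inv_inv[of c] inv_triv by (metis Diff_iff singletonD singletonI)
  have "2 * card (?f ` ?A) = card ?A + card {c \<in> ?A. U.lin_inv c = c}"
    by (rule double_card_image_involution) (use inv_A inv_inv fib in auto)
  moreover have "card ?A = CARD('f) - 2"
    by (simp add: U.lin_triv U_card_lin_chars)
  moreover have "{c \<in> ?A. U.lin_inv c = c} = {c \<in> U.lin_chars. U.lin_inv c = c} - {U.lin_triv}" by blast
  then have "card {c \<in> ?A. U.lin_inv c = c} = card {z :: 'f. z^2 = 1} - 1"
    using card_involutive_lin_chars[where 'f = 'f] U.lin_triv[where 'f = 'f] inv_triv by simp
  ultimately show ?thesis using image by simp
qed

lemma orbits_of_other_degree:
  assumes q: "CARD('f::{field,finite}) > 2"
    and n: "n \<notin> {1, of_nat CARD('f) - 1, of_nat CARD('f), of_nat CARD('f) + 1}"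
  shows "(orbits_of_degree n :: ('f mat \<Rightarrow> complex) set set) = {}"
proof -
  have "degree_char \<chi> \<noteq> n" if \<chi>: "\<chi> \<in> GL2.irr_chars" for \<chi> :: "'f mat \<Rightarrow> complex"
  proof (cases "\<chi> \<in> GL2.lin_chars")
    case True
    then show ?thesis using degree_lin n by auto
  next
    case False
    then have "\<chi> \<in> generic_chars" using \<chi> by (simp add: generic_chars_def)
    then show ?thesis by (cases rule: degree_cases[OF q, consumes 1, case_names cuspidal steinberg principal]) (use n in auto)
  qed
  then show ?thesis by (auto simp: orbits_of_degree_def)
qed

text \<open>Degrees are constant on orbits, so the total count is the sum over the four possible degrees; this
  determines the number of cuspidal orbits without constructing a cuspidal representation.\<close>
lemma card_orbits_total:
  assumes q: "CARD('f::{field,finite}) > 2"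
  shows "card (orbits_of_degree (of_nat CARD('f) - 1) :: ('f mat \<Rightarrow> complex) set set)
      + card (orbits_of_degree (of_nat CARD('f) + 1) :: ('f mat \<Rightarrow> complex) set set) + 2
    = CARD('f) + card {z :: 'f. z^2 = 1}"
proof -
  let ?O = "orbits_of_degree :: complex \<Rightarrow> ('f mat \<Rightarrow> complex) set set"
  let ?q = "of_nat CARD('f) :: complex"
  let ?D = "{1, ?q - 1, ?q, ?q + 1}"
  have ne: "?q \<noteq> 1" "?q - 1 \<noteq> 1"
  proof -
    have "?q = 1 \<longleftrightarrow> CARD('f) = 1" by simp
    then show "?q \<noteq> 1" using q by simp
    have "?q = of_nat 2 \<longleftrightarrow> CARD('f) = 2" by (rule of_nat_eq_iff)
    then show "?q - 1 \<noteq> 1" using q by (auto simp: algebra_simps)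
  qed
  have ne': "?q - 1 \<noteq> ?q + 1" by (simp add: algebra_simps)
  have all: "GL2.twist_orbit ` GL2.irr_chars = (\<Union>n\<in>?D. ?O n)"
  proof (intro equalityI subsetI)
    fix z assume "z \<in> GL2.twist_orbit ` (GL2.irr_chars :: ('f mat \<Rightarrow> complex) set)"
    then obtain \<chi> where "\<chi> \<in> GL2.irr_chars" "z = GL2.twist_orbit \<chi>" by blast
    then have z: "z \<in> ?O (degree_char \<chi>)" by (auto simp: orbits_of_degree_def)
    then have "degree_char \<chi> \<in> ?D" using orbits_of_other_degree[OF q] by (metis empty_iff)
    then show "z \<in> (\<Union>n\<in>?D. ?O n)" using z by blast
  qed (auto simp: orbits_of_degree_def)
  have disj: "?O m \<inter> ?O n = {}" if "m \<noteq> n" for m n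
  proof (rule ccontr)
    assume "?O m \<inter> ?O n \<noteq> {}"
    then obtain z where "z \<in> ?O m" "z \<in> ?O n" by blast
    then obtain \<chi> \<phi> where "\<chi> \<in> GL2.irr_chars" "degree_char \<chi> = m" "z = GL2.twist_orbit \<chi>"
      "\<phi> \<in> GL2.irr_chars" "degree_char \<phi> = n" "z = GL2.twist_orbit \<phi>"
      by (auto simp: orbits_of_degree_def)
    then show False using degree_orbit[of \<chi> \<phi>] that by simp
  qed
  have "card (\<Union>n\<in>?D. ?O n) = (\<Sum>n\<in>?D. card (?O n))"
    by (rule card_UN_disjoint) (auto simp: finite_orbits_of_degree disj)
  also have "\<dots> = 2 + card (?O (?q - 1)) + card (?O (?q + 1))"
    using ne ne' by (simp add: card_orbits_degree_one card_orbits_steinberg[OF q])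
  finally show ?thesis using card_all_orbits[OF q] all by simp
qed

lemma card_square_roots_one:
  "card {z :: 'f::{field,finite}. z^2 = 1} = (if CHAR('f) = 2 then 1 else 2)"
proof -
  have roots: "{z :: 'f. z^2 = 1} = {1, - 1}" by (auto simp: power2_eq_1_iff)
  have "(1 :: 'f) = - 1 \<longleftrightarrow> CHAR('f) = 2"
  proof -
    have "(1 :: 'f) = - 1 \<longleftrightarrow> of_nat 2 = (0 :: 'f)" by (simp add: eq_neg_iff_add_eq_0)
    also have "\<dots> \<longleftrightarrow> CHAR('f) dvd 2" by (rule of_nat_eq_0_iff_char_dvd)
    also have "\<dots> \<longleftrightarrow> CHAR('f) = 2"
      using CHAR_not_1'[where 'a = 'f] two_is_prime_nat by (auto simp: prime_nat_iff)
    finally show ?thesis .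
  qed
  moreover have "card {1 :: 'f, - 1} = (if (1 :: 'f) = - 1 then 1 else 2)"
    by (cases "(1 :: 'f) = - 1") (metis card.insert card.empty empty_iff finite.emptyI insert_absorb2 One_nat_def, simp)
  ultimately show ?thesis unfolding roots by simp
qed

theorem lemma4p2:
  fixes q p :: nat and s :: complex
  assumes q: "CARD('f::{field,finite}) = q"
    and p: "CHAR('f) = p"
    and q_ne_2: "q \<noteq> 2"
  shows "(\<forall>i. finite (twist_isoclasses (GL TYPE('f) 2) i)) \<and>
    summable (\<lambda>i. twist_zeta_term (GL TYPE('f) 2) s (Suc i)) \<and>
    twist_zeta (GL TYPE('f) 2) s =
      (if p \<noteq> 2
       then 1 + of_nat q powr (- s)
            + 1 / 2 * (of_nat q - 1) * (of_nat q + 1) powr (- s)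
            + 1 / 2 * (of_nat q + 1) * (of_nat q - 1) powr (- s)
       else 1 + of_nat q powr (- s)
            + 1 / 2 * (of_nat q - 2) * (of_nat q + 1) powr (- s)
            + 1 / 2 * of_nat q * (of_nat q - 1) powr (- s))"
proof -
  have q2: "CARD('f) > 2" and q3: "q > 2" using card_field_gt_1[where 'f = 'f] q q_ne_2 by auto
  let ?t = "\<lambda>i. twist_zeta_term (GL2 :: 'f mat monoid) s (Suc i)"
  let ?O = "orbits_of_degree :: complex \<Rightarrow> ('f mat \<Rightarrow> complex) set set"
  let ?A = "card (?O (of_nat q - 1))" and ?B = "card (?O (of_nat q + 1))"
  let ?r = "card {z :: 'f. z^2 = 1}"
  have zero: "?t i = 0" if i: "i \<notin> {0, q - 2, q - 1, q}" for i
  proof -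
    have "Suc i \<noteq> 1" "Suc i + 1 \<noteq> q" "Suc i \<noteq> q" "Suc i \<noteq> q + 1" using i q3 by auto
    then have "of_nat (Suc i) \<noteq> (1 :: complex)" "of_nat (Suc i + 1) \<noteq> (of_nat q :: complex)"
      "of_nat (Suc i) \<noteq> (of_nat q :: complex)" "of_nat (Suc i) \<noteq> (of_nat (q + 1) :: complex)"
      unfolding of_nat_eq_iff of_nat_eq_1_iff by simp_all
    then have "of_nat (Suc i) \<notin> {1, of_nat CARD('f) - 1, of_nat CARD('f), of_nat CARD('f) + (1 :: complex)}"
      using q by (auto simp: algebra_simps)
    from orbits_of_other_degree[OF q2 this] show ?thesis
      by (simp only: twist_zeta_term_def twist_count_orbits) simp
  qed
  have sums: "?t sums (\<Sum>i\<in>{0, q - 2, q - 1, q}. ?t i)"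
    by (rule sums_finite) (use zero in auto)
  have c1: "?t 0 = 1"
    using card_orbits_degree_one[where 'f = 'f] by (simp add: twist_zeta_term_def twist_count_orbits)
  have c2: "?t (q - 2) = of_nat ?A * (of_nat q - 1) powr (- s)"
  proof -
    have "of_nat (Suc (q - 2)) = (of_nat q - 1 :: complex)" using q3 by (simp add: of_nat_diff)
    then show ?thesis by (simp only: twist_zeta_term_def twist_count_orbits)
  qed
  have c3: "?t (q - 1) = of_nat q powr (- s)"
    using card_orbits_steinberg[OF q2] q3 q by (simp add: twist_zeta_term_def twist_count_orbits)
  have c4: "?t q = of_nat ?B * (of_nat q + 1) powr (- s)"
    unfolding twist_zeta_term_def twist_count_orbits by (simp add: add.commute)
  have "(\<Sum>i\<in>{0, q - 2, q - 1, q}. ?t i) = ?t 0 + ?t (q - 2) + ?t (q - 1) + ?t q"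
  proof -
    have "0 \<notin> {q - 2, q - 1, q}" "q - 2 \<notin> {q - 1, q}" "q - 1 \<notin> {q}" using q3 by auto
    then show ?thesis by (simp del: One_nat_def)
  qed
  then have total: "(\<Sum>i\<in>{0, q - 2, q - 1, q}. ?t i) =
      1 + of_nat q powr (- s) + of_nat ?B * (of_nat q + 1) powr (- s) + of_nat ?A * (of_nat q - 1) powr (- s)"
    unfolding c1 c2 c3 c4 by (simp add: add_ac)
  have AB: "2 * ?B = (q - 2) + (?r - 1)" "?A + ?B + 2 = q + ?r"
    using card_orbits_principal[OF q2] card_orbits_total[OF q2] q by simp_all
  have r: "?r = (if p = 2 then 1 else 2)" using card_square_roots_one[where 'f = 'f] p by simp
  have "twist_zeta (GL2 :: 'f mat monoid) s =
      1 + of_nat q powr (- s) + of_nat ?B * (of_nat q + 1) powr (- s) + of_nat ?A * (of_nat q - 1) powr (- s)"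
    unfolding twist_zeta_def using sums_unique[OF sums] total by simp
  moreover have "of_nat ?B = (if p \<noteq> 2 then 1 / 2 * (of_nat q - 1) else 1 / 2 * (of_nat q - 2) :: complex)"
    "of_nat ?A = (if p \<noteq> 2 then 1 / 2 * (of_nat q + 1) else 1 / 2 * of_nat q :: complex)"
  proof -
    have nat_eq: "2 * ?B + (if p \<noteq> 2 then 1 else 2) = q" "2 * ?A = (if p \<noteq> 2 then q + 1 else q)"
      using AB r q3 by (auto split: if_splits)
    have "2 * of_nat ?B + (if p \<noteq> 2 then 1 else 2) = (of_nat (2 * ?B + (if p \<noteq> 2 then 1 else 2)) :: complex)"
      by simp
    then have "2 * of_nat ?B + (if p \<noteq> 2 then 1 else 2) = (of_nat q :: complex)" by (simp only: nat_eq(1))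
    moreover have "2 * of_nat ?A = (of_nat (2 * ?A) :: complex)" by simp
    then have "2 * of_nat ?A = (of_nat (if p \<noteq> 2 then q + 1 else q) :: complex)" by (simp only: nat_eq(2))
    then have "2 * of_nat ?A = (if p \<noteq> 2 then of_nat q + 1 else of_nat q :: complex)"
      by (cases "p = 2") (simp_all only: if_True if_False simp_thms of_nat_add of_nat_1)
    moreover have "x = 1 / 2 * (y - e)" if "2 * x + e = y" for x y e :: complex
      using that by auto
    moreover have "x = 1 / 2 * y" if "2 * x = y" for x y :: complex
      using that by auto
    ultimately show "of_nat ?B = (if p \<noteq> 2 then 1 / 2 * (of_nat q - 1) else 1 / 2 * (of_nat q - 2) :: complex)"
      "of_nat ?A = (if p \<noteq> 2 then 1 / 2 * (of_nat q + 1) else 1 / 2 * of_nat q :: complex)"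
      by (cases "p = 2"; simp only: if_True if_False simp_thms)+
  qed
  ultimately have "twist_zeta (GL2 :: 'f mat monoid) s = (if p \<noteq> 2
       then 1 + of_nat q powr (- s)
            + 1 / 2 * (of_nat q - 1) * (of_nat q + 1) powr (- s)
            + 1 / 2 * (of_nat q + 1) * (of_nat q - 1) powr (- s)
       else 1 + of_nat q powr (- s)
            + 1 / 2 * (of_nat q - 2) * (of_nat q + 1) powr (- s)
            + 1 / 2 * of_nat q * (of_nat q - 1) powr (- s))"
    by simp
  then show ?thesis using GL2.twist_isoclasses_count(1) sums_summable[OF sums] by blast
qed

end
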